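(* The quantum big cell $\mathcal{O}_q(U_{12})$ admits a coaction of $\mathcal{O}(P_{l,q})$ obtained by restricting the comultiplication of $\mathcal{O}(P_{l,q})$; that is, there is a well defined morphism $$\tilde\Delta:\mathcal{O}_q(U_{12})\longrightarrow \mathcal{O}(P_{l,q})\otimes\mathcal{O}_q(U_{12})$$ satisfying the coaction properties and given explicitly (summing over repeated indices) by $$\tilde\Delta t_{ij}=t_{ij}\otimes 1+y_{ia}S(x)_{bj}\otimes t_{ab}+y_{ia}\eta_aS(x)_{bj}\otimes\tilde\tau_{b},$$ $$\tilde\Delta\tilde\tau_j=(d\otimes1)(\tau_a\otimes1+\xi_b\otimes t_{ba}+1\otimes\tilde\tau_a)(S(x)_{aj}\otimes1).$$ Furthermore, this coaction goes down to a well defined coaction on $\mathcal{O}_q(U_{12})$ of the quantum super Poincaré group times dilations $\mathcal{O}(P_{l,q})/(\xi)$.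
   Context: Let $\mathbb{C}_q=\mathbb{C}[q,q^{-1}]$. The quantum matrix superalgebra is $M_q(4|1)=\mathbb{C}_q\langle g_{ij}\rangle/I_M$, $1\le i,j\le 5$ (odd entries are also written $\gamma_{ij}$), where $p(i)=0$ for $i\le 4$, $p(5)=1$, $\pi(g_{ij})=p(i)+p(j)$ is the parity of $g_{ij}$, and $I_M$ is generated by $$g_{ij}g_{il}=(-1)^{\pi(g_{ij})\pi(g_{il})}q^{(-1)^{p(i)+1}}g_{il}g_{ij},\quad j<l,$$ $$g_{ij}g_{kj}=(-1)^{\pi(g_{ij})\pi(g_{kj})}q^{(-1)^{p(j)+1}}g_{kj}g_{ij},\quad i<k,$$ $$g_{ij}g_{kl}=(-1)^{\pi(g_{ij})\pi(g_{kl})}g_{kl}g_{ij},\quad i<k,\ j>l\ \text{ or }\ i>k,\ j<l,$$ $$g_{ij}g_{kl}-(-1)^{\pi(g_{ij})\pi(g_{kl})}g_{kl}g_{ij}=(-1)^{\pi(g_{ij})\pi(g_{kj})}(q^{-1}-q)g_{kj}g_{il},\quad i<k,\ j<l,$$ and $g_{ij}^2=0$ for $g_{ij}$ odd. $\mathcal{O}(\mathrm{GL}_q(4|1))=M_q(4|1)\langle D_1^{-1},D_2^{-1}\rangle$, with $D_1^{-1},D_2^{-1}$ even two-sided inverses of $D_1=\sum_{\sigma\in S_4}(-q)^{-l(\sigma)}g_{1\sigma(1)}\cdots g_{4\sigma(4)}$ ($l(\sigma)$ the length) and $D_2=g_{55}$; it is a Hopf superalgebra with $\Delta(g_{ij})=\sum_kg_{ik}\otimes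 g_{kj}$, counit $\epsilon(g_{ij})=\delta_{ij}$, antipode $S$. Tensor products of superalgebras carry the usual sign rule. $\mathcal{O}(P_{l,q})=\mathcal{O}(\mathrm{GL}_q(4|1))/\mathcal{I}_q$, with $\mathcal{I}_q$ the two-sided ideal generated by $g_{13},g_{14},g_{23},g_{24},\gamma_{15},\gamma_{25}$; it is a Hopf superalgebra with inherited comultiplication. In it set $D_{ij}=g_{i1}g_{j2}-q^{-1}g_{i2}g_{j1}$ ($1\le i<j\le5$; $D_{12}$ is invertible) and $$x=\begin{pmatrix}g_{11}&g_{12}\\ g_{21}&g_{22}\end{pmatrix},\quad y=\begin{pmatrix}g_{33}&g_{34}\\ g_{43}&g_{44}\end{pmatrix},\quad d=g_{55},\quad t=\begin{pmatrix}-q^{-1}D_{23}D_{12}^{-1}&D_{13}D_{12}^{-1}\\ -q^{-1}D_{24}D_{12}^{-1}&D_{14}D_{12}^{-1}\end{pmatrix},$$ $$\tilde\tau=(-q^{-1}D_{25}D_{12}^{-1},\ D_{15}D_{12}^{-1}),\quad \xi=(g_{55}^{-1}\gamma_{53},\,g_{55}^{-1}\gamma_{54}),\quad \eta=y^{-1}\begin{pmatrix}\gamma_{35}\\ \gamma_{45}\end{pmatrix},\quad \tau=(g_{55}^{-1}\gamma_{51},\,g_{55}^{-1}\gamma_{52}),$$ so that $d\tau=\tilde\tau x$ and the generating matrix of $\mathcal{O}(P_{l,q})$ is $\begin{pmatrix}x&0&0\\ tx&y&y\eta\\ \tilde\tau x&d\xi&d\end{pmatrix}$. $S(x)$ is the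 matrix of antipodes $S(x_{ij})$, i.e. the inverse of $x$. The $2\times2$ matrices and vectors are indexed by position: rows of $t$, rows and columns of $y$, and entries of $\eta$ and $\xi$ by the pair of values corresponding to $3,4$; columns of $t$, rows and columns of $x$, and entries of $\tau,\tilde\tau$ by $1,2$. The quantum big cell $\mathcal{O}_q(U_{12})$ is the $\mathbb{C}_q$-subring of $\mathcal{O}(P_{l,q})$ generated by the entries of $t$ and $\tilde\tau$. The quantum super Poincaré group times dilations is the quotient $\mathcal{O}(P_{l,q})/(\xi)$ by the ideal generated by the entries of $\xi$, which is a Hopf ideal. *)

theory Defs
  imports Complex_Main "HOL-Library.Poly_Mapping" "HOL-Combinatorics.Permutations"
begin

section \<open>Superalgebras over the Laurent polynomials\<close>

type_synonym Cq = "int \<Rightarrow>\<^sub>0 complex"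

definition qpow :: "int \<Rightarrow> Cq" where
  "qpow n = Poly_Mapping.single n 1"

class cq_module = ab_group_add +
  fixes scaleq :: "Cq \<Rightarrow> 'a \<Rightarrow> 'a"  (infixr \<open>*\<^sub>q\<close> 75)
  assumes scaleq_add_right: "c *\<^sub>q (x + y) = c *\<^sub>q x + c *\<^sub>q y"
    and scaleq_add_left: "(b + c) *\<^sub>q x = b *\<^sub>q x + c *\<^sub>q x"
    and scaleq_scaleq: "b *\<^sub>q (c *\<^sub>q x) = (b * c) *\<^sub>q x"
    and scaleq_one: "1 *\<^sub>q x = x"

global_interpretation cq: module "scaleq :: Cq \<Rightarrow> 'a \<Rightarrow> 'a::cq_module"
  by standard (rule scaleq_add_right scaleq_add_left scaleq_scaleq scaleq_one)+

abbreviation cq_linear :: "('a::cq_module \<Rightarrow> 'b::cq_module) \<Rightarrow> bool" where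
  "cq_linear \<equiv> module_hom scaleq scaleq"

text \<open>
  The \<open>\<int>/2\<close>-grading is encoded by the projection \<open>evenp\<close> onto the even part along the odd
  part.  The base class \<open>ring_1\<close> is avoided because it would require \<open>0 \<noteq> 1\<close>.
\<close>

class cq_superalgebra = cq_module + ring + monoid_mult +
  fixes evenp :: "'a \<Rightarrow> 'a"
  assumes scaleq_mult_left: "(c *\<^sub>q x) * y = c *\<^sub>q (x * y)"
    and scaleq_mult_right: "x * (c *\<^sub>q y) = c *\<^sub>q (x * y)"
    and evenp_add: "evenp (x + y) = evenp x + evenp y"
    and evenp_scaleq: "evenp (c *\<^sub>q x) = c *\<^sub>q evenp x"
    and evenp_idem: "evenp (evenp x) = evenp x"
    and evenp_one: "evenp 1 = 1"
    and evenp_mult: "evenp (x * y) = evenp x * evenp y + (x - evenp x) * (y - evenp y)"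

definition oddp :: "'a::cq_superalgebra \<Rightarrow> 'a" where
  "oddp x = x - evenp x"

definition superalg_hom :: "('a::cq_superalgebra \<Rightarrow> 'b::cq_superalgebra) \<Rightarrow> bool" where
  "superalg_hom f \<longleftrightarrow> cq_linear f \<and> f 1 = 1 \<and> (\<forall>x y. f (x * y) = f x * f y)
     \<and> (\<forall>x. f (evenp x) = evenp (f x))"

lemma cq_linear_iff:
  "cq_linear f \<longleftrightarrow> (\<forall>x y. f (x + y) = f x + f y) \<and> (\<forall>c x. f (c *\<^sub>q x) = c *\<^sub>q f x)"
  by (auto simp: module_hom_iff cq.module_axioms)

lemma cq_linearI:
  "(\<And>x y. f (x + y) = f x + f y) \<Longrightarrow> (\<And>c x. f (c *\<^sub>q x) = c *\<^sub>q f x) \<Longrightarrow> cq_linear f"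
  by (simp add: cq_linear_iff)

lemma cq_linear_add: "cq_linear f \<Longrightarrow> f (x + y) = f x + f y"
  and cq_linear_scale: "cq_linear f \<Longrightarrow> f (c *\<^sub>q x) = c *\<^sub>q f x"
  by (simp_all add: cq_linear_iff)

lemma cq_linear_zero: "cq_linear f \<Longrightarrow> f 0 = 0"
  by (metis add_cancel_right_left cq_linear_iff)

lemma cq_linear_diff: "cq_linear f \<Longrightarrow> f (x - y) = f x - f y"
  by (metis add_diff_cancel_right' cq_linear_iff diff_add_cancel)

lemma evenp_linear: "cq_linear evenp"
  by (simp add: cq_linear_iff evenp_add evenp_scaleq)

lemma evenp_zero [simp]: "evenp 0 = 0"
  and evenp_diff: "evenp (x - y) = evenp x - evenp y"
  by (rule cq_linear_zero cq_linear_diff, rule evenp_linear)+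

lemma evenp_uminus: "evenp (- x) = - evenp x"
  by (metis evenp_diff evenp_zero diff_0)

lemma evenp_sum: "evenp (sum f A) = (\<Sum>i\<in>A. evenp (f i))"
  by (induction A rule: infinite_finite_induct) (auto simp: evenp_add)

lemma oddp_linear: "cq_linear oddp"
  by (simp add: cq_linear_iff oddp_def evenp_add evenp_scaleq algebra_simps
      cq.scale_right_diff_distrib)

lemma evenp_oddp [simp]: "evenp (oddp x) = 0"
  and oddp_evenp [simp]: "oddp (evenp x) = 0"
  and oddp_oddp [simp]: "oddp (oddp x) = oddp x"
  and even_plus_odd: "evenp x + oddp x = x"
  by (simp_all add: oddp_def evenp_diff evenp_idem)

lemma oddp_mult: "oddp (x * y) = evenp x * oddp y + oddp x * evenp y"
  by (simp add: oddp_def evenp_mult algebra_simps)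

lemma evenp_mult': "evenp (x * y) = evenp x * evenp y + oddp x * oddp y"
  by (simp add: oddp_def evenp_mult)

text \<open>For invertible \<open>a\<close>, the two-sided inverse; otherwise unspecified.\<close>

definition rinv :: "'a::monoid_mult \<Rightarrow> 'a" where
  "rinv a = (THE b. a * b = 1 \<and> b * a = 1)"

lemma rinv_eq:
  assumes "a * b = 1" "b * a = 1" shows "rinv a = b"
  unfolding rinv_def
proof (rule the_equality)
  show "c = b" if "a * c = 1 \<and> c * a = 1" for c
    by (metis assms that mult.assoc mult_1_left mult_1_right)
qed (use assms in auto)

lemma even_inverse:
  fixes a :: "'a::cq_superalgebra"
  assumes "a * b = 1" "b * a = 1" "evenp a = a" shows "evenp b = b"
proof -
  have "a * evenp b = 1"
    using arg_cong[OF assms(1), of evenp] assms(3) by (simp add: evenp_mult evenp_one)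
  then show ?thesis by (metis assms(2) mult.assoc mult_1_left mult_1_right)
qed

section \<open>Ideals and subalgebras\<close>

definition two_sided_ideal :: "'a::{ring,monoid_mult} set \<Rightarrow> bool" where
  "two_sided_ideal I \<longleftrightarrow> 0 \<in> I \<and> (\<forall>x\<in>I. \<forall>y\<in>I. x + y \<in> I) \<and> (\<forall>x\<in>I. \<forall>a. a * x \<in> I \<and> x * a \<in> I)"

definition ideal_gen :: "'a::{ring,monoid_mult} set \<Rightarrow> 'a set" where
  "ideal_gen S = two_sided_ideal hull S"

definition subalgebra :: "'a::cq_superalgebra set \<Rightarrow> bool" where
  "subalgebra B \<longleftrightarrow> 0 \<in> B \<and> 1 \<in> B \<and> (\<forall>x\<in>B. \<forall>y\<in>B. x + y \<in> B \<and> x * y \<in> B) \<and> (\<forall>x\<in>B. \<forall>c. c *\<^sub>q x \<in> B)"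

definition subalgebra_gen :: "'a::cq_superalgebra set \<Rightarrow> 'a set" where
  "subalgebra_gen S = subalgebra hull S"

lemma two_sided_ideal_gen: "two_sided_ideal (ideal_gen S)"
  unfolding ideal_gen_def by (rule hull_in) (auto simp: two_sided_ideal_def)

lemma ideal_gen_inc: "x \<in> S \<Longrightarrow> x \<in> ideal_gen S"
  unfolding ideal_gen_def by (rule hull_inc)

lemma ideal_gen_min: "S \<subseteq> I \<Longrightarrow> two_sided_ideal I \<Longrightarrow> ideal_gen S \<subseteq> I"
  unfolding ideal_gen_def by (rule hull_minimal)

lemma ideal_zero: "0 \<in> ideal_gen S"
  and ideal_add: "x \<in> ideal_gen S \<Longrightarrow> y \<in> ideal_gen S \<Longrightarrow> x + y \<in> ideal_gen S"
  and ideal_mult_left: "x \<in> ideal_gen S \<Longrightarrow> a * x \<in> ideal_gen S"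
  and ideal_mult_right: "x \<in> ideal_gen S \<Longrightarrow> x * a \<in> ideal_gen S"
  using two_sided_ideal_gen[of S] by (auto simp: two_sided_ideal_def)

lemma ideal_uminus: "x \<in> ideal_gen S \<Longrightarrow> - x \<in> ideal_gen S"
  using ideal_mult_left[of x S "- 1"] by simp

lemma ideal_diff: "x \<in> ideal_gen S \<Longrightarrow> y \<in> ideal_gen S \<Longrightarrow> x - y \<in> ideal_gen S"
  using ideal_add[of x S "- y"] ideal_uminus[of y S] by simp

lemma ideal_scaleq:
  fixes x :: "'a::cq_superalgebra"
  shows "x \<in> ideal_gen S \<Longrightarrow> c *\<^sub>q x \<in> ideal_gen S"
  using ideal_mult_left[of x S "c *\<^sub>q 1"] by (simp add: scaleq_mult_left)

lemma ideal_equivp: "equivp (\<lambda>x y. x - y \<in> ideal_gen S)"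
proof (rule equivpI)
  show "reflp (\<lambda>x y. x - y \<in> ideal_gen S)" by (simp add: reflp_def ideal_zero)
  show "symp (\<lambda>x y. x - y \<in> ideal_gen S)"
  proof (rule sympI)
    show "y - x \<in> ideal_gen S" if "x - y \<in> ideal_gen S" for x y
      using ideal_uminus[OF that] by simp
  qed
  show "transp (\<lambda>x y. x - y \<in> ideal_gen S)"
  proof (rule transpI)
    show "x - z \<in> ideal_gen S" if "x - y \<in> ideal_gen S" "y - z \<in> ideal_gen S" for x y z
      using ideal_add[OF that] by simp
  qed
qed

lemma ideal_cong_add:
  "a - b \<in> ideal_gen S \<Longrightarrow> c - d \<in> ideal_gen S \<Longrightarrow> (a + c) - (b + d) \<in> ideal_gen S"
  by (drule (1) ideal_add) (simp add: algebra_simps)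

lemma ideal_cong_diff:
  "a - b \<in> ideal_gen S \<Longrightarrow> c - d \<in> ideal_gen S \<Longrightarrow> (a - c) - (b - d) \<in> ideal_gen S"
  by (drule (1) ideal_diff) (simp add: algebra_simps)

lemma ideal_cong_uminus: "a - b \<in> ideal_gen S \<Longrightarrow> (- a) - (- b) \<in> ideal_gen S"
  by (drule ideal_uminus) (simp add: algebra_simps)

lemma ideal_cong_mult:
  assumes "a - b \<in> ideal_gen S" "c - d \<in> ideal_gen S" shows "a * c - b * d \<in> ideal_gen S"
proof -
  have "a * c - b * d = (a - b) * c + b * (c - d)" by (simp add: algebra_simps)
  then show ?thesis using assms by (metis ideal_add ideal_mult_left ideal_mult_right)
qed

lemma ideal_cong_scaleq:
  fixes a :: "'a::cq_superalgebra"
  shows "a - b \<in> ideal_gen S \<Longrightarrow> c *\<^sub>q a - c *\<^sub>q b \<in> ideal_gen S"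
  by (metis ideal_scaleq cq.scale_right_diff_distrib)

lemma ideal_cong_evenp:
  fixes a :: "'a::cq_superalgebra"
  assumes S: "\<And>s. s \<in> S \<Longrightarrow> evenp s = s \<or> evenp s = 0" and ab: "a - b \<in> ideal_gen S"
  shows "evenp a - evenp b \<in> ideal_gen S"
proof -
  let ?J = "{x \<in> ideal_gen S. evenp x \<in> ideal_gen S}"
  have J: "two_sided_ideal ?J"
    unfolding two_sided_ideal_def
    by (simp add: ideal_zero evenp_add evenp_mult ideal_add ideal_mult_left ideal_mult_right ideal_diff)
  have "x \<in> ?J" if "x \<in> S" for x
    using S[OF that] ideal_gen_inc[OF that] by (auto simp: ideal_zero)
  then have "S \<subseteq> ?J" by blast
  then have "ideal_gen S \<subseteq> ?J" using J by (rule ideal_gen_min)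
  then have "a - b \<in> ?J" using ab by blast
  then show ?thesis by (simp add: evenp_diff)
qed

lemma subalgebra_gen_subalgebra: "subalgebra (subalgebra_gen S)"
  unfolding subalgebra_gen_def by (rule hull_in) (auto simp: subalgebra_def)

lemma subalgebra_gen_inc: "x \<in> S \<Longrightarrow> x \<in> subalgebra_gen S"
  unfolding subalgebra_gen_def by (rule hull_inc)

lemma subalgebra_gen_closed:
  "0 \<in> subalgebra_gen S" "1 \<in> subalgebra_gen S"
  "x \<in> subalgebra_gen S \<Longrightarrow> y \<in> subalgebra_gen S \<Longrightarrow> x + y \<in> subalgebra_gen S"
  "x \<in> subalgebra_gen S \<Longrightarrow> y \<in> subalgebra_gen S \<Longrightarrow> x * y \<in> subalgebra_gen S"
  "x \<in> subalgebra_gen S \<Longrightarrow> c *\<^sub>q x \<in> subalgebra_gen S"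
  using subalgebra_gen_subalgebra[of S] by (auto simp: subalgebra_def)

lemma subalgebra_gen_uminus: "x \<in> subalgebra_gen S \<Longrightarrow> - x \<in> subalgebra_gen S"
  using subalgebra_gen_closed(5)[of x S "- 1"] by (simp add: scaleq_one)

lemma subalgebra_gen_diff:
  "x \<in> subalgebra_gen S \<Longrightarrow> y \<in> subalgebra_gen S \<Longrightarrow> x - y \<in> subalgebra_gen S"
  using subalgebra_gen_closed(3)[of x S "- y"] subalgebra_gen_uminus[of y S] by simp

lemma subalgebra_gen_evenp:
  assumes S: "\<And>s. s \<in> S \<Longrightarrow> evenp s = s \<or> evenp s = 0" and x: "x \<in> subalgebra_gen S"
  shows "evenp x \<in> subalgebra_gen S"
proof -
  let ?J = "{x \<in> subalgebra_gen S. evenp x \<in> subalgebra_gen S}"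
  have J: "subalgebra ?J"
    unfolding subalgebra_def
    by (simp add: subalgebra_gen_closed evenp_add evenp_mult evenp_one evenp_scaleq
        subalgebra_gen_diff)
  have "x \<in> ?J" if "x \<in> S" for x
    using S[OF that] subalgebra_gen_inc[OF that] by (auto simp: subalgebra_gen_closed(1))
  then have "S \<subseteq> ?J" by blast
  then have "subalgebra_gen S \<subseteq> ?J"
    using J unfolding subalgebra_gen_def by (rule hull_minimal)
  with x show ?thesis by blast
qed

section \<open>Tensor products\<close>

text \<open>The module of relations defining \<open>M \<otimes> N\<close> inside the free module on \<open>M \<times> N\<close>.\<close>

inductive_set tensor_null :: "('a::cq_module \<times> 'b::cq_module \<Rightarrow>\<^sub>0 Cq) set" where
  tn_zero: "0 \<in> tensor_null"
| tn_add_left: "Poly_Mapping.single (a + a', b) k - Poly_Mapping.single (a, b) k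
    - Poly_Mapping.single (a', b) k \<in> tensor_null"
| tn_add_right: "Poly_Mapping.single (a, b + b') k - Poly_Mapping.single (a, b) k
    - Poly_Mapping.single (a, b') k \<in> tensor_null"
| tn_scale_left: "Poly_Mapping.single (c *\<^sub>q a, b) k - Poly_Mapping.single (a, b) (c * k) \<in> tensor_null"
| tn_scale_right: "Poly_Mapping.single (a, c *\<^sub>q b) k - Poly_Mapping.single (a, b) (c * k) \<in> tensor_null"
| tn_add: "x \<in> tensor_null \<Longrightarrow> y \<in> tensor_null \<Longrightarrow> x + y \<in> tensor_null"

definition fscale :: "Cq \<Rightarrow> ('k \<Rightarrow>\<^sub>0 Cq) \<Rightarrow> ('k \<Rightarrow>\<^sub>0 Cq)" where
  "fscale c = Poly_Mapping.map ((*) c)"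

lemma lookup_fscale: "Poly_Mapping.lookup (fscale c p) k = c * Poly_Mapping.lookup p k"
  by (simp add: fscale_def Poly_Mapping.map.rep_eq when_def)

lemma fscale_simps:
  fixes x y :: "'k \<Rightarrow>\<^sub>0 Cq"
  shows "fscale c (x + y) = fscale c x + fscale c y" "fscale c (x - y) = fscale c x - fscale c y"
  "fscale c (0 :: 'k \<Rightarrow>\<^sub>0 Cq) = 0" "fscale (b + c) x = fscale b x + fscale c x"
  "fscale b (fscale c x) = fscale (b * c) x" "fscale 1 x = x"
  "fscale c (Poly_Mapping.single k a) = Poly_Mapping.single k (c * a)"
proof -
  show "fscale c (x + y) = fscale c x + fscale c y"
    by (rule poly_mapping_eqI) (simp add: lookup_fscale lookup_add distrib_left)
  show "fscale c (x - y) = fscale c x - fscale c y"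
    by (rule poly_mapping_eqI) (simp add: lookup_fscale lookup_minus right_diff_distrib)
  show "fscale c (0 :: 'k \<Rightarrow>\<^sub>0 Cq) = 0"
    by (rule poly_mapping_eqI) (simp add: lookup_fscale)
  show "fscale (b + c) x = fscale b x + fscale c x"
    by (rule poly_mapping_eqI) (simp add: lookup_fscale lookup_add distrib_right)
  show "fscale b (fscale c x) = fscale (b * c) x"
    by (rule poly_mapping_eqI) (simp add: lookup_fscale mult.assoc)
  show "fscale 1 x = x"
    by (rule poly_mapping_eqI) (simp add: lookup_fscale)
  show "fscale c (Poly_Mapping.single k a) = Poly_Mapping.single k (c * a)"
    by (rule poly_mapping_eqI) (simp add: lookup_fscale lookup_single when_def)
qed

lemma tn_fscale: "x \<in> tensor_null \<Longrightarrow> fscale c x \<in> tensor_null"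
proof (induction rule: tensor_null.induct)
  case (tn_scale_left d a b k)
  show ?case using tensor_null.tn_scale_left[of d a b "c * k"]
    by (simp add: fscale_simps mult.left_commute)
next
  case (tn_scale_right a d b k)
  show ?case using tensor_null.tn_scale_right[of a d b "c * k"]
    by (simp add: fscale_simps mult.left_commute)
qed (simp_all add: fscale_simps tensor_null.intros)

lemma tn_uminus: "x \<in> tensor_null \<Longrightarrow> - x \<in> tensor_null"
proof -
  have "- x = fscale (- 1) x" by (rule poly_mapping_eqI) (simp add: lookup_fscale)
  then show "x \<in> tensor_null \<Longrightarrow> - x \<in> tensor_null" by (simp add: tn_fscale)
qed

definition tensor_rel ::
  "('a::cq_module \<times> 'b::cq_module \<Rightarrow>\<^sub>0 Cq) \<Rightarrow> ('a \<times> 'b \<Rightarrow>\<^sub>0 Cq) \<Rightarrow> bool" where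
  "tensor_rel x y \<longleftrightarrow> x - y \<in> tensor_null"

lemma tensor_rel_equivp: "equivp tensor_rel"
proof (rule equivpI)
  show "reflp tensor_rel" by (simp add: reflp_def tensor_rel_def tn_zero)
  show "symp tensor_rel"
    by (rule sympI, unfold tensor_rel_def, drule tn_uminus, simp)
  show "transp tensor_rel"
    by (rule transpI, unfold tensor_rel_def, drule (1) tn_add, simp)
qed

quotient_type (overloaded) ('a, 'b) tensor =
  "'a::cq_module \<times> 'b::cq_module \<Rightarrow>\<^sub>0 Cq" / tensor_rel
  by (rule tensor_rel_equivp)

instantiation tensor :: (cq_module, cq_module) cq_module
begin

lift_definition zero_tensor :: "('a, 'b) tensor" is 0 .

lift_definition plus_tensor :: "('a, 'b) tensor \<Rightarrow> ('a, 'b) tensor \<Rightarrow> ('a, 'b) tensor" is "(+)"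
  unfolding tensor_rel_def by (drule (1) tn_add) (simp add: algebra_simps)

lift_definition uminus_tensor :: "('a, 'b) tensor \<Rightarrow> ('a, 'b) tensor" is uminus
  unfolding tensor_rel_def by (drule tn_uminus) (simp add: algebra_simps)

lift_definition minus_tensor :: "('a, 'b) tensor \<Rightarrow> ('a, 'b) tensor \<Rightarrow> ('a, 'b) tensor" is "(-)"
  unfolding tensor_rel_def by (drule tn_uminus, drule (1) tn_add) (simp add: algebra_simps)

lift_definition scaleq_tensor :: "Cq \<Rightarrow> ('a, 'b) tensor \<Rightarrow> ('a, 'b) tensor" is fscale
  unfolding tensor_rel_def by (drule tn_fscale) (simp add: fscale_simps)

instance
  by standard (transfer; simp add: fscale_simps algebra_simps tensor_rel_def tn_zero)+

end

lift_definition tens :: "'a::cq_module \<Rightarrow> 'b::cq_module \<Rightarrow> ('a, 'b) tensor"  (infixr \<open>\<otimes>\<close> 70)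
  is "\<lambda>a b. Poly_Mapping.single (a, b) 1" .

text \<open>
  The linear map on \<open>M \<otimes> N\<close> induced by a bilinear map \<open>f\<close>, evaluated on a representative; it is
  independent of the representative exactly because \<open>f\<close> is bilinear, cf. \<open>tlift_tens\<close>.
\<close>

definition free_lift :: "('k \<Rightarrow> 'c::cq_module) \<Rightarrow> ('k \<Rightarrow>\<^sub>0 Cq) \<Rightarrow> 'c" where
  "free_lift f p = (\<Sum>k\<in>Poly_Mapping.keys p. Poly_Mapping.lookup p k *\<^sub>q f k)"

definition tlift ::
  "('a::cq_module \<Rightarrow> 'b::cq_module \<Rightarrow> 'c::cq_module) \<Rightarrow> ('a, 'b) tensor \<Rightarrow> 'c" where
  "tlift f x = free_lift (case_prod f) (rep_tensor x)"

definition bilinear_q :: "('a::cq_module \<Rightarrow> 'b::cq_module \<Rightarrow> 'c::cq_module) \<Rightarrow> bool" where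
  "bilinear_q f \<longleftrightarrow> (\<forall>b. cq_linear (\<lambda>a. f a b)) \<and> (\<forall>a. cq_linear (f a))"

lemma free_lift_superset:
  assumes "finite A" "Poly_Mapping.keys p \<subseteq> A" shows "free_lift f p = (\<Sum>k\<in>A. Poly_Mapping.lookup p k *\<^sub>q f k)"
  unfolding free_lift_def
  by (rule sum.mono_neutral_left[OF assms]) (simp add: in_keys_iff)

lemma free_lift_add: "free_lift f (p + r) = free_lift f p + free_lift f r"
proof -
  let ?A = "Poly_Mapping.keys p \<union> Poly_Mapping.keys r"
  have "free_lift f (p + r) = (\<Sum>k\<in>?A. Poly_Mapping.lookup (p + r) k *\<^sub>q f k)"
    by (rule free_lift_superset) (use Poly_Mapping.keys_add[of p r] in auto)
  also have "\<dots> = (\<Sum>k\<in>?A. Poly_Mapping.lookup p k *\<^sub>q f k) + (\<Sum>k\<in>?A. Poly_Mapping.lookup r k *\<^sub>q f k)"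
    by (simp add: lookup_add cq.scale_left_distrib sum.distrib)
  finally show ?thesis by (simp flip: free_lift_superset)
qed

lemma free_lift_zero [simp]: "free_lift f 0 = 0"
  by (simp add: free_lift_def)

lemma free_lift_diff: "free_lift f (p - r) = free_lift f p - free_lift f r"
  by (metis add_diff_cancel_right' diff_add_cancel free_lift_add)

lemma free_lift_fscale: "free_lift f (fscale c p) = c *\<^sub>q free_lift f p"
proof -
  have "free_lift f (fscale c p) = (\<Sum>k\<in>Poly_Mapping.keys p. Poly_Mapping.lookup (fscale c p) k *\<^sub>q f k)"
    by (rule free_lift_superset) (auto simp: in_keys_iff lookup_fscale)
  then show ?thesis by (simp add: lookup_fscale free_lift_def cq.scale_sum_right)
qed

lemma free_lift_single [simp]: "free_lift f (Poly_Mapping.single k c) = c *\<^sub>q f k"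
  by (simp add: free_lift_def)

lemma free_lift_null:
  assumes f: "bilinear_q f" and "x \<in> tensor_null" shows "free_lift (case_prod f) x = 0"
  using assms(2)
proof (induction rule: tensor_null.induct)
  case (tn_add_left a a' b k)
  have "f (a + a') b = f a b + f a' b" using f by (simp add: bilinear_q_def cq_linear_iff)
  then show ?case by (simp add: free_lift_diff cq.scale_right_distrib)
next
  case (tn_add_right a b b' k)
  have "f a (b + b') = f a b + f a b'" using f by (simp add: bilinear_q_def cq_linear_iff)
  then show ?case by (simp add: free_lift_diff cq.scale_right_distrib)
next
  case (tn_scale_left c a b k)
  have "f (c *\<^sub>q a) b = c *\<^sub>q f a b" using f by (simp add: bilinear_q_def cq_linear_iff)
  then show ?case by (simp add: free_lift_diff mult.commute)
next
  case (tn_scale_right a c b k)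
  have "f a (c *\<^sub>q b) = c *\<^sub>q f a b" using f by (simp add: bilinear_q_def cq_linear_iff)
  then show ?case by (simp add: free_lift_diff mult.commute)
qed (simp_all add: free_lift_add)

lemma tlift_abs:
  assumes f: "bilinear_q f" shows "tlift f (abs_tensor p) = free_lift (case_prod f) p"
proof -
  have "tensor_rel (rep_tensor (abs_tensor p)) p"
    by (metis Quotient3_tensor Quotient3_def tensor.abs_eq_iff)
  then have "free_lift (case_prod f) (rep_tensor (abs_tensor p) - p) = 0"
    unfolding tensor_rel_def by (rule free_lift_null[OF f])
  then show ?thesis by (simp add: tlift_def free_lift_diff)
qed

lemma tlift_tens: "bilinear_q f \<Longrightarrow> tlift f (a \<otimes> b) = f a b"
  by (simp add: tens.abs_eq tlift_abs scaleq_one)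

lemma tlift_linear: assumes f: "bilinear_q f" shows "cq_linear (tlift f)"
proof (rule cq_linearI)
  show "tlift f (x + y) = tlift f x + tlift f y" for x y
    by (induction x; induction y)
      (simp add: plus_tensor.abs_eq tlift_abs[OF f] free_lift_add)
  show "tlift f (c *\<^sub>q x) = c *\<^sub>q tlift f x" for c x
    by (induction x) (simp add: scaleq_tensor.abs_eq tlift_abs[OF f] free_lift_fscale)
qed

lemma tens_bilinear: "bilinear_q (\<otimes>)"
  unfolding bilinear_q_def cq_linear_iff
proof safe
  fix a a' :: 'a and b b' :: 'b and c
  show "(a + a') \<otimes> b = a \<otimes> b + a' \<otimes> b"
    by transfer (use tn_add_left in \<open>auto simp: tensor_rel_def diff_diff_eq\<close>)
  show "a \<otimes> (b + b') = a \<otimes> b + a \<otimes> b'"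
    by transfer (use tn_add_right in \<open>auto simp: tensor_rel_def diff_diff_eq\<close>)
  show "(c *\<^sub>q a) \<otimes> b = c *\<^sub>q (a \<otimes> b)"
    by transfer (use tn_scale_left[where k = 1] in \<open>auto simp: tensor_rel_def fscale_simps\<close>)
  show "a \<otimes> (c *\<^sub>q b) = c *\<^sub>q (a \<otimes> b)"
    by transfer (use tn_scale_right[where k = 1] in \<open>auto simp: tensor_rel_def fscale_simps\<close>)
qed

lemma bilinear_qD:
  assumes "bilinear_q f"
  shows "f (a + a') b = f a b + f a' b" "f a (b + b') = f a b + f a b'"
    "f (c *\<^sub>q a) b = c *\<^sub>q f a b" "f a (c *\<^sub>q b) = c *\<^sub>q f a b"
  using assms by (simp_all add: bilinear_q_def cq_linear_iff)

lemmas tens_add_left = bilinear_qD(1)[OF tens_bilinear]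
  and tens_add_right = bilinear_qD(2)[OF tens_bilinear]
  and tens_scale_left = bilinear_qD(3)[OF tens_bilinear]
  and tens_scale_right = bilinear_qD(4)[OF tens_bilinear]

lemma tens_zero [simp]: "0 \<otimes> b = 0" "a \<otimes> 0 = 0"
  by (metis tens_scale_left tens_scale_right cq.scale_zero_left)+

lemma tensor_induct [case_names tens add, induct type: tensor]:
  fixes x :: "('a::cq_module, 'b::cq_module) tensor"
  assumes 1: "\<And>a b. P (a \<otimes> b)" and 2: "\<And>x y. P x \<Longrightarrow> P y \<Longrightarrow> P (x + y)"
  shows "P x"
proof (induction x rule: tensor.abs_induct)
  case (1 p)
  have single: "abs_tensor (Poly_Mapping.single k c) = (c *\<^sub>q fst k) \<otimes> snd k" for k c
    unfolding tens_scale_left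
    by (simp add: tens.abs_eq scaleq_tensor.abs_eq fscale_simps)
  have P0: "P 0" using assms(1)[of 0 0] by simp
  have "P (abs_tensor (\<Sum>k\<in>A. Poly_Mapping.single k (Poly_Mapping.lookup p k)))" if "finite A" for A
    using that
  proof (induction A rule: finite_induct)
    case empty
    then show ?case using P0 by (simp add: zero_tensor.abs_eq)
  next
    case (insert k A)
    then show ?case using assms(1) 2 by (simp add: single flip: plus_tensor.abs_eq)
  qed
  moreover have "(\<Sum>k\<in>Poly_Mapping.keys p. Poly_Mapping.single k (Poly_Mapping.lookup p k)) = p"
    by (rule poly_mapping_eqI)
      (auto simp: lookup_sum lookup_single when_def in_keys_iff)
  ultimately show ?case by (metis finite_keys)
qed

text \<open>
  The sign rule \<open>(a \<otimes> b) (c \<otimes> d) = (-1)\<^bsup>|b||c|\<^esup> ac \<otimes> bd\<close>, extended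
  linearly from homogeneous \<open>b\<close> and \<open>c\<close>.
\<close>

definition super_tmult ::
  "'a::cq_superalgebra \<Rightarrow> 'b::cq_superalgebra \<Rightarrow> 'a \<Rightarrow> 'b \<Rightarrow> ('a, 'b) tensor" where
  "super_tmult a b c d =
     (a * evenp c) \<otimes> (evenp b * d) + (a * evenp c) \<otimes> (oddp b * d)
   + (a * oddp c) \<otimes> (evenp b * d) - (a * oddp c) \<otimes> (oddp b * d)"

lemma bilinear_qI:
  assumes "\<And>a a' b. f (a + a') b = f a b + f a' b" "\<And>a b b'. f a (b + b') = f a b + f a b'"
    "\<And>c a b. f (c *\<^sub>q a) b = c *\<^sub>q f a b" "\<And>c a b. f a (c *\<^sub>q b) = c *\<^sub>q f a b"
  shows "bilinear_q f"
  using assms by (simp add: bilinear_q_def cq_linear_iff)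

lemma cq_linear_tens: "cq_linear (\<lambda>a. a \<otimes> b)" "cq_linear (\<lambda>b. a \<otimes> b)"
  by (simp_all add: cq_linear_iff tens_add_left tens_add_right tens_scale_left tens_scale_right)

lemmas tens_diff_left = cq_linear_diff[OF cq_linear_tens(1)]
lemmas tens_diff_right = cq_linear_diff[OF cq_linear_tens(2)]

lemma oddp_add: "oddp (x + y) = oddp x + oddp y"
  and oddp_scaleq: "oddp (c *\<^sub>q x) = c *\<^sub>q oddp x"
  by (rule cq_linear_add cq_linear_scale, rule oddp_linear)+

lemma super_tmult_add:
  "super_tmult (a + a') b c d = super_tmult a b c d + super_tmult a' b c d"
  "super_tmult a (b + b') c d = super_tmult a b c d + super_tmult a b' c d"
  "super_tmult a b (c + c') d = super_tmult a b c d + super_tmult a b c' d"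
  "super_tmult a b c (d + d') = super_tmult a b c d + super_tmult a b c d'"
  by (simp_all add: super_tmult_def evenp_add oddp_add distrib_left distrib_right
      tens_add_left tens_add_right)

lemma super_tmult_scaleq:
  "super_tmult (k *\<^sub>q a) b c d = k *\<^sub>q super_tmult a b c d"
  "super_tmult a (k *\<^sub>q b) c d = k *\<^sub>q super_tmult a b c d"
  "super_tmult a b (k *\<^sub>q c) d = k *\<^sub>q super_tmult a b c d"
  "super_tmult a b c (k *\<^sub>q d) = k *\<^sub>q super_tmult a b c d"
  by (simp_all add: super_tmult_def evenp_scaleq oddp_scaleq scaleq_mult_left scaleq_mult_right
      tens_scale_left tens_scale_right cq.scale_right_distrib cq.scale_right_diff_distrib)

lemma super_tmult_bilinear: "bilinear_q (super_tmult a b)"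
  by (rule bilinear_qI) (simp_all add: super_tmult_add super_tmult_scaleq)

lemmas super_tmult_lift = tlift_tens[OF super_tmult_bilinear]
  cq_linear_add[OF tlift_linear[OF super_tmult_bilinear]]
  cq_linear_scale[OF tlift_linear[OF super_tmult_bilinear]]

lemma tlift_add_fun:
  assumes "bilinear_q f" "bilinear_q g" "bilinear_q h" "\<And>c d. h c d = f c d + g c d"
  shows "tlift h y = tlift f y + tlift g y"
proof (induction y)
  case (tens a b)
  show ?case
    unfolding tlift_tens[OF assms(1)] tlift_tens[OF assms(2)] tlift_tens[OF assms(3)]
    by (rule assms(4))
next
  case (add x y)
  then show ?case by (simp add: cq_linear_add[OF tlift_linear] assms(1-3) add_ac)
qed

lemma tlift_scale_fun:
  assumes "bilinear_q f" "bilinear_q h" "\<And>c d. h c d = k *\<^sub>q f c d"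
  shows "tlift h y = k *\<^sub>q tlift f y"
proof (induction y)
  case (tens a b)
  show ?case
    unfolding tlift_tens[OF assms(1)] tlift_tens[OF assms(2)] by (rule assms(3))
next
  case (add x y)
  then show ?case by (simp add: cq_linear_add[OF tlift_linear] assms(1-2) cq.scale_right_distrib)
qed

lemma super_tmult_bilinear': "bilinear_q (\<lambda>a b. tlift (super_tmult a b) y)"
  by (rule bilinear_qI; (rule tlift_add_fun | rule tlift_scale_fun))
    (rule super_tmult_bilinear super_tmult_add super_tmult_scaleq)+

definition homog :: "'a::cq_superalgebra \<Rightarrow> bool" where
  "homog a \<longleftrightarrow> evenp a = a \<or> evenp a = 0"

lemma homog_cases:
  assumes "homog a"
  obtains "evenp a = a" "oddp a = 0" | "evenp a = 0" "oddp a = a"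
  using assms by (auto simp: homog_def oddp_def)

lemma homog_parts [simp]: "homog (evenp a)" "homog (oddp a)"
  by (simp_all add: homog_def evenp_idem)

lemma tensor_induct_homog [case_names tens add]:
  fixes x :: "('a::cq_superalgebra, 'b::cq_superalgebra) tensor"
  assumes 1: "\<And>a b. homog a \<Longrightarrow> homog b \<Longrightarrow> P (a \<otimes> b)" and 2: "\<And>x y. P x \<Longrightarrow> P y \<Longrightarrow> P (x + y)"
  shows "P x"
proof (induction x)
  case (tens a b)
  have "a \<otimes> b = (evenp a \<otimes> evenp b + evenp a \<otimes> oddp b) + (oddp a \<otimes> evenp b + oddp a \<otimes> oddp b)"
    by (simp add: even_plus_odd flip: tens_add_left tens_add_right)
  then show ?case using 1 2 by (metis homog_parts)
qed (rule 2)

instantiation tensor :: (cq_superalgebra, cq_superalgebra) cq_superalgebra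
begin

definition one_tensor :: "('a, 'b) tensor" where
  "1 = 1 \<otimes> 1"

definition times_tensor :: "('a, 'b) tensor \<Rightarrow> ('a, 'b) tensor \<Rightarrow> ('a, 'b) tensor" where
  "x * y = tlift (\<lambda>a b. tlift (super_tmult a b) y) x"

definition evenp_tensor :: "('a, 'b) tensor \<Rightarrow> ('a, 'b) tensor" where
  "evenp x = tlift (\<lambda>a b. evenp a \<otimes> evenp b + oddp a \<otimes> oddp b) x"

lemma evenp_tensor_bilinear:
  "bilinear_q (\<lambda>(a::'a) (b::'b). evenp a \<otimes> evenp b + oddp a \<otimes> oddp b)"
  by (rule bilinear_qI)
    (simp_all add: evenp_add oddp_add evenp_scaleq oddp_scaleq tens_add_left tens_add_right
      tens_scale_left tens_scale_right cq.scale_right_distrib)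

lemma tens_mult: "(a \<otimes> b) * y = tlift (super_tmult a b) y" for a :: 'a and b :: 'b
  unfolding times_tensor_def by (rule tlift_tens[OF super_tmult_bilinear'])

lemma tensor_mult_tens: "(a \<otimes> b) * (c \<otimes> d) = super_tmult a b c d" for a c :: 'a and b d :: 'b
  unfolding tens_mult by (rule tlift_tens[OF super_tmult_bilinear])

lemma tensor_evenp_tens: "evenp (a \<otimes> b) = evenp a \<otimes> evenp b + oddp a \<otimes> oddp b"
  for a :: 'a and b :: 'b
  by (simp add: evenp_tensor_def tlift_tens evenp_tensor_bilinear)

lemma tensor_distrib:
  fixes x y z :: "('a, 'b) tensor"
  shows "(x + y) * z = x * z + y * z" "z * (x + y) = z * x + z * y"
    "(c *\<^sub>q x) * z = c *\<^sub>q (x * z)" "z * (c *\<^sub>q x) = c *\<^sub>q (z * x)"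
proof -
  note lin = tlift_linear[OF super_tmult_bilinear']
  show 1: "(x + y) * z = x * z + y * z" for x y z :: "('a, 'b) tensor"
    unfolding times_tensor_def by (rule cq_linear_add[OF lin])
  show "(c *\<^sub>q x) * z = c *\<^sub>q (x * z)"
    unfolding times_tensor_def by (rule cq_linear_scale[OF lin])
  show "z * (x + y) = z * x + z * y"
    by (induction z) (simp_all only: tens_mult super_tmult_lift 1 add_ac)
  show "z * (c *\<^sub>q x) = c *\<^sub>q (z * x)"
    by (induction z) (simp_all only: tens_mult super_tmult_lift 1 cq.scale_right_distrib)
qed

lemma tensor_zero_mult: "0 * z = 0" "z * 0 = 0" for z :: "('a, 'b) tensor"
  by (metis tensor_distrib(1,2) add_cancel_right_right)+

lemma tensor_uminus_mult: "(- x) * z = - (x * z)" "z * (- x) = - (z * x)"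
  for x z :: "('a, 'b) tensor"
  by (metis tensor_distrib(1,2) tensor_zero_mult add.right_inverse minus_unique)+

lemma tensor_evenp_linear: "cq_linear (evenp :: ('a, 'b) tensor \<Rightarrow> _)"
  unfolding evenp_tensor_def by (rule tlift_linear[OF evenp_tensor_bilinear])

lemma tensor_mult_assoc: "(x * y) * z = x * (y * z)" for x y z :: "('a, 'b) tensor"
proof (induction x rule: tensor_induct_homog)
  case x: (tens a b)
  show ?case
  proof (induction y rule: tensor_induct_homog)
    case y: (tens c d)
    show ?case
    proof (induction z rule: tensor_induct_homog)
      case z: (tens e f)
      show ?case
        by (rule homog_cases[OF x(2)]; rule homog_cases[OF y(1)]; rule homog_cases[OF y(2)];
            rule homog_cases[OF z(1)])
          (simp_all add: tensor_mult_tens super_tmult_def evenp_mult' oddp_mult mult.assoc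
            tensor_uminus_mult)
    qed (simp add: tensor_distrib)
  qed (simp add: tensor_distrib)
qed (simp add: tensor_distrib)

lemma tensor_evenp_mult:
  "evenp (x * y) = evenp x * evenp y + (x - evenp x) * (y - evenp y)" for x y :: "('a, 'b) tensor"
proof -
  note lin = cq_linear_add[OF tensor_evenp_linear]
  have split: "(u + v) - (u' + v') = (u - u') + (v - v')" for u v u' v' :: "('a, 'b) tensor"
    by simp
  have neg: "evenp (- u) = - evenp u" for u :: "('a, 'b) tensor"
    by (metis cq_linear_diff[OF tensor_evenp_linear] cq_linear_zero[OF tensor_evenp_linear] diff_0)
  show ?thesis
  proof (induction x rule: tensor_induct_homog)
    case x: (tens a b)
    show ?case
    proof (induction y rule: tensor_induct_homog)
      case y: (tens c d)
      show ?case
        by (rule homog_cases[OF x(1)]; rule homog_cases[OF x(2)]; rule homog_cases[OF y(1)];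
            rule homog_cases[OF y(2)])
          (simp_all add: tensor_mult_tens super_tmult_def evenp_mult' oddp_mult
            tensor_uminus_mult tensor_evenp_tens tensor_zero_mult neg)
    qed (simp only: split tensor_distrib lin add_ac)
  qed (simp only: split tensor_distrib lin add_ac)
qed

instance
proof
  fix x y z :: "('a, 'b) tensor" and c
  show "x * y * z = x * (y * z)" by (rule tensor_mult_assoc)
  show "(x + y) * z = x * z + y * z" "x * (y + z) = x * y + x * z"
    "c *\<^sub>q x * y = c *\<^sub>q (x * y)" "x * c *\<^sub>q y = c *\<^sub>q (x * y)"
    by (rule tensor_distrib)+
  have oddp_one: "oddp (1 :: 'z::cq_superalgebra) = 0" by (simp add: oddp_def evenp_one)
  show "1 * x = x"
    unfolding one_tensor_def
    by (induction x)
      (simp_all add: tensor_mult_tens super_tmult_def tensor_distrib oddp_one evenp_one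
        even_plus_odd flip: tens_add_left)
  show "x * 1 = x"
    unfolding one_tensor_def
    by (induction x)
      (simp_all add: tensor_mult_tens super_tmult_def tensor_distrib oddp_one evenp_one
        even_plus_odd flip: tens_add_right)
  show "evenp (x + y) = evenp x + evenp y" by (rule cq_linear_add[OF tensor_evenp_linear])
  show "evenp (c *\<^sub>q x) = c *\<^sub>q evenp x" by (rule cq_linear_scale[OF tensor_evenp_linear])
  show "evenp (evenp x) = evenp x"
    by (induction x)
      (simp_all add: tensor_evenp_tens cq_linear_add[OF tensor_evenp_linear] evenp_idem)
  show "evenp (1 :: ('a, 'b) tensor) = 1"
    by (simp add: one_tensor_def tensor_evenp_tens evenp_one oddp_one)
  show "evenp (x * y) = evenp x * evenp y + (x - evenp x) * (y - evenp y)"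
    by (rule tensor_evenp_mult)
qed

end

definition map_tensor ::
  "('a::cq_module \<Rightarrow> 'c::cq_module) \<Rightarrow> ('b::cq_module \<Rightarrow> 'd::cq_module) \<Rightarrow> ('a, 'b) tensor \<Rightarrow> ('c, 'd) tensor" where
  "map_tensor f g = tlift (\<lambda>a b. f a \<otimes> g b)"

definition tensor_assoc ::
  "(('a::cq_module, 'b::cq_module) tensor, 'c::cq_module) tensor \<Rightarrow> ('a, ('b, 'c) tensor) tensor" where
  "tensor_assoc = tlift (\<lambda>x c. tlift (\<lambda>a b. a \<otimes> (b \<otimes> c)) x)"

section \<open>Hopf superalgebras and coactions\<close>

text \<open>
  The maps \<open>\<epsilon> \<otimes> id\<close> and \<open>id \<otimes> \<epsilon>\<close> are composed with the canonical isomorphisms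
  \<open>\<complex>\<^sub>q \<otimes> A \<cong> A \<cong> A \<otimes> \<complex>\<^sub>q\<close>.
\<close>

locale hopf_superalgebra =
  fixes \<Delta> :: "'h::cq_superalgebra \<Rightarrow> ('h, 'h) tensor"
    and \<epsilon> :: "'h \<Rightarrow> Cq"
    and S :: "'h \<Rightarrow> 'h"
  assumes comult_hom: "superalg_hom \<Delta>"
    and counit_add: "\<epsilon> (x + y) = \<epsilon> x + \<epsilon> y"
    and counit_scaleq: "\<epsilon> (c *\<^sub>q x) = c * \<epsilon> x"
    and counit_mult: "\<epsilon> (x * y) = \<epsilon> x * \<epsilon> y"
    and counit_one: "\<epsilon> 1 = 1"
    and counit_even: "\<epsilon> (evenp x) = \<epsilon> x"
    and coassoc: "tensor_assoc (map_tensor \<Delta> id (\<Delta> x)) = map_tensor id \<Delta> (\<Delta> x)"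
    and counit_left: "tlift (\<lambda>a b. \<epsilon> a *\<^sub>q b) (\<Delta> x) = x"
    and counit_right: "tlift (\<lambda>a b. \<epsilon> b *\<^sub>q a) (\<Delta> x) = x"
    and antipode_linear: "cq_linear S"
    and antipode_even: "S (evenp x) = evenp (S x)"
    and antipode_left: "tlift (\<lambda>a b. S a * b) (\<Delta> x) = \<epsilon> x *\<^sub>q 1"
    and antipode_right: "tlift (\<lambda>a b. a * S b) (\<Delta> x) = \<epsilon> x *\<^sub>q 1"

locale left_coaction = hopf_superalgebra \<Delta> \<epsilon> S
  for \<Delta> :: "'h::cq_superalgebra \<Rightarrow> ('h, 'h) tensor" and \<epsilon> :: "'h \<Rightarrow> Cq" and S :: "'h \<Rightarrow> 'h" +
  fixes \<delta> :: "'v::cq_superalgebra \<Rightarrow> ('h, 'v) tensor"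
  assumes coaction_hom: "superalg_hom \<delta>"
    and coaction_coassoc: "tensor_assoc (map_tensor \<Delta> id (\<delta> v)) = map_tensor id \<delta> (\<delta> v)"
    and coaction_counit: "tlift (\<lambda>a w. \<epsilon> a *\<^sub>q w) (\<delta> v) = v"

text \<open>
  The structure maps inherited by a quotient \<open>\<pi> : H \<rightarrow> H/I\<close>, computed on an arbitrary representative
  \<open>inv \<pi> x\<close>.  They do not depend on the choice when \<open>I\<close> is a Hopf ideal.
\<close>

definition quot_comult ::
  "('a::cq_superalgebra \<Rightarrow> 'b::cq_superalgebra) \<Rightarrow> ('a \<Rightarrow> ('a, 'a) tensor) \<Rightarrow> 'b \<Rightarrow> ('b, 'b) tensor" where
  "quot_comult \<pi> \<Delta> x = map_tensor \<pi> \<pi> (\<Delta> (inv \<pi> x))"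

definition quot_counit :: "('a \<Rightarrow> 'b) \<Rightarrow> ('a \<Rightarrow> Cq) \<Rightarrow> 'b \<Rightarrow> Cq" where
  "quot_counit \<pi> \<epsilon> x = \<epsilon> (inv \<pi> x)"

definition quot_antipode :: "('a \<Rightarrow> 'b) \<Rightarrow> ('a \<Rightarrow> 'a) \<Rightarrow> 'b \<Rightarrow> 'b" where
  "quot_antipode \<pi> S x = \<pi> (S (inv \<pi> x))"

section \<open>The quantum matrix superalgebra and its localization\<close>

datatype idx = I1 | I2 | I3 | I4 | I5

primrec idx_nat :: "idx \<Rightarrow> nat" where
  "idx_nat I1 = 1" | "idx_nat I2 = 2" | "idx_nat I3 = 3" | "idx_nat I4 = 4" | "idx_nat I5 = 5"

instantiation idx :: "{linorder, finite}"
begin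

definition less_eq_idx :: "idx \<Rightarrow> idx \<Rightarrow> bool" where
  "i \<le> j \<longleftrightarrow> idx_nat i \<le> idx_nat j"

definition less_idx :: "idx \<Rightarrow> idx \<Rightarrow> bool" where
  "i < j \<longleftrightarrow> idx_nat i < idx_nat j"

lemma UNIV_idx: "UNIV = {I1, I2, I3, I4, I5}"
  using idx.exhaust by blast

instance
proof
  show "finite (UNIV :: idx set)" by (simp add: UNIV_idx)
  show "i = j" if "i \<le> j" "j \<le> i" for i j :: idx
    using that by (cases i; cases j) (simp_all add: less_eq_idx_def)
qed (auto simp: less_eq_idx_def less_idx_def)

end

definition par :: "idx \<Rightarrow> nat" where
  "par i = (if i = I5 then 1 else 0)"

text \<open>Parities are kept as natural numbers; only their residues modulo 2 matter.\<close>

definition gpar :: "idx \<Rightarrow> idx \<Rightarrow> nat" where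
  "gpar i j = par i + par j"

datatype letter = G idx idx | D1inv | D2inv

primrec lpar :: "letter \<Rightarrow> nat" where
  "lpar (G i j) = gpar i j" | "lpar D1inv = 0" | "lpar D2inv = 0"

datatype fword = FWord (letters: "letter list")

instantiation fword :: monoid_add
begin

definition zero_fword :: fword where
  "0 = FWord []"

definition plus_fword :: "fword \<Rightarrow> fword \<Rightarrow> fword" where
  "u + v = FWord (letters u @ letters v)"

instance by standard (simp_all add: zero_fword_def plus_fword_def)

end

definition wpar :: "fword \<Rightarrow> nat" where
  "wpar w = sum_list (map lpar (letters w))"

lemma wpar_simps: "wpar 0 = 0" "wpar (u + v) = wpar u + wpar v"
  by (simp_all add: wpar_def zero_fword_def plus_fword_def)

definition word_evenp :: "(fword \<Rightarrow>\<^sub>0 Cq) \<Rightarrow> (fword \<Rightarrow>\<^sub>0 Cq)" where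
  "word_evenp f = Abs_poly_mapping (\<lambda>w. if even (wpar w) then Poly_Mapping.lookup f w else 0)"

lemma lookup_word_evenp:
  "Poly_Mapping.lookup (word_evenp f) w = (if even (wpar w) then Poly_Mapping.lookup f w else 0)"
proof -
  have "finite {w. (if even (wpar w) then Poly_Mapping.lookup f w else 0) \<noteq> 0}"
    by (rule finite_subset[OF _ finite_lookup[of f]]) auto
  then show ?thesis by (simp add: word_evenp_def)
qed

lemma poly_mapping_induct_single [case_names single add]:
  assumes 1: "\<And>k c. P (Poly_Mapping.single k c)" and 2: "\<And>x y. P x \<Longrightarrow> P y \<Longrightarrow> P (x + y)"
  shows "P (p :: 'k \<Rightarrow>\<^sub>0 Cq)"
proof -
  have "P (\<Sum>k\<in>A. Poly_Mapping.single k (Poly_Mapping.lookup p k))" if "finite A" for A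
    using that
  proof (induction A rule: finite_induct)
    case empty
    then show ?case using 1[of undefined 0] by simp
  next
    case (insert k A)
    then show ?case using 1 2 by simp
  qed
  moreover have "(\<Sum>k\<in>Poly_Mapping.keys p. Poly_Mapping.single k (Poly_Mapping.lookup p k)) = p"
    by (rule poly_mapping_eqI) (auto simp: lookup_sum lookup_single when_def in_keys_iff)
  ultimately show ?thesis by (metis finite_keys)
qed

lemma word_evenp_add: "word_evenp (x + y) = word_evenp x + word_evenp y"
  by (rule poly_mapping_eqI) (simp add: lookup_word_evenp lookup_add)

lemma word_evenp_single:
  "word_evenp (Poly_Mapping.single w c) = (if even (wpar w) then Poly_Mapping.single w c else 0)"
  by (rule poly_mapping_eqI) (simp add: lookup_word_evenp lookup_single when_def)

lemma word_evenp_mult: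
  "word_evenp (x * y) = word_evenp x * word_evenp y + (x - word_evenp x) * (y - word_evenp y)"
proof (induction x rule: poly_mapping_induct_single)
  case x: (single u c)
  show ?case
  proof (induction y rule: poly_mapping_induct_single)
    case (single v d)
    show ?case by (simp add: mult_single word_evenp_single wpar_simps)
  qed (simp only: add_diff_add distrib_left distrib_right word_evenp_add add_ac)
qed (simp only: add_diff_add distrib_left distrib_right word_evenp_add add_ac)

lemma const_commute: "x * Poly_Mapping.single 0 c = Poly_Mapping.single 0 c * x"
  for x :: "fword \<Rightarrow>\<^sub>0 Cq"
  by (induction x rule: poly_mapping_induct_single)
    (simp_all add: mult_single mult.commute algebra_simps)

definition word_scale :: "Cq \<Rightarrow> (fword \<Rightarrow>\<^sub>0 Cq) \<Rightarrow> (fword \<Rightarrow>\<^sub>0 Cq)" where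
  "word_scale c x = Poly_Mapping.single 0 c * x"

lemma word_evenp_scale: "word_evenp (word_scale c x) = word_scale c (word_evenp x)"
  by (simp add: word_scale_def word_evenp_mult word_evenp_single wpar_simps)

text \<open>The free algebra \<open>\<complex>\<^sub>q\<langle>g\<^sub>i\<^sub>j, D\<^sub>1\<^sup>-\<^sup>1, D\<^sub>2\<^sup>-\<^sup>1\<rangle>\<close>.\<close>

typedef free_gl = "UNIV :: (fword \<Rightarrow>\<^sub>0 Cq) set" by simp

setup_lifting type_definition_free_gl

instantiation free_gl :: cq_superalgebra
begin

lift_definition zero_free_gl :: free_gl is 0 .
lift_definition one_free_gl :: free_gl is 1 .
lift_definition plus_free_gl :: "free_gl \<Rightarrow> free_gl \<Rightarrow> free_gl" is "(+)" .
lift_definition minus_free_gl :: "free_gl \<Rightarrow> free_gl \<Rightarrow> free_gl" is "(-)" .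
lift_definition uminus_free_gl :: "free_gl \<Rightarrow> free_gl" is uminus .
lift_definition times_free_gl :: "free_gl \<Rightarrow> free_gl \<Rightarrow> free_gl" is "(*)" .
lift_definition scaleq_free_gl :: "Cq \<Rightarrow> free_gl \<Rightarrow> free_gl" is word_scale .
lift_definition evenp_free_gl :: "free_gl \<Rightarrow> free_gl" is word_evenp .

instance
proof
  fix x y z :: free_gl and b c :: Cq
  show "x + y + z = x + (y + z)" "x + y = y + x" "0 + x = x" "- x + x = 0" "x - y = x + - y"
    "x * y * z = x * (y * z)" "1 * x = x" "x * 1 = x" "(x + y) * z = x * z + y * z"
    "x * (y + z) = x * y + x * z" "c *\<^sub>q (x + y) = c *\<^sub>q x + c *\<^sub>q y"
    "1 *\<^sub>q x = x" "c *\<^sub>q x * y = c *\<^sub>q (x * y)"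
    by (transfer; simp add: word_scale_def algebra_simps)+
  show "(b + c) *\<^sub>q x = b *\<^sub>q x + c *\<^sub>q x" by transfer (simp add: word_scale_def single_add algebra_simps)
  show "b *\<^sub>q c *\<^sub>q x = (b * c) *\<^sub>q x" by transfer (simp add: word_scale_def mult_single flip: mult.assoc)
  show "x * c *\<^sub>q y = c *\<^sub>q (x * y)" by transfer (metis word_scale_def const_commute mult.assoc)
  show "evenp (x + y) = evenp x + evenp y" by transfer (rule word_evenp_add)
  show "evenp (c *\<^sub>q x) = c *\<^sub>q evenp x" by transfer (rule word_evenp_scale)
  show "evenp (evenp x) = evenp x" by transfer (rule poly_mapping_eqI, simp add: lookup_word_evenp)
  show "evenp (1 :: free_gl) = 1"
    by transfer (metis word_evenp_single wpar_simps(1) even_zero single_one)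
  show "evenp (x * y) = evenp x * evenp y + (x - evenp x) * (y - evenp y)"
    by transfer (rule word_evenp_mult)
qed

end

definition letter_gl :: "letter \<Rightarrow> free_gl" where
  "letter_gl l = Abs_free_gl (Poly_Mapping.single (FWord [l]) 1)"

definition gen_gl :: "idx \<Rightarrow> idx \<Rightarrow> free_gl" where
  "gen_gl i j = letter_gl (G i j)"

text \<open>The length of a permutation is its number of inversions.\<close>

definition perm_length :: "(idx \<Rightarrow> idx) \<Rightarrow> nat" where
  "perm_length \<sigma> = card {(i, j). i < j \<and> \<sigma> j < \<sigma> i}"

text \<open>Note \<open>(-q)\<^bsup>-l\<^esup> = (-q\<^sup>-\<^sup>1)\<^bsup>l\<^esup>\<close>.\<close>

definition qdet4 :: "(idx \<Rightarrow> idx \<Rightarrow> 'a::cq_superalgebra) \<Rightarrow> 'a" where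
  "qdet4 g = (\<Sum>\<sigma> | \<sigma> permutes {I1, I2, I3, I4}.
     (- qpow (- 1)) ^ perm_length \<sigma> *\<^sub>q (g I1 (\<sigma> I1) * g I2 (\<sigma> I2) * g I3 (\<sigma> I3) * g I4 (\<sigma> I4)))"

definition rel_M :: "free_gl set" where
  "rel_M =
     {gen_gl i j * gen_gl i l
        - ((- 1) ^ (gpar i j * gpar i l) * qpow ((- 1) ^ (par i + 1))) *\<^sub>q (gen_gl i l * gen_gl i j)
      | i j l. j < l}
   \<union> {gen_gl i j * gen_gl k j
        - ((- 1) ^ (gpar i j * gpar k j) * qpow ((- 1) ^ (par j + 1))) *\<^sub>q (gen_gl k j * gen_gl i j)
      | i j k. i < k}
   \<union> {gen_gl i j * gen_gl k l - (- 1) ^ (gpar i j * gpar k l) *\<^sub>q (gen_gl k l * gen_gl i j)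
      | i j k l. i < k \<and> j > l \<or> i > k \<and> j < l}
   \<union> {gen_gl i j * gen_gl k l - (- 1) ^ (gpar i j * gpar k l) *\<^sub>q (gen_gl k l * gen_gl i j)
        - ((- 1) ^ (gpar i j * gpar k j) * (qpow (- 1) - qpow 1)) *\<^sub>q (gen_gl k j * gen_gl i l)
      | i j k l. i < k \<and> j < l}
   \<union> {gen_gl i j * gen_gl i j | i j. odd (gpar i j)}"

definition rel_inv :: "free_gl set" where
  "rel_inv =
     {qdet4 gen_gl * letter_gl D1inv - 1, letter_gl D1inv * qdet4 gen_gl - 1,
      gen_gl I5 I5 * letter_gl D2inv - 1, letter_gl D2inv * gen_gl I5 I5 - 1}"

definition rel_GL :: "free_gl set" where
  "rel_GL = rel_M \<union> rel_inv"

lemma evenp_letter: "evenp (letter_gl l) = (if even (lpar l) then letter_gl l else 0)"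
proof -
  have "word_evenp (Poly_Mapping.single (FWord [l]) 1) =
      (if even (lpar l) then Poly_Mapping.single (FWord [l]) 1 else 0)"
    by (simp add: word_evenp_single wpar_def)
  then show ?thesis
    by (simp add: letter_gl_def evenp_free_gl.abs_eq zero_free_gl_def)
qed

definition hpar :: "nat \<Rightarrow> 'a::cq_superalgebra \<Rightarrow> bool" where
  "hpar n x \<longleftrightarrow> evenp x = (if even n then x else 0)"

lemma hpar_gen: "hpar (gpar i j) (gen_gl i j)"
  by (simp add: hpar_def gen_gl_def evenp_letter)

lemma hpar_mult: "hpar m x \<Longrightarrow> hpar n y \<Longrightarrow> hpar (m + n) (x * y)"
  by (auto simp: hpar_def evenp_mult)

lemma hpar_mult0: "hpar 0 x \<Longrightarrow> hpar 0 y \<Longrightarrow> hpar 0 (x * y)"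
  using hpar_mult[of 0 x 0 y] by simp

lemma hpar_scaleq: "hpar n x \<Longrightarrow> hpar n (c *\<^sub>q x)"
  by (simp add: hpar_def evenp_scaleq)

lemma hpar_diff: "hpar n x \<Longrightarrow> hpar n y \<Longrightarrow> hpar n (x - y)"
  by (simp add: hpar_def evenp_diff)

lemma hpar_cong: "hpar m x \<Longrightarrow> even m = even n \<Longrightarrow> hpar n x"
  by (simp add: hpar_def)

lemma hpar_sum: "(\<And>i. i \<in> A \<Longrightarrow> hpar n (f i)) \<Longrightarrow> hpar n (sum f A)"
  by (auto simp: hpar_def evenp_sum)

lemma hpar_homog: "hpar n x \<Longrightarrow> evenp x = x \<or> evenp x = 0"
  by (simp add: hpar_def split: if_splits)

lemma hpar_one: "hpar 0 1"
  by (simp add: hpar_def evenp_one)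

lemma hpar_qdet4:
  assumes "\<And>i j. hpar (gpar i j) (g i j)"
  shows "hpar 0 (qdet4 g)"
  unfolding qdet4_def
proof (rule hpar_sum, rule hpar_scaleq)
  fix \<sigma> assume "\<sigma> \<in> {\<sigma>. \<sigma> permutes {I1, I2, I3, I4}}"
  then have \<sigma>: "\<sigma> permutes {I1, I2, I3, I4}" by simp
  have *: "hpar 0 (g i (\<sigma> i))" if "i \<in> {I1, I2, I3, I4}" for i
  proof -
    have "\<sigma> i \<in> {I1, I2, I3, I4}" using that \<sigma> by (simp only: permutes_in_image)
    with that have "gpar i (\<sigma> i) = 0" by (auto simp: gpar_def par_def)
    then show ?thesis using assms[of i "\<sigma> i"] by simp
  qed
  show "hpar 0 (g I1 (\<sigma> I1) * g I2 (\<sigma> I2) * g I3 (\<sigma> I3) * g I4 (\<sigma> I4))"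
    by (intro hpar_mult0 *) simp_all
qed

lemma rel_GL_homog:
  assumes "s \<in> rel_GL" shows "evenp s = s \<or> evenp s = 0"
proof -
  have prod: "hpar n (gen_gl i j * gen_gl k l)" if "even n = even (par i + par j + par k + par l)"
    for i j k l n
    by (rule hpar_cong[OF hpar_mult[OF hpar_gen hpar_gen]]) (use that in \<open>auto simp: gpar_def\<close>)
  have D1: "hpar 0 (qdet4 gen_gl)" by (rule hpar_qdet4) (rule hpar_gen)
  have D2: "hpar 0 (gen_gl I5 I5)"
    by (rule hpar_cong[OF hpar_gen]) (simp add: gpar_def)
  have "hpar 0 (letter_gl D1inv)" "hpar 0 (letter_gl D2inv)"
    by (simp_all add: hpar_def evenp_letter)
  then have inv: "hpar 0 s" if "s \<in> rel_inv"
    using that D1 D2 unfolding rel_inv_def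
    by (elim insertE emptyE) (simp_all add: hpar_diff hpar_mult0 hpar_one)
  have "\<exists>n. hpar n s" if "s \<in> rel_M"
    using that unfolding rel_M_def
    apply (elim UnE CollectE exE conjE)
    subgoal for i j l
      by (rule exI[of _ "par i + par j + par i + par l"])
        (auto intro!: hpar_diff hpar_scaleq prod)
    subgoal for i j k
      by (rule exI[of _ "par i + par j + par k + par j"])
        (auto intro!: hpar_diff hpar_scaleq prod)
    subgoal for i j k l
      by (rule exI[of _ "par i + par j + par k + par l"])
        (auto intro!: hpar_diff hpar_scaleq prod)
    subgoal for i j k l
      by (rule exI[of _ "par i + par j + par k + par l"])
        (auto intro!: hpar_diff hpar_scaleq prod)
    subgoal for i j
      by (rule exI[of _ "par i + par j + par i + par j"])
        (auto intro!: hpar_diff hpar_scaleq prod)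
    done
  with inv assms show ?thesis unfolding rel_GL_def using hpar_homog by blast
qed

quotient_type O_GL = free_gl / "\<lambda>x y. x - y \<in> ideal_gen rel_GL"
  by (rule ideal_equivp)

instantiation O_GL :: cq_superalgebra
begin

lift_definition zero_O_GL :: O_GL is 0 .
lift_definition one_O_GL :: O_GL is 1 .
lift_definition plus_O_GL :: "O_GL \<Rightarrow> O_GL \<Rightarrow> O_GL" is "(+)" by (rule ideal_cong_add)
lift_definition minus_O_GL :: "O_GL \<Rightarrow> O_GL \<Rightarrow> O_GL" is "(-)" by (rule ideal_cong_diff)
lift_definition uminus_O_GL :: "O_GL \<Rightarrow> O_GL" is uminus by (rule ideal_cong_uminus)
lift_definition times_O_GL :: "O_GL \<Rightarrow> O_GL \<Rightarrow> O_GL" is "(*)" by (rule ideal_cong_mult)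
lift_definition scaleq_O_GL :: "Cq \<Rightarrow> O_GL \<Rightarrow> O_GL" is "(*\<^sub>q)" by (rule ideal_cong_scaleq)
lift_definition evenp_O_GL :: "O_GL \<Rightarrow> O_GL" is evenp
  by (rule ideal_cong_evenp[OF rel_GL_homog])

instance
  by standard
    (transfer; simp add: algebra_simps ideal_zero cq.scale_right_distrib cq.scale_left_distrib
      scaleq_one scaleq_mult_left scaleq_mult_right evenp_add evenp_scaleq evenp_idem evenp_one
      evenp_mult)+

end

definition gGL :: "idx \<Rightarrow> idx \<Rightarrow> O_GL" where
  "gGL i j = abs_O_GL (gen_gl i j)"

lemma hom_O_GL: "superalg_hom abs_O_GL"
  by (simp add: superalg_hom_def cq_linear_iff plus_O_GL.abs_eq scaleq_O_GL.abs_eq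
      one_O_GL.abs_eq times_O_GL.abs_eq evenp_O_GL.abs_eq)

lemma superalg_homD:
  assumes "superalg_hom f"
  shows "f (x + y) = f x + f y" "f (x - y) = f x - f y" "f (c *\<^sub>q x) = c *\<^sub>q f x" "f 1 = 1"
    "f (x * y) = f x * f y" "f (evenp x) = evenp (f x)" "f 0 = 0" "f (sum h A) = (\<Sum>i\<in>A. f (h i))"
proof -
  have lin: "cq_linear f" using assms by (simp add: superalg_hom_def)
  show "f (x + y) = f x + f y" by (rule cq_linear_add[OF lin])
  show "f (x - y) = f x - f y" by (rule cq_linear_diff[OF lin])
  show "f (c *\<^sub>q x) = c *\<^sub>q f x" by (rule cq_linear_scale[OF lin])
  show "f 0 = 0" by (rule cq_linear_zero[OF lin])
  show "f (sum h A) = (\<Sum>i\<in>A. f (h i))" by (rule module_hom.sum[OF lin])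
qed (use assms in \<open>simp_all add: superalg_hom_def\<close>)

lemma superalg_hom_hpar: "superalg_hom f \<Longrightarrow> hpar n x \<Longrightarrow> hpar n (f x)"
  by (auto simp: hpar_def superalg_homD(7) simp flip: superalg_homD(6))

lemma superalg_hom_qdet4: "superalg_hom f \<Longrightarrow> f (qdet4 g) = qdet4 (\<lambda>i j. f (g i j))"
  by (simp add: qdet4_def superalg_homD)

lemma rel_GL_zero: "r \<in> rel_GL \<Longrightarrow> abs_O_GL r = 0"
  by (simp add: zero_O_GL_def O_GL.abs_eq_iff ideal_gen_inc)

section \<open>The quantum parabolic supergroup\<close>

definition rel_P :: "O_GL set" where
  "rel_P = {gGL I1 I3, gGL I1 I4, gGL I2 I3, gGL I2 I4, gGL I1 I5, gGL I2 I5}"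

lemma hpar_gGL: "hpar (gpar i j) (gGL i j)"
  unfolding gGL_def by (rule superalg_hom_hpar[OF hom_O_GL hpar_gen])

lemma rel_P_homog:
  assumes "s \<in> rel_P" shows "evenp s = s \<or> evenp s = 0"
  using assms hpar_homog[OF hpar_gGL] by (auto simp: rel_P_def)

quotient_type O_P = O_GL / "\<lambda>x y. x - y \<in> ideal_gen rel_P"
  by (rule ideal_equivp)

instantiation O_P :: cq_superalgebra
begin

lift_definition zero_O_P :: O_P is 0 .
lift_definition one_O_P :: O_P is 1 .
lift_definition plus_O_P :: "O_P \<Rightarrow> O_P \<Rightarrow> O_P" is "(+)" by (rule ideal_cong_add)
lift_definition minus_O_P :: "O_P \<Rightarrow> O_P \<Rightarrow> O_P" is "(-)" by (rule ideal_cong_diff)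
lift_definition uminus_O_P :: "O_P \<Rightarrow> O_P" is uminus by (rule ideal_cong_uminus)
lift_definition times_O_P :: "O_P \<Rightarrow> O_P \<Rightarrow> O_P" is "(*)" by (rule ideal_cong_mult)
lift_definition scaleq_O_P :: "Cq \<Rightarrow> O_P \<Rightarrow> O_P" is "(*\<^sub>q)" by (rule ideal_cong_scaleq)
lift_definition evenp_O_P :: "O_P \<Rightarrow> O_P" is evenp
  by (rule ideal_cong_evenp[OF rel_P_homog])

instance
  by standard
    (transfer; simp add: algebra_simps ideal_zero cq.scale_right_distrib cq.scale_left_distrib
      scaleq_one scaleq_mult_left scaleq_mult_right evenp_add evenp_scaleq evenp_idem evenp_one
      evenp_mult)+

end

definition prP :: "O_GL \<Rightarrow> O_P" where
  "prP = abs_O_P"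

definition gP :: "idx \<Rightarrow> idx \<Rightarrow> O_P" where
  "gP i j = prP (gGL i j)"

definition DP :: "idx \<Rightarrow> idx \<Rightarrow> O_P" where
  "DP i j = gP i I1 * gP j I2 - qpow (- 1) *\<^sub>q (gP i I2 * gP j I1)"

text \<open>
  Indices keep their values in the \<open>5 \<times> 5\<close> generating matrix: the rows of \<open>t\<close> and the entries of
  \<open>\<xi>\<close>, \<open>\<eta>\<close> are indexed by \<open>I3\<close>, \<open>I4\<close>; the columns of \<open>t\<close> and the entries of \<open>\<tau>\<close>,
  \<open>ttau\<close> (that is, \<open>\<tau>\<close> with a tilde) by \<open>I1\<close>, \<open>I2\<close>.  Values elsewhere are irrelevant.
\<close>

definition tP :: "idx \<Rightarrow> idx \<Rightarrow> O_P" where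
  "tP i j = (if j = I1 then - qpow (- 1) *\<^sub>q (DP I2 i * rinv (DP I1 I2)) else DP I1 i * rinv (DP I1 I2))"

definition ttauP :: "idx \<Rightarrow> O_P" where
  "ttauP j = (if j = I1 then - qpow (- 1) *\<^sub>q (DP I2 I5 * rinv (DP I1 I2)) else DP I1 I5 * rinv (DP I1 I2))"

definition xiP :: "idx \<Rightarrow> O_P" where
  "xiP j = rinv (gP I5 I5) * gP I5 j"

definition tauP :: "idx \<Rightarrow> O_P" where
  "tauP j = rinv (gP I5 I5) * gP I5 j"

text \<open>The inverse of the matrix with rows and columns indexed by \<open>J\<close>, over a noncommutative ring.\<close>

definition matrix_rinv ::
  "idx set \<Rightarrow> (idx \<Rightarrow> idx \<Rightarrow> 'a::{ring,monoid_mult}) \<Rightarrow> (idx \<Rightarrow> idx \<Rightarrow> 'a)" where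
  "matrix_rinv J m = (SOME z. \<forall>i\<in>J. \<forall>k\<in>J.
     (\<Sum>j\<in>J. m i j * z j k) = (if i = k then 1 else 0) \<and>
     (\<Sum>j\<in>J. z i j * m j k) = (if i = k then 1 else 0))"

definition etaP :: "idx \<Rightarrow> O_P" where
  "etaP i = (\<Sum>j\<in>{I3, I4}. matrix_rinv {I3, I4} gP i j * gP j I5)"

lemma hom_prP: "superalg_hom prP"
  by (simp add: prP_def superalg_hom_def cq_linear_iff plus_O_P.abs_eq scaleq_O_P.abs_eq
      one_O_P.abs_eq times_O_P.abs_eq evenp_O_P.abs_eq)

lemma hpar_gP: "hpar (gpar i j) (gP i j)"
  unfolding gP_def by (rule superalg_hom_hpar[OF hom_prP hpar_gGL])

lemma rel_P_zero: "r \<in> rel_P \<Longrightarrow> prP r = 0"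
  by (simp add: prP_def zero_O_P_def O_P.abs_eq_iff ideal_gen_inc)

lemma gP_zero: "i \<in> {I1, I2} \<Longrightarrow> j \<in> {I3, I4, I5} \<Longrightarrow> gP i j = 0"
  unfolding gP_def by (rule rel_P_zero) (auto simp: rel_P_def)

lemma gP_commute:
  assumes "i \<in> {I1, I2}" "j \<in> {I1, I2}" "k \<in> {I3, I4}" "l \<in> {I3, I4}"
  shows "gP i j * gP k l = gP k l * gP i j"
proof -
  let ?r = "gen_gl i j * gen_gl k l - (- 1) ^ (gpar i j * gpar k l) *\<^sub>q (gen_gl k l * gen_gl i j)
        - ((- 1) ^ (gpar i j * gpar k j) * (qpow (- 1) - qpow 1)) *\<^sub>q (gen_gl k j * gen_gl i l)"
  have "i < k" "j < l" using assms by (auto simp: less_idx_def)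
  then have "?r \<in> rel_GL" unfolding rel_GL_def rel_M_def by blast
  then have "prP (abs_O_GL ?r) = 0" by (simp add: rel_GL_zero superalg_homD[OF hom_prP])
  moreover have "gpar i j = 0" using assms by (auto simp: gpar_def par_def)
  moreover have "gP i l = 0" using assms by (intro gP_zero) auto
  ultimately show ?thesis
    by (simp add: superalg_homD[OF hom_prP] superalg_homD[OF hom_O_GL] scaleq_one
        flip: gGL_def gP_def)
qed

lemma all_idx: "(\<forall>i. P i) \<longleftrightarrow> P I1 \<and> P I2 \<and> P I3 \<and> P I4 \<and> P I5"
  by (metis idx.exhaust)

definition block_perm :: "bool \<Rightarrow> bool \<Rightarrow> idx \<Rightarrow> idx" where
  "block_perm a b i = (case i of
     I1 \<Rightarrow> if a then I2 else I1 | I2 \<Rightarrow> if a then I1 else I2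
   | I3 \<Rightarrow> if b then I4 else I3 | I4 \<Rightarrow> if b then I3 else I4 | I5 \<Rightarrow> I5)"

lemma block_perm_simps [simp]:
  "block_perm a b I1 = (if a then I2 else I1)" "block_perm a b I2 = (if a then I1 else I2)"
  "block_perm a b I3 = (if b then I4 else I3)" "block_perm a b I4 = (if b then I3 else I4)"
  "block_perm a b I5 = I5"
  by (simp_all add: block_perm_def)

lemma block_perm_permutes: "block_perm a b permutes {I1, I2, I3, I4}"
proof (rule bij_imp_permutes)
  have inv: "block_perm a b (block_perm a b i) = i" for i by (cases i) simp_all
  show "bij_betw (block_perm a b) {I1, I2, I3, I4} {I1, I2, I3, I4}"
    by (rule bij_betwI[where g = "block_perm a b"]) (auto simp: inv)
  show "\<And>x. x \<notin> {I1, I2, I3, I4} \<Longrightarrow> block_perm a b x = x"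
    by (case_tac x) simp_all
qed

lemma block_perm_length: "perm_length (block_perm a b) = (if a then 1 else 0) + (if b then 1 else 0)"
proof -
  have "{(i, j). i < j \<and> block_perm a b j < block_perm a b i}
      = (if a then {(I1, I2)} else {}) \<union> (if b then {(I3, I4)} else {})" (is "?L = ?R")
  proof (rule set_eqI, clarify)
    show "(i, j) \<in> ?L \<longleftrightarrow> (i, j) \<in> ?R" for i j
      by (cases i; cases j) (simp_all add: less_idx_def)
  qed
  then show ?thesis by (simp add: perm_length_def)
qed

lemma block_perm_char:
  assumes \<sigma>: "\<sigma> permutes {I1, I2, I3, I4}" and "\<sigma> I1 \<in> {I1, I2}" "\<sigma> I2 \<in> {I1, I2}"
  shows "\<sigma> = block_perm (\<sigma> I1 = I2) (\<sigma> I3 = I4)"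
proof -
  have ne: "\<sigma> i = \<sigma> j \<longleftrightarrow> i = j" for i j using permutes_inj[OF \<sigma>] by (simp add: inj_eq)
  have 5: "\<sigma> I5 = I5" using \<sigma> by (simp add: permutes_not_in)
  have n5: "\<sigma> I3 \<noteq> I5" "\<sigma> I4 \<noteq> I5" using ne[of I3 I5] ne[of I4 I5] 5 by auto
  have d: "\<sigma> I1 \<noteq> \<sigma> I2" "\<sigma> I3 \<noteq> \<sigma> I4" "\<sigma> I1 \<noteq> \<sigma> I3" "\<sigma> I1 \<noteq> \<sigma> I4" "\<sigma> I2 \<noteq> \<sigma> I3" "\<sigma> I2 \<noteq> \<sigma> I4"
    by (simp_all add: ne)
  have "\<sigma> I3 \<in> {I3, I4}" "\<sigma> I4 \<in> {I3, I4}"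
    using assms(2,3) d n5 by (cases "\<sigma> I3"; cases "\<sigma> I4"; auto)+
  then have "\<forall>i. \<sigma> i = block_perm (\<sigma> I1 = I2) (\<sigma> I3 = I4) i"
    unfolding all_idx using assms(2,3) d 5 by auto
  then show ?thesis by blast
qed

definition D34P :: O_P where
  "D34P = gP I3 I3 * gP I4 I4 - qpow (- 1) *\<^sub>q (gP I3 I4 * gP I4 I3)"

lemma qdet4_gP: "qdet4 gP = DP I1 I2 * D34P"
proof -
  define h where "h \<sigma> = (- qpow (- 1)) ^ perm_length \<sigma> *\<^sub>q
    (gP I1 (\<sigma> I1) * gP I2 (\<sigma> I2) * gP I3 (\<sigma> I3) * gP I4 (\<sigma> I4))" for \<sigma>
  let ?B = "(\<lambda>(a, b). block_perm a b) ` (UNIV :: (bool \<times> bool) set)"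
  have "qdet4 gP = sum h ?B"
    unfolding qdet4_def h_def[symmetric]
  proof (rule sum.mono_neutral_right)
    show "finite {\<sigma>. \<sigma> permutes {I1, I2, I3, I4}}" by (rule finite_permutations) simp
    show "?B \<subseteq> {\<sigma>. \<sigma> permutes {I1, I2, I3, I4}}" by (auto simp: block_perm_permutes)
    show "\<forall>\<sigma>\<in>{\<sigma>. \<sigma> permutes {I1, I2, I3, I4}} - ?B. h \<sigma> = 0"
    proof (rule ballI)
      fix \<sigma> assume "\<sigma> \<in> {\<sigma>. \<sigma> permutes {I1, I2, I3, I4}} - ?B"
      then have "\<sigma> permutes {I1, I2, I3, I4}" "\<sigma> \<notin> ?B" by auto
      moreover have "block_perm a b \<in> ?B" for a b by force
      ultimately have "\<not> (\<sigma> I1 \<in> {I1, I2} \<and> \<sigma> I2 \<in> {I1, I2})"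
        using block_perm_char[of \<sigma>] by metis
      then have "\<sigma> I1 \<in> {I3, I4, I5} \<or> \<sigma> I2 \<in> {I3, I4, I5}" using idx.exhaust by blast
      then have "gP I1 (\<sigma> I1) = 0 \<or> gP I2 (\<sigma> I2) = 0"
        using gP_zero[of I1 "\<sigma> I1"] gP_zero[of I2 "\<sigma> I2"] by blast
      then show "h \<sigma> = 0" by (auto simp: h_def)
    qed
  qed
  also have "\<dots> = (\<Sum>(a, b)\<in>UNIV. h (block_perm a b))"
  proof (subst sum.reindex)
    show "inj_on (\<lambda>(a, b). block_perm a b) UNIV"
    proof (rule injI, clarify)
      fix a b a' b' assume "block_perm a b = block_perm a' b'"
      from fun_cong[OF this, of I1] fun_cong[OF this, of I3] show "a = a' \<and> b = b'"
        by (simp split: if_splits)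
    qed
  qed (simp add: case_prod_unfold comp_def)
  also have "\<dots> = h (block_perm False False) + h (block_perm True False)
      + h (block_perm False True) + h (block_perm True True)"
    by (simp add: UNIV_bool sum.cartesian_product[symmetric] flip: UNIV_Times_UNIV)
  also have "\<dots> = DP I1 I2 * D34P"
    by (simp add: h_def block_perm_length DP_def D34P_def algebra_simps scaleq_one scaleq_mult_left
        scaleq_mult_right cq.scale_right_diff_distrib scaleq_scaleq power2_eq_square)
  finally show ?thesis .
qed

lemma mult_commute_left:
  fixes a b c :: "'a::monoid_mult"
  shows "a * b = b * a \<Longrightarrow> a * c = c * a \<Longrightarrow> a * (b * c) = (b * c) * a"
  by (metis mult.assoc)

lemma mult_commute_right:
  fixes a b c :: "'a::monoid_mult"
  shows "a * c = c * a \<Longrightarrow> b * c = c * b \<Longrightarrow> a * b * c = c * (a * b)"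
  by (metis mult.assoc)

lemma D12_D34_commute: "DP I1 I2 * D34P = D34P * DP I1 I2"
proof -
  have 1: "gP i j * (gP k l * gP m n) = (gP k l * gP m n) * gP i j"
    if "i \<in> {I1, I2}" "j \<in> {I1, I2}" "k \<in> {I3, I4}" "l \<in> {I3, I4}" "m \<in> {I3, I4}" "n \<in> {I3, I4}"
    for i j k l m n
    by (rule mult_commute_left; rule gP_commute) (use that in auto)
  have 2: "gP i j * D34P = D34P * gP i j" if "i \<in> {I1, I2}" "j \<in> {I1, I2}" for i j
    using that by (simp add: D34P_def left_diff_distrib right_diff_distrib scaleq_mult_left
        scaleq_mult_right 1)
  have "gP i j * gP k l * D34P = D34P * (gP i j * gP k l)"
    if "i \<in> {I1, I2}" "j \<in> {I1, I2}" "k \<in> {I1, I2}" "l \<in> {I1, I2}" for i j k l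
    by (rule mult_commute_right; rule 2) (use that in auto)
  then show ?thesis
    by (simp add: DP_def left_diff_distrib right_diff_distrib scaleq_mult_left scaleq_mult_right)
qed

lemma D12_invertible: obtains b where "DP I1 I2 * b = 1" "b * DP I1 I2 = 1"
proof -
  let ?d = "prP (abs_O_GL (letter_gl D1inv))"
  have qdet: "prP (abs_O_GL (qdet4 gen_gl)) = DP I1 I2 * D34P"
    by (simp add: superalg_hom_qdet4[OF hom_O_GL] superalg_hom_qdet4[OF hom_prP] qdet4_gP
        flip: gGL_def gP_def)
  have "prP (abs_O_GL r) = 0" if "r \<in> rel_inv" for r
    using that by (simp add: rel_GL_zero rel_GL_def superalg_homD[OF hom_prP])
  from this[of "qdet4 gen_gl * letter_gl D1inv - 1"] this[of "letter_gl D1inv * qdet4 gen_gl - 1"]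
  have 1: "DP I1 I2 * D34P * ?d = 1" "?d * (DP I1 I2 * D34P) = 1"
    by (simp_all add: rel_inv_def superalg_homD[OF hom_prP] superalg_homD[OF hom_O_GL] qdet)
  have "D34P * ?d = ?d * D34P * DP I1 I2 * (D34P * ?d)"
    using 1(2) by (simp add: D12_D34_commute mult.assoc)
  also have "\<dots> = ?d * D34P" using 1(1) by (simp add: mult.assoc)
  finally have eq: "D34P * ?d = ?d * D34P" .
  have "D34P * ?d * DP I1 I2 = ?d * (DP I1 I2 * D34P)"
    by (simp only: eq mult.assoc D12_D34_commute)
  then have "D34P * ?d * DP I1 I2 = 1" using 1(2) by simp
  moreover have "DP I1 I2 * (D34P * ?d) = 1" using 1(1) by (simp only: mult.assoc)
  ultimately show ?thesis using that by blast
qed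

lemma d_invertible: obtains b where "gP I5 I5 * b = 1" "b * gP I5 I5 = 1"
proof -
  have "prP (abs_O_GL r) = 0" if "r \<in> rel_inv" for r
    using that by (simp add: rel_GL_zero rel_GL_def superalg_homD[OF hom_prP])
  from this[of "gen_gl I5 I5 * letter_gl D2inv - 1"] this[of "letter_gl D2inv * gen_gl I5 I5 - 1"]
  show ?thesis
    using that[of "prP (abs_O_GL (letter_gl D2inv))"]
    by (simp add: rel_inv_def superalg_homD[OF hom_prP] superalg_homD[OF hom_O_GL]
        flip: gGL_def gP_def)
qed

lemma hpar_rinv:
  assumes "hpar 0 a" "a * b = 1" "b * a = 1" shows "hpar 0 (rinv a)"
  using even_inverse[OF assms(2,3)] assms(1) by (simp add: hpar_def rinv_eq[OF assms(2,3)])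

lemma hpar_DP: "hpar (par i + par j) (DP i j)"
  unfolding DP_def
  by (intro hpar_diff hpar_scaleq; rule hpar_cong[OF hpar_mult[OF hpar_gP hpar_gP]])
    (simp_all add: gpar_def par_def)

lemma hpar_rinv_D12: "hpar 0 (rinv (DP I1 I2))"
proof -
  obtain b where "DP I1 I2 * b = 1" "b * DP I1 I2 = 1" by (rule D12_invertible)
  then show ?thesis using hpar_DP[of I1 I2] by (intro hpar_rinv) (simp_all add: par_def)
qed

lemma hpar_rinv_d: "hpar 0 (rinv (gP I5 I5))"
proof -
  obtain b where "gP I5 I5 * b = 1" "b * gP I5 I5 = 1" by (rule d_invertible)
  moreover have "hpar 0 (gP I5 I5)" using hpar_cong[OF hpar_gP[of I5 I5]] by (simp add: gpar_def)
  ultimately show ?thesis by (intro hpar_rinv)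
qed

lemma hpar_DP_quotient: "hpar (par i + par j) (DP i j * rinv (DP I1 I2))"
  using hpar_mult[OF hpar_DP hpar_rinv_D12] by simp

lemma hpar_tP: "hpar (par i) (tP i j)"
  using hpar_DP_quotient[of I1 i] hpar_DP_quotient[of I2 i]
  by (simp add: tP_def par_def hpar_scaleq del: cq.scale_minus_left)

lemma hpar_ttauP: "hpar 1 (ttauP j)"
  using hpar_DP_quotient[of I1 I5] hpar_DP_quotient[of I2 I5]
  by (simp add: ttauP_def par_def hpar_scaleq del: cq.scale_minus_left)

lemma hpar_xiP: "j \<in> {I3, I4} \<Longrightarrow> hpar 1 (xiP j)"
  using hpar_mult[OF hpar_rinv_d hpar_gP[of I5 j]] by (auto simp: xiP_def gpar_def par_def)

section \<open>The quantum big cell\<close>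

definition big_cell_gens :: "O_P set" where
  "big_cell_gens = {tP i j | i j. i \<in> {I3, I4} \<and> j \<in> {I1, I2}} \<union> {ttauP j | j. j \<in> {I1, I2}}"

lemma big_cell_gens_homog: "s \<in> big_cell_gens \<Longrightarrow> evenp s = s \<or> evenp s = 0"
  unfolding big_cell_gens_def using hpar_homog[OF hpar_tP] hpar_homog[OF hpar_ttauP] by blast

typedef O_U = "subalgebra_gen big_cell_gens"
  using subalgebra_gen_closed(1) by blast

setup_lifting type_definition_O_U

instantiation O_U :: cq_superalgebra
begin

lift_definition zero_O_U :: O_U is 0 by (rule subalgebra_gen_closed)
lift_definition one_O_U :: O_U is 1 by (rule subalgebra_gen_closed)
lift_definition plus_O_U :: "O_U \<Rightarrow> O_U \<Rightarrow> O_U" is "(+)" by (rule subalgebra_gen_closed)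
lift_definition minus_O_U :: "O_U \<Rightarrow> O_U \<Rightarrow> O_U" is "(-)" by (rule subalgebra_gen_diff)
lift_definition uminus_O_U :: "O_U \<Rightarrow> O_U" is uminus by (rule subalgebra_gen_uminus)
lift_definition times_O_U :: "O_U \<Rightarrow> O_U \<Rightarrow> O_U" is "(*)" by (rule subalgebra_gen_closed)
lift_definition scaleq_O_U :: "Cq \<Rightarrow> O_U \<Rightarrow> O_U" is "(*\<^sub>q)" by (rule subalgebra_gen_closed)
lift_definition evenp_O_U :: "O_U \<Rightarrow> O_U" is evenp
  by (rule subalgebra_gen_evenp[OF big_cell_gens_homog])

instance
  by standard
    (transfer; simp add: algebra_simps cq.scale_right_distrib cq.scale_left_distrib
      scaleq_one scaleq_mult_left scaleq_mult_right evenp_add evenp_scaleq evenp_idem evenp_one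
      evenp_mult)+

end

text \<open>\<open>Rep_O_U\<close> is the inclusion; \<open>tU\<close> and \<open>ttauU\<close> are the generators as elements of the subring.\<close>

definition tU :: "idx \<Rightarrow> idx \<Rightarrow> O_U" where
  "tU i j = Abs_O_U (tP i j)"

definition ttauU :: "idx \<Rightarrow> O_U" where
  "ttauU j = Abs_O_U (ttauP j)"

lemma Rep_tU: "i \<in> {I3, I4} \<Longrightarrow> j \<in> {I1, I2} \<Longrightarrow> Rep_O_U (tU i j) = tP i j"
  unfolding tU_def
  by (rule Abs_O_U_inverse, rule subalgebra_gen_inc) (auto simp: big_cell_gens_def)

lemma Rep_ttauU: "j \<in> {I1, I2} \<Longrightarrow> Rep_O_U (ttauU j) = ttauP j"
  unfolding ttauU_def
  by (rule Abs_O_U_inverse, rule subalgebra_gen_inc) (auto simp: big_cell_gens_def)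

section \<open>The quantum super Poincare group times dilations\<close>

definition rel_SP :: "O_P set" where
  "rel_SP = {xiP I3, xiP I4}"

lemma rel_SP_homog: "s \<in> rel_SP \<Longrightarrow> evenp s = s \<or> evenp s = 0"
  using hpar_homog[OF hpar_xiP[of I3]] hpar_homog[OF hpar_xiP[of I4]] by (auto simp: rel_SP_def)

quotient_type O_SP = O_P / "\<lambda>x y. x - y \<in> ideal_gen rel_SP"
  by (rule ideal_equivp)

instantiation O_SP :: cq_superalgebra
begin

lift_definition zero_O_SP :: O_SP is 0 .
lift_definition one_O_SP :: O_SP is 1 .
lift_definition plus_O_SP :: "O_SP \<Rightarrow> O_SP \<Rightarrow> O_SP" is "(+)" by (rule ideal_cong_add)
lift_definition minus_O_SP :: "O_SP \<Rightarrow> O_SP \<Rightarrow> O_SP" is "(-)" by (rule ideal_cong_diff)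
lift_definition uminus_O_SP :: "O_SP \<Rightarrow> O_SP" is uminus by (rule ideal_cong_uminus)
lift_definition times_O_SP :: "O_SP \<Rightarrow> O_SP \<Rightarrow> O_SP" is "(*)" by (rule ideal_cong_mult)
lift_definition scaleq_O_SP :: "Cq \<Rightarrow> O_SP \<Rightarrow> O_SP" is "(*\<^sub>q)" by (rule ideal_cong_scaleq)
lift_definition evenp_O_SP :: "O_SP \<Rightarrow> O_SP" is evenp
  by (rule ideal_cong_evenp[OF rel_SP_homog])

instance
  by standard
    (transfer; simp add: algebra_simps ideal_zero cq.scale_right_distrib cq.scale_left_distrib
      scaleq_one scaleq_mult_left scaleq_mult_right evenp_add evenp_scaleq evenp_idem evenp_one
      evenp_mult)+

end

definition prSP :: "O_P \<Rightarrow> O_SP" where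
  "prSP = abs_O_SP"

end

theory Submission
  imports Defs
begin

text \<open>
  The comultiplication maps the big cell \<open>U\<close> into the image of \<open>P \<otimes> U\<close> in \<open>P \<otimes> P\<close>; the difficulty
  is that \<open>P \<otimes> U \<rightarrow> P \<otimes> P\<close> has to be injective over \<open>\<complex>\<^sub>q\<close>.  This is obtained from a linear
  retraction of \<open>P\<close> onto \<open>U\<close>, found as in Radford's theorem on Hopf algebras with a projection.
  The algebra endomorphism \<open>\<phi>\<close> of \<open>P\<close> that sets the lower left block to zero satisfies
  \<open>(id \<otimes> \<phi>) (\<Delta> u) = u \<otimes> 1\<close> on \<open>U\<close> and \<open>(id \<otimes> \<phi>) (\<Delta> h) = \<Delta> h\<close> on the subalgebra \<open>H\<close>
  generated by the diagonal blocks, so \<open>a \<mapsto> a\<^sub>1 S(\<phi>(a\<^sub>2))\<close> maps \<open>u h\<close> to \<open>\<epsilon>(h) u\<close>; and the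
  commutation relations show that \<open>P\<close> is spanned by the products \<open>u h\<close>.  The formulas
  come from \<open>g\<^sub>i\<^sub>j = \<Sum>\<^sub>k t\<^sub>i\<^sub>k x\<^sub>k\<^sub>j\<close>: apply \<open>\<Delta>\<close> and cancel the invertible matrix \<open>1 \<otimes> x\<close>.
\<close>

section \<open>Multilinear maps\<close>

text \<open>Over a field the injectivity would be automatic; over the Laurent polynomials it is a
  question of flatness, and no basis of P is at hand. A linear left inverse of the inclusion
  survives tensoring and settles it, and for its construction the products u h merely have to span
  P. A second obstacle is that the structure maps of P and of P/(\<xi>) are evaluated at arbitrary
  representatives and must be shown to be well defined. For the antipode this rests on S(a b) =
  (-1)^{|a||b|} S(b) S(a), which is not among the axioms of \<open>hopf_superalgebra\<close> and has
  to be derived. Of the Hopf structure of GL_q(4|1) only the axioms and the values of \<Delta> and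
  \<epsilon> on the g_ij are given. What else is required, such as S(x) = x^{-1} or \<Delta> on
  inverses of determinants, is forced by the uniqueness of inverses.\<close>

lemma cq_linear_id: "cq_linear id" "cq_linear (\<lambda>x. x)"
  by (simp_all add: cq_linear_iff)

lemma cq_linear_compose:
  assumes "cq_linear f" "cq_linear g" shows "cq_linear (\<lambda>x. f (g x))"
  using assms by (simp add: cq_linear_iff)

lemma cq_linear_mult: "cq_linear ((*) a)" "cq_linear (\<lambda>x. x * a)"
  for a :: "'a::cq_superalgebra"
  by (simp_all add: cq_linear_iff distrib_left distrib_right scaleq_mult_left scaleq_mult_right)

lemma superalg_hom_linear: "superalg_hom f \<Longrightarrow> cq_linear f"
  by (simp add: superalg_hom_def)

lemma superalg_hom_id: "superalg_hom id"
  by (simp add: superalg_hom_def cq_linear_id)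

lemma superalg_hom_compose:
  assumes "superalg_hom f" "superalg_hom g" shows "superalg_hom (\<lambda>x. f (g x))"
  using assms by (auto simp: superalg_hom_def cq_linear_iff)

lemma superalg_hom_oddp: "superalg_hom f \<Longrightarrow> f (oddp x) = oddp (f x)"
  by (simp add: oddp_def superalg_homD)

lemma bilinear_compose:
  assumes "bilinear_q B" "cq_linear f" "cq_linear g"
  shows "bilinear_q (\<lambda>a b. B (f a) (g b))"
  using assms by (simp add: bilinear_q_def cq_linear_iff)

lemma linear_bilinear:
  assumes "cq_linear F" "bilinear_q B" shows "bilinear_q (\<lambda>a b. F (B a b))"
  using assms by (simp add: bilinear_q_def cq_linear_iff)

lemma mult_bilinear: "bilinear_q ((*) :: 'a::cq_superalgebra \<Rightarrow> 'a \<Rightarrow> 'a)"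
  by (simp add: bilinear_q_def cq_linear_mult)

lemma tensor_linear_eqI:
  assumes "cq_linear f" "cq_linear g" "\<And>a b. f (a \<otimes> b) = g (a \<otimes> b)"
  shows "f x = g x"
  by (induction x) (simp_all add: assms(3) cq_linear_add[OF assms(1)] cq_linear_add[OF assms(2)])

text \<open>Linearity in a parameter while the tensor is fixed, the counterpart of
  \<open>tlift_linear\<close>. Nested uses of \<open>tlift\<close>, as in the associator, need
  both.\<close>

lemma tlift_bilinear_outer:
  assumes 1: "\<And>b c. cq_linear (\<lambda>a. B a b c)" and 2: "\<And>a. bilinear_q (B a)"
  shows "cq_linear (\<lambda>a. tlift (B a) y)"
proof (rule cq_linearI)
  show "tlift (B (a + a')) y = tlift (B a) y + tlift (B a') y" for a a'
    by (rule tlift_add_fun) (use 1 2 in \<open>auto simp: cq_linear_iff\<close>)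
  show "tlift (B (c *\<^sub>q a)) y = c *\<^sub>q tlift (B a) y" for c a
    by (rule tlift_scale_fun) (use 1 2 in \<open>auto simp: cq_linear_iff\<close>)
qed

lemma map_tensor_bilinear:
  assumes "cq_linear f" "cq_linear g" shows "bilinear_q (\<lambda>a b. f a \<otimes> g b)"
  by (rule bilinear_compose[OF tens_bilinear assms])

lemma map_tensor_tens:
  assumes "cq_linear f" "cq_linear g" shows "map_tensor f g (a \<otimes> b) = f a \<otimes> g b"
  unfolding map_tensor_def by (rule tlift_tens[OF map_tensor_bilinear[OF assms]])

lemma map_tensor_linear:
  assumes "cq_linear f" "cq_linear g" shows "cq_linear (map_tensor f g)"
  unfolding map_tensor_def by (rule tlift_linear[OF map_tensor_bilinear[OF assms]])

lemma map_tensor_compose: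
  assumes "cq_linear f" "cq_linear g" "cq_linear f'" "cq_linear g'"
  shows "map_tensor f g (map_tensor f' g' x) = map_tensor (\<lambda>a. f (f' a)) (\<lambda>b. g (g' b)) x"
  by (rule tensor_linear_eqI[OF cq_linear_compose[OF map_tensor_linear map_tensor_linear] map_tensor_linear])
    (simp_all add: map_tensor_tens assms cq_linear_compose[OF assms(1,3)] cq_linear_compose[OF assms(2,4)])

lemma map_tensor_id: "map_tensor id id x = x" "map_tensor (\<lambda>x. x) (\<lambda>x. x) x = x"
  by (induction x) (simp_all add: cq_linear_id map_tensor_tens cq_linear_add[OF map_tensor_linear])

lemma tlift_map_tensor:
  assumes "bilinear_q B" "cq_linear f" "cq_linear g"
  shows "tlift B (map_tensor f g x) = tlift (\<lambda>a b. B (f a) (g b)) x"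
  by (rule tensor_linear_eqI[OF cq_linear_compose[OF tlift_linear map_tensor_linear] tlift_linear])
    (simp_all add: map_tensor_tens tlift_tens bilinear_compose[OF assms] assms)

lemma linear_tlift:
  assumes "cq_linear F" "bilinear_q B"
  shows "F (tlift B x) = tlift (\<lambda>a b. F (B a b)) x"
  by (rule tensor_linear_eqI[OF cq_linear_compose[OF _ tlift_linear] tlift_linear])
    (simp_all add: tlift_tens linear_bilinear[OF assms] assms)

lemma tensor_assoc_inner: "cq_linear (tlift (\<lambda>a b. a \<otimes> (b \<otimes> c)))"
  and tensor_assoc_inner_tens: "tlift (\<lambda>a b. a \<otimes> (b \<otimes> c)) (a \<otimes> b) = a \<otimes> (b \<otimes> c)"
proof -
  have "bilinear_q (\<lambda>a b. a \<otimes> (b \<otimes> c))"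
    by (rule bilinear_compose[OF tens_bilinear cq_linear_id(2) cq_linear_tens(1)])
  then show "cq_linear (tlift (\<lambda>a b. a \<otimes> (b \<otimes> c)))"
    "tlift (\<lambda>a b. a \<otimes> (b \<otimes> c)) (a \<otimes> b) = a \<otimes> (b \<otimes> c)"
    by (rule tlift_linear tlift_tens)+
qed

lemma tensor_assoc_bilinear: "bilinear_q (\<lambda>x c. tlift (\<lambda>a b. a \<otimes> (b \<otimes> c)) x)"
  unfolding bilinear_q_def
proof (intro conjI allI)
  show "cq_linear (\<lambda>c. tlift (\<lambda>a b. a \<otimes> (b \<otimes> c)) x)" for x :: "('a, 'b) tensor"
    by (rule tlift_bilinear_outer)
      (rule cq_linear_compose[OF cq_linear_tens(2) cq_linear_tens(2)]
        bilinear_compose[OF tens_bilinear cq_linear_id(2) cq_linear_tens(1)])+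
qed (rule tensor_assoc_inner)

lemma tensor_assoc_linear: "cq_linear tensor_assoc"
  unfolding tensor_assoc_def by (rule tlift_linear[OF tensor_assoc_bilinear])

lemma tensor_assoc_tens: "tensor_assoc ((a \<otimes> b) \<otimes> c) = a \<otimes> (b \<otimes> c)"
  unfolding tensor_assoc_def by (simp add: tlift_tens tensor_assoc_bilinear tensor_assoc_inner_tens)

lemma tensor3_linear_eqI:
  assumes "cq_linear f" "cq_linear g" "\<And>a b c. f ((a \<otimes> b) \<otimes> c) = g ((a \<otimes> b) \<otimes> c)"
  shows "f x = g x"
proof (rule tensor_linear_eqI[OF assms(1,2)])
  show "f (y \<otimes> c) = g (y \<otimes> c)" for y c
    by (rule tensor_linear_eqI[where f = "\<lambda>y. f (y \<otimes> c)"])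
      (rule cq_linear_compose[OF assms(1) cq_linear_tens(1)]
        cq_linear_compose[OF assms(2) cq_linear_tens(1)] assms(3))+
qed

lemma tensor_assoc_map_tensor:
  assumes "cq_linear f" "cq_linear g" "cq_linear h"
  shows "tensor_assoc (map_tensor (map_tensor f g) h x) = map_tensor f (map_tensor g h) (tensor_assoc x)"
  by (rule tensor3_linear_eqI[OF cq_linear_compose[OF tensor_assoc_linear map_tensor_linear]
        cq_linear_compose[OF map_tensor_linear tensor_assoc_linear]])
    (simp_all add: map_tensor_tens map_tensor_linear tensor_assoc_tens assms)

lemma map_tensor_superalg_hom:
  assumes f: "superalg_hom f" and g: "superalg_hom g"
  shows "superalg_hom (map_tensor f g)"
proof -
  note lin = superalg_hom_linear[OF f] superalg_hom_linear[OF g]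
  note L = map_tensor_linear[OF lin]
  have mult: "map_tensor f g (x * y) = map_tensor f g x * map_tensor f g y" for x y
  proof (induction x)
    case (tens a b)
    show ?case
      by (induction y)
        (simp_all add: tensor_mult_tens super_tmult_def map_tensor_tens[OF lin] cq_linear_add[OF L]
          cq_linear_diff[OF L] superalg_homD[OF f] superalg_homD[OF g] superalg_hom_oddp[OF f]
          superalg_hom_oddp[OF g] distrib_left)
  qed (simp add: distrib_right cq_linear_add[OF L])
  have "map_tensor f g (evenp x) = evenp (map_tensor f g x)" for x
    by (induction x)
      (simp_all add: tensor_evenp_tens map_tensor_tens[OF lin] cq_linear_add[OF L] evenp_add
          superalg_homD[OF f] superalg_homD[OF g] superalg_hom_oddp[OF f] superalg_hom_oddp[OF g])
  then show ?thesis
    unfolding superalg_hom_def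
    by (simp add: L mult one_tensor_def map_tensor_tens[OF lin] superalg_homD[OF f] superalg_homD[OF g])
qed

text \<open>The sign rule only bites when both inner factors \<open>b\<close> and \<open>c\<close>
  are odd.\<close>

lemma tens_mult_tens_even:
  assumes "evenp b = b \<or> evenp c = c"
  shows "(a \<otimes> b) * (c \<otimes> d) = (a * c) \<otimes> (b * d)"
  using assms
proof
  assume "evenp b = b"
  then have "oddp b = 0" by (simp add: oddp_def)
  with \<open>evenp b = b\<close> show ?thesis
    by (simp add: tensor_mult_tens super_tmult_def even_plus_odd flip: tens_add_left distrib_left)
next
  assume "evenp c = c"
  then have "oddp c = 0" by (simp add: oddp_def)
  with \<open>evenp c = c\<close> show ?thesis
    by (simp add: tensor_mult_tens super_tmult_def even_plus_odd flip: tens_add_right distrib_right)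
qed

lemma tens_mult_one [simp]:
  "(a \<otimes> 1) * (c \<otimes> d) = (a * c) \<otimes> d" "(a \<otimes> b) * (1 \<otimes> d) = a \<otimes> (b * d)"
  by (simp_all add: tens_mult_tens_even evenp_one)

section \<open>Quotients of Hopf superalgebras\<close>

lemma tlift_add_arg: "bilinear_q B \<Longrightarrow> tlift B (x + y) = tlift B x + tlift B y"
  by (rule cq_linear_add[OF tlift_linear])

section \<open>Anti-multiplicativity of the antipode\<close>

context hopf_superalgebra
begin

lemma comult_linear: "cq_linear \<Delta>"
  by (rule superalg_hom_linear[OF comult_hom])

lemma counit_scale_bilinear: "bilinear_q (\<lambda>a b. \<epsilon> a *\<^sub>q b)" "bilinear_q (\<lambda>a b. \<epsilon> b *\<^sub>q a)"
  by (simp_all add: bilinear_q_def cq_linear_iff counit_add counit_scaleq cq.scale_right_distrib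
      cq.scale_left_distrib scaleq_scaleq mult.commute)

lemma counit_zero: "\<epsilon> 0 = 0"
  using counit_scaleq[of 0 0] by simp

lemma counit_diff: "\<epsilon> (x - y) = \<epsilon> x - \<epsilon> y"
  by (metis add_diff_cancel_right' counit_add diff_add_cancel)

lemma counit_unit_linear: "cq_linear (\<lambda>x. \<epsilon> x *\<^sub>q 1)"
  by (simp add: cq_linear_iff counit_add counit_scaleq cq.scale_left_distrib scaleq_scaleq)

lemma antipode_left_bilinear: "bilinear_q (\<lambda>a b. S a * b)"
  and antipode_right_bilinear: "bilinear_q (\<lambda>a b. a * S b)"
  by (rule bilinear_compose[OF mult_bilinear] antipode_linear cq_linear_id(2))+

text \<open>The Galois map p \<otimes> s -> p_1 \<otimes> p_2 s, whose inverse is p \<otimes> s ->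
  p_1 \<otimes> S(p_2) s. It takes the place of a convolution algebra on H \<otimes> H, and the
  factor 1 \<otimes> s creates no signs because 1 is even.\<close>

definition fusion :: "('h, 'h) tensor \<Rightarrow> ('h, 'h) tensor" where
  "fusion = tlift (\<lambda>p s. \<Delta> p * (1 \<otimes> s))"

lemma fusion_bilinear: "bilinear_q (\<lambda>p s. \<Delta> p * (1 \<otimes> s))"
  by (rule bilinear_compose[OF mult_bilinear comult_linear cq_linear_tens(2)])

lemmas fusion_linear = tlift_linear[OF fusion_bilinear, folded fusion_def]
lemmas fusion_tens = tlift_tens[OF fusion_bilinear, folded fusion_def]

text \<open>S(p_1) p_2 s = \<epsilon>(p) s.\<close>

lemma antipode_fusion:
  "tlift (\<lambda>a b. S a * b) (fusion w) = tlift (\<lambda>a b. \<epsilon> a *\<^sub>q b) w"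
proof -
  let ?m = "tlift (\<lambda>a b. S a * b)"
  note m = antipode_left_bilinear
  have right: "?m (z * (1 \<otimes> s)) = ?m z * s" for z s
    by (induction z) (simp_all add: tlift_tens[OF m] tlift_add_arg[OF m] distrib_right mult.assoc)
  show ?thesis
    by (induction w)
      (simp_all add: fusion_tens cq_linear_add[OF fusion_linear] tlift_add_arg m right
        antipode_left scaleq_mult_left tlift_tens counit_scale_bilinear)
qed

text \<open>By coassociativity the left side is a_1 \<otimes> a_2 S(a_3) = a_1 \<otimes>
  \<epsilon>(a_2) 1.\<close>

lemma fusion_antipode: "fusion (map_tensor id S (\<Delta> a)) = a \<otimes> 1"
proof -
  let ?m = "tlift (\<lambda>a b. a * S b)"
  note m = antipode_right_bilinear
  note m_lin = tlift_linear[OF m]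
  have 1: "z * (1 \<otimes> S b) = map_tensor id ?m (tensor_assoc (z \<otimes> b))" for z b
    by (induction z)
      (simp_all add: map_tensor_tens cq_linear_id m_lin tensor_assoc_tens tlift_tens[OF m]
        tens_add_left cq_linear_add[OF tensor_assoc_linear] distrib_right
        cq_linear_add[OF map_tensor_linear])
  have "fusion (map_tensor id S w) = map_tensor id ?m (tensor_assoc (map_tensor \<Delta> id w))" for w
    by (induction w)
      (simp_all add: map_tensor_tens cq_linear_id antipode_linear fusion_tens 1 comult_linear
        cq_linear_add[OF map_tensor_linear] m_lin cq_linear_add[OF fusion_linear]
        cq_linear_add[OF tensor_assoc_linear] id_def)
  then have "fusion (map_tensor id S (\<Delta> a)) = map_tensor id ?m (map_tensor id \<Delta> (\<Delta> a))"
    by (simp add: coassoc)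
  also have "\<dots> = map_tensor id (\<lambda>b. \<epsilon> b *\<^sub>q 1) (\<Delta> a)"
    by (simp add: map_tensor_compose cq_linear_id m_lin comult_linear antipode_right id_def)
  also have "map_tensor id (\<lambda>b. \<epsilon> b *\<^sub>q 1) z = tlift (\<lambda>a b. \<epsilon> b *\<^sub>q a) z \<otimes> (1 :: 'h)" for z
    by (induction z)
      (simp_all add: map_tensor_tens cq_linear_id counit_unit_linear tlift_tens tlift_add_arg
        counit_scale_bilinear tens_scale_left tens_scale_right tens_add_left
        cq_linear_add[OF map_tensor_linear])
  finally show ?thesis by (simp add: counit_right)
qed

text \<open>
  An element \<open>w\<close> with \<open>fusion w = c \<otimes> 1\<close> satisfies \<open>S c = (\<epsilon> \<otimes> id) w\<close>.  For \<open>c = ab\<close>, such a \<open>w\<close>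
  is assembled from the elements \<open>(id \<otimes> S) (\<Delta> a)\<close> and \<open>(id \<otimes> S) (\<Delta> b)\<close>.
\<close>

lemma antipode_mult_twisted:
  assumes \<sigma>: "cq_linear \<sigma>" and comm: "\<And>s. b \<otimes> \<sigma> s = (1 \<otimes> s) * (b \<otimes> (1 :: 'h))"
  shows "S (a * b) = S b * \<sigma> (S a)"
proof -
  let ?K = "tlift (\<lambda>a b. \<epsilon> a *\<^sub>q b)"
  let ?u = "map_tensor id S (\<Delta> a)" and ?v = "map_tensor id S (\<Delta> b)"
  note K = counit_scale_bilinear(1)
  define L where "L p s = tlift (\<lambda>p' s'. (p * p') \<otimes> (s' * s))" for p s :: 'h
  \<comment> \<open>\<open>V\<close> sends p \<otimes> s to p b_1 \<otimes> S(b_2) \<sigma>(s). The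
    map \<sigma> supplies the sign that arises when b moves past s.\<close>
  define V where "V = tlift (\<lambda>p s. L p (\<sigma> s) ?v)"
  have Lb: "bilinear_q (\<lambda>p' s'. (p * p') \<otimes> (s' * s))" for p s :: 'h
    by (rule bilinear_compose[OF tens_bilinear cq_linear_mult])
  note L_lin = tlift_linear[OF Lb, folded L_def] and L_tens = tlift_tens[OF Lb, folded L_def]
  have Vb: "bilinear_q (\<lambda>p s. L p (\<sigma> s) ?v)"
    unfolding bilinear_q_def L_def
  proof (intro conjI allI)
    show "cq_linear (\<lambda>p. tlift (\<lambda>p' s'. (p * p') \<otimes> (s' * \<sigma> s)) ?v)" for s
      by (rule tlift_bilinear_outer)
        (rule cq_linear_compose[OF cq_linear_tens(1) cq_linear_mult(2)] Lb)+
    show "cq_linear (\<lambda>s. tlift (\<lambda>p' s'. (p * p') \<otimes> (s' * \<sigma> s)) ?v)" for p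
      by (rule tlift_bilinear_outer)
        (rule cq_linear_compose[OF cq_linear_tens(2)] cq_linear_compose[OF cq_linear_mult(1) \<sigma>] Lb)+
  qed
  note V_lin = tlift_linear[OF Vb, folded V_def] and V_tens = tlift_tens[OF Vb, folded V_def]
  have fusion_L: "fusion (L p s v) = \<Delta> p * fusion v * (1 \<otimes> s)" for p s v
    by (induction v)
      (simp_all add: L_tens fusion_tens superalg_homD[OF comult_hom] mult.assoc distrib_left
        distrib_right cq_linear_add[OF fusion_linear] cq_linear_add[OF L_lin])
  have fusion_V: "fusion (V w) = fusion w * (b \<otimes> 1)" for w
  proof (induction w)
    case (tens p s)
    have "fusion (V (p \<otimes> s)) = \<Delta> p * ((b \<otimes> 1) * (1 \<otimes> \<sigma> s))"
      by (simp only: V_tens fusion_L fusion_antipode mult.assoc)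
    also have "(b \<otimes> 1) * (1 \<otimes> \<sigma> s) = (1 \<otimes> s) * (b \<otimes> 1)" by (simp add: comm)
    finally show ?case by (simp only: fusion_tens mult.assoc)
  qed (simp add: cq_linear_add[OF V_lin] cq_linear_add[OF fusion_linear] distrib_right)
  have K_L: "?K (L p s v) = \<epsilon> p *\<^sub>q (?K v * s)" for p s v
    by (induction v)
      (simp_all add: L_tens tlift_tens tlift_add_arg K counit_mult scaleq_scaleq scaleq_mult_left
        cq_linear_add[OF L_lin] distrib_right cq.scale_right_distrib)
  have K_V: "?K (V w) = ?K ?v * \<sigma> (?K w)" for w
    by (induction w)
      (simp_all add: V_tens K_L tlift_tens tlift_add_arg K cq_linear_scale[OF \<sigma>] scaleq_mult_right
        cq_linear_add[OF \<sigma>] cq_linear_add[OF V_lin] distrib_left id_def)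
  have S_eq: "S c = ?K w" if "fusion w = c \<otimes> 1" for c w
    using antipode_fusion[of w] by (simp add: that tlift_tens antipode_left_bilinear)
  have "fusion (V ?u) = (a * b) \<otimes> 1"
    by (simp add: fusion_V fusion_antipode)
  then have "S (a * b) = ?K (V ?u)" by (rule S_eq)
  also have "\<dots> = S b * \<sigma> (S a)"
    by (simp only: K_V S_eq[OF fusion_antipode])
  finally show ?thesis .
qed

text \<open>S preserves parity, so the sign (-1)^{|a||b|} can be carried by S(a): for odd b it is
  the parity automorphism, even part minus odd part.\<close>

lemma antipode_mult:
  "S (a * b) = S (evenp b) * S a + S (oddp b) * (evenp (S a) - oddp (S a))"
proof -
  let ?s = "\<lambda>x :: 'h. evenp x - oddp x"
  have even: "S (a * evenp b) = S (evenp b) * id (S a)"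
    by (rule antipode_mult_twisted) (simp_all add: cq_linear_id tens_mult_tens_even evenp_idem)
  have odd: "S (a * oddp b) = S (oddp b) * ?s (S a)"
  proof (rule antipode_mult_twisted)
    show "cq_linear ?s"
      by (simp add: cq_linear_iff evenp_add oddp_add evenp_scaleq oddp_scaleq algebra_simps
          cq.scale_right_diff_distrib)
    show "oddp b \<otimes> ?s s = (1 \<otimes> s) * (oddp b \<otimes> 1)" for s
      by (simp add: tensor_mult_tens super_tmult_def tens_diff_right)
  qed
  have "S (a * b) = S (a * evenp b) + S (a * oddp b)"
    by (simp only: cq_linear_add[OF antipode_linear, symmetric] distrib_left[symmetric] even_plus_odd)
  then show ?thesis using even odd by simp
qed

end

section \<open>Hopf ideals tested on generators\<close>

lemma superalg_hom_kernel_ideal: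
  assumes "superalg_hom f" shows "two_sided_ideal {x. f x = 0}"
  by (simp add: two_sided_ideal_def superalg_homD[OF assms])

text \<open>Conditions on the generators \<open>R\<close> are enough because the elements killed by
  each induced map form a two-sided ideal; for the antipode this follows from
  \<open>antipode_mult\<close>.\<close>

locale hopf_quotient = hopf_superalgebra \<Delta> \<epsilon> S
  for \<Delta> :: "'h::cq_superalgebra \<Rightarrow> ('h, 'h) tensor" and \<epsilon> :: "'h \<Rightarrow> Cq" and S :: "'h \<Rightarrow> 'h" +
  fixes \<pi> :: "'h \<Rightarrow> 'k::cq_superalgebra" and R :: "'h set"
  assumes proj_hom: "superalg_hom \<pi>"
    and proj_surj: "surj \<pi>"
    and proj_kernel: "\<pi> x = 0 \<Longrightarrow> x \<in> ideal_gen R"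
    and comult_rel: "r \<in> R \<Longrightarrow> map_tensor \<pi> \<pi> (\<Delta> r) = 0"
    and counit_rel: "r \<in> R \<Longrightarrow> \<epsilon> r = 0"
    and antipode_rel: "r \<in> R \<Longrightarrow> \<pi> (S r) = 0"
begin

lemma proj_linear: "cq_linear \<pi>"
  by (rule superalg_hom_linear[OF proj_hom])

lemma proj_comult_hom: "superalg_hom (\<lambda>x. map_tensor \<pi> \<pi> (\<Delta> x))"
  by (rule superalg_hom_compose[OF map_tensor_superalg_hom[OF proj_hom proj_hom] comult_hom])

lemma inv_proj_diff: "inv \<pi> (\<pi> x) - x \<in> ideal_gen R"
  by (rule proj_kernel) (simp add: superalg_homD[OF proj_hom] surj_f_inv_f[OF proj_surj])

lemma quot_comult_proj: "quot_comult \<pi> \<Delta> (\<pi> x) = map_tensor \<pi> \<pi> (\<Delta> x)"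
proof -
  have "ideal_gen R \<subseteq> {x. map_tensor \<pi> \<pi> (\<Delta> x) = 0}"
    by (rule ideal_gen_min[OF _ superalg_hom_kernel_ideal[OF proj_comult_hom]])
      (auto simp: comult_rel)
  then have "map_tensor \<pi> \<pi> (\<Delta> (inv \<pi> (\<pi> x) - x)) = 0" using inv_proj_diff by blast
  then show ?thesis by (simp add: superalg_homD(2)[OF proj_comult_hom] quot_comult_def)
qed

lemma quot_counit_proj: "quot_counit \<pi> \<epsilon> (\<pi> x) = \<epsilon> x"
proof -
  have "ideal_gen R \<subseteq> {x. \<epsilon> x = 0}"
    by (rule ideal_gen_min)
      (auto simp: counit_rel two_sided_ideal_def counit_zero counit_add counit_mult)
  then have "\<epsilon> (inv \<pi> (\<pi> x) - x) = 0" using inv_proj_diff by blast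
  then show ?thesis by (simp add: counit_diff quot_counit_def)
qed

lemma quot_antipode_proj: "quot_antipode \<pi> S (\<pi> x) = \<pi> (S x)"
proof -
  note homD = superalg_homD[OF proj_hom] and S_add = cq_linear_add[OF antipode_linear]
  \<comment> \<open>\<open>antipode_mult\<close> splits its right factor by parity, so the elements
    killed by \<pi> after S have to be closed under taking even and odd parts.\<close>
  have parts: "\<pi> (S (evenp x)) = 0" "\<pi> (S (oddp x)) = 0" if "\<pi> (S x) = 0" for x
    using that by (simp_all add: oddp_def antipode_even homD cq_linear_diff[OF antipode_linear])
  have "ideal_gen R \<subseteq> {x. \<pi> (S x) = 0}"
  proof (rule ideal_gen_min)
    show "two_sided_ideal {x. \<pi> (S x) = 0}"
      unfolding two_sided_ideal_def
      using parts by (simp add: homD S_add cq_linear_zero[OF antipode_linear] antipode_mult oddp_def)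
  qed (auto simp: antipode_rel)
  then have "\<pi> (S (inv \<pi> (\<pi> x) - x)) = 0" using inv_proj_diff by blast
  then show ?thesis by (simp add: quot_antipode_def cq_linear_diff[OF antipode_linear] homD)
qed

lemma proj_cases: obtains y where "x = \<pi> y"
  using proj_surj by (metis surjD)

abbreviation "\<Delta>' \<equiv> quot_comult \<pi> \<Delta>"
abbreviation "\<epsilon>' \<equiv> quot_counit \<pi> \<epsilon>"
abbreviation "S' \<equiv> quot_antipode \<pi> S"

lemma quot_comult_hom: "superalg_hom \<Delta>'"
proof -
  note homD = superalg_homD[OF proj_comult_hom] and p = superalg_homD[OF proj_hom]
  have "\<Delta>' (x + y) = \<Delta>' x + \<Delta>' y" "\<Delta>' (x * y) = \<Delta>' x * \<Delta>' y" "\<Delta>' (c *\<^sub>q x) = c *\<^sub>q \<Delta>' x"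
    "\<Delta>' (evenp x) = evenp (\<Delta>' x)" for x y c
    by (cases x rule: proj_cases; cases y rule: proj_cases;
        simp add: quot_comult_proj homD flip: p)+
  moreover have "\<Delta>' 1 = 1" using quot_comult_proj[of 1] by (simp add: homD p)
  ultimately show ?thesis by (simp add: superalg_hom_def cq_linear_iff)
qed

lemma quot_antipode_linear: "cq_linear S'"
proof (rule cq_linearI)
  note p = superalg_homD[OF proj_hom]
  show "S' (x + y) = S' x + S' y" for x y
    by (cases x rule: proj_cases; cases y rule: proj_cases)
      (simp add: quot_antipode_proj cq_linear_add[OF antipode_linear] p(1) flip: p(1))
  show "S' (c *\<^sub>q x) = c *\<^sub>q S' x" for c x
    by (cases x rule: proj_cases)
      (simp add: quot_antipode_proj cq_linear_scale[OF antipode_linear] p(3) flip: p(3))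
qed

text \<open>The free \<open>f\<close> lets one computation serve coassociativity of the quotient
  (\<open>f\<close> = \<pi>) and the coaction law after projection (\<open>f\<close> = id).\<close>

lemma map_quot_comult:
  assumes f: "cq_linear f"
  shows "tensor_assoc (map_tensor \<Delta>' id (map_tensor \<pi> f w))
    = map_tensor \<pi> (map_tensor \<pi> f) (tensor_assoc (map_tensor \<Delta> id w))"
proof -
  note lin = proj_linear f comult_linear cq_linear_id superalg_hom_linear[OF quot_comult_hom]
  have "map_tensor \<Delta>' id (map_tensor \<pi> f w) = map_tensor (map_tensor \<pi> \<pi>) f (map_tensor \<Delta> id w)"
    by (simp add: map_tensor_compose lin map_tensor_linear quot_comult_proj)
  then show ?thesis by (simp add: tensor_assoc_map_tensor lin)
qed

lemma quot_counit_scale_bilinear: "bilinear_q (\<lambda>a b. \<epsilon>' a *\<^sub>q b)" "bilinear_q (\<lambda>a b. \<epsilon>' b *\<^sub>q a)"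
proof -
  note p = superalg_homD[OF proj_hom]
  have "\<epsilon>' (x + y) = \<epsilon>' x + \<epsilon>' y" "\<epsilon>' (c *\<^sub>q x) = c * \<epsilon>' x" for x y c
    by (cases x rule: proj_cases; cases y rule: proj_cases;
        simp add: quot_counit_proj counit_add counit_scaleq flip: p)+
  then show "bilinear_q (\<lambda>a b. \<epsilon>' a *\<^sub>q b)" "bilinear_q (\<lambda>a b. \<epsilon>' b *\<^sub>q a)"
    by (simp_all add: bilinear_q_def cq_linear_iff cq.scale_right_distrib
        cq.scale_left_distrib scaleq_scaleq mult.commute)
qed

theorem quot_hopf_superalgebra: "hopf_superalgebra \<Delta>' \<epsilon>' S'"
proof (rule hopf_superalgebra.intro)
  note p = superalg_homD[OF proj_hom]
  note lin = proj_linear cq_linear_id comult_linear superalg_hom_linear[OF quot_comult_hom]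
    map_tensor_linear quot_antipode_linear
  note bil = counit_scale_bilinear antipode_left_bilinear antipode_right_bilinear
  have p_one: "1 = \<pi> 1" by (simp add: p)
  show "superalg_hom \<Delta>'" by (rule quot_comult_hom)
  show "cq_linear S'" by (rule quot_antipode_linear)
  show "\<epsilon>' 1 = 1" by (simp add: p_one quot_counit_proj counit_one)
  fix x y :: 'k and c
  obtain u v where x: "x = \<pi> u" and y: "y = \<pi> v" using proj_cases by metis
  show "\<epsilon>' (x + y) = \<epsilon>' x + \<epsilon>' y" "\<epsilon>' (c *\<^sub>q x) = c * \<epsilon>' x" "\<epsilon>' (x * y) = \<epsilon>' x * \<epsilon>' y"
    "\<epsilon>' (evenp x) = \<epsilon>' x"
    by (simp_all add: x y quot_counit_proj counit_add counit_scaleq counit_mult counit_even flip: p)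
  show "S' (evenp x) = evenp (S' x)"
    unfolding x by (simp add: quot_antipode_proj antipode_even p(6) flip: p(6))
  show "tensor_assoc (map_tensor \<Delta>' id (\<Delta>' x)) = map_tensor id \<Delta>' (\<Delta>' x)"
    by (simp add: x quot_comult_proj map_quot_comult lin coassoc)
      (simp add: map_tensor_compose lin quot_comult_proj)
  show "tlift (\<lambda>a b. \<epsilon>' a *\<^sub>q b) (\<Delta>' x) = x"
    using linear_tlift[OF proj_linear bil(1), of "\<Delta> u", symmetric]
    by (simp add: x quot_comult_proj tlift_map_tensor quot_counit_scale_bilinear lin
        quot_counit_proj counit_left p)
  show "tlift (\<lambda>a b. \<epsilon>' b *\<^sub>q a) (\<Delta>' x) = x"
    using linear_tlift[OF proj_linear bil(2), of "\<Delta> u", symmetric]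
    by (simp add: x quot_comult_proj tlift_map_tensor quot_counit_scale_bilinear lin
        quot_counit_proj counit_right p)
  have "bilinear_q (\<lambda>a b. S' a * b)" "bilinear_q (\<lambda>a b. a * S' b)"
    by (rule bilinear_compose[OF mult_bilinear] lin)+
  then show "tlift (\<lambda>a b. S' a * b) (\<Delta>' x) = \<epsilon>' x *\<^sub>q 1"
    "tlift (\<lambda>a b. a * S' b) (\<Delta>' x) = \<epsilon>' x *\<^sub>q 1"
    using linear_tlift[OF proj_linear bil(3), of "\<Delta> u", symmetric] linear_tlift[OF proj_linear bil(4), of "\<Delta> u", symmetric]
    by (simp_all add: x quot_comult_proj tlift_map_tensor lin quot_counit_proj quot_antipode_proj
        antipode_left antipode_right p)
qed

text \<open>This gives the descent to P/(\<xi>): the comodule stays the same and only the left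
  tensor factor is projected.\<close>

theorem quot_left_coaction:
  fixes \<delta> :: "'v::cq_superalgebra \<Rightarrow> ('h, 'v) tensor"
  assumes "left_coaction \<Delta> \<epsilon> S \<delta>"
  shows "left_coaction \<Delta>' \<epsilon>' S' (\<lambda>v. map_tensor \<pi> id (\<delta> v))"
proof -
  interpret c: left_coaction \<Delta> \<epsilon> S \<delta> by (rule assms)
  interpret q: hopf_superalgebra \<Delta>' \<epsilon>' S' by (rule quot_hopf_superalgebra)
  note c_lin = superalg_hom_linear[OF c.coaction_hom]
  note lin = proj_linear cq_linear_id map_tensor_linear cq_linear_compose[OF map_tensor_linear c_lin]
    c_lin
  show ?thesis
  proof (rule left_coaction.intro[OF quot_hopf_superalgebra left_coaction_axioms.intro])
    show "superalg_hom (\<lambda>v. map_tensor \<pi> id (\<delta> v))"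
      by (rule superalg_hom_compose[OF map_tensor_superalg_hom[OF proj_hom superalg_hom_id]
            c.coaction_hom])
    fix v
    show "tensor_assoc (map_tensor \<Delta>' id (map_tensor \<pi> id (\<delta> v)))
        = map_tensor id (\<lambda>v. map_tensor \<pi> id (\<delta> v)) (map_tensor \<pi> id (\<delta> v))"
      by (simp add: map_quot_comult lin c.coaction_coassoc)
        (simp add: map_tensor_compose lin)
    show "tlift (\<lambda>a w. \<epsilon>' a *\<^sub>q w) (map_tensor \<pi> id (\<delta> v)) = v"
    proof -
      have "bilinear_q (\<lambda>a w. \<epsilon>' a *\<^sub>q (w :: 'v))"
        using q.counit_add q.counit_scaleq
        by (simp add: bilinear_q_def cq_linear_iff cq.scale_right_distrib
            cq.scale_left_distrib scaleq_scaleq mult.commute)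
      then show ?thesis
        by (simp add: tlift_map_tensor lin quot_counit_proj c.coaction_counit)
    qed
  qed
qed

end

section \<open>Generators and relations\<close>

lemma free_gl_induct:
  assumes B: "subalgebra B" and letters: "\<And>l. letter_gl l \<in> B"
  shows "x \<in> B"
proof (cases x)
  case (Abs_free_gl p)
  have word: "Abs_free_gl (Poly_Mapping.single (FWord w) c) \<in> B" for w c
  proof (induction w arbitrary: c)
    case Nil
    have "Abs_free_gl (Poly_Mapping.single (FWord []) c) = c *\<^sub>q 1"
      by (simp add: scaleq_free_gl_def one_free_gl_def Abs_free_gl_inverse word_scale_def
          zero_fword_def)
    then show ?case using B by (simp add: subalgebra_def)
  next
    case (Cons l w)
    have "Abs_free_gl (Poly_Mapping.single (FWord (l # w)) c)
        = letter_gl l * Abs_free_gl (Poly_Mapping.single (FWord w) c)"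
      by (simp add: letter_gl_def times_free_gl_def Abs_free_gl_inverse mult_single plus_fword_def)
    then show ?case using B letters Cons by (simp add: subalgebra_def)
  qed
  have "Abs_free_gl p \<in> B"
  proof (induction p rule: poly_mapping_induct_single)
    case (single k c)
    then show ?case using word[of "letters k" c] by simp
  next
    case (add x y)
    moreover have "Abs_free_gl (x + y) = Abs_free_gl x + Abs_free_gl y"
      by (simp add: plus_free_gl_def Abs_free_gl_inverse)
    ultimately show ?case using B by (simp add: subalgebra_def)
  qed
  then show ?thesis by (simp add: Abs_free_gl)
qed

lemma subalgebra_vimage:
  assumes "superalg_hom f" "subalgebra B" shows "subalgebra (f -` B)"
  using assms(2) by (simp add: subalgebra_def superalg_homD[OF assms(1)])

lemma subalgebra_equalizer:
  assumes "superalg_hom f" "superalg_hom g" shows "subalgebra {x. f x = g x}"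
  by (simp add: subalgebra_def superalg_homD[OF assms(1)] superalg_homD[OF assms(2)])

definition free_eval :: "(letter \<Rightarrow> 'a::cq_superalgebra) \<Rightarrow> free_gl \<Rightarrow> 'a" where
  "free_eval e x = free_lift (\<lambda>w. prod_list (map e (letters w))) (Rep_free_gl x)"

lemma free_eval_letter: "free_eval e (letter_gl l) = e l"
  by (simp add: free_eval_def letter_gl_def Abs_free_gl_inverse scaleq_one)

lemma free_eval_hom:
  assumes e: "\<And>l. hpar (lpar l) (e l)"
  shows "superalg_hom (free_eval e)"
proof -
  let ?f = "\<lambda>w. prod_list (map e (letters w))"
  have f0: "?f 0 = 1" and f_add: "?f (u + v) = ?f u * ?f v" for u v
    by (simp_all add: zero_fword_def plus_fword_def)
  have par: "hpar (wpar w) (?f w)" for w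
  proof -
    have "hpar (sum_list (map lpar ls)) (prod_list (map e ls))" for ls
      by (induction ls) (simp_all add: hpar_one hpar_mult e)
    then show ?thesis by (simp add: wpar_def)
  qed
  have mult: "free_lift ?f (x * y) = free_lift ?f x * free_lift ?f y" for x y
  proof (induction x rule: poly_mapping_induct_single)
    case (single u c)
    show ?case
    proof (induction y rule: poly_mapping_induct_single)
      case (single v d)
      show ?case
        by (simp add: mult_single f_add scaleq_mult_left scaleq_mult_right scaleq_scaleq mult.commute)
    qed (simp add: distrib_left free_lift_add)
  qed (simp add: distrib_right free_lift_add)
  have even: "free_lift ?f (word_evenp x) = evenp (free_lift ?f x)" for x
  proof (induction x rule: poly_mapping_induct_single)
    case (single k c)
    then show ?case
      using par[of k] by (auto simp: word_evenp_single evenp_scaleq hpar_def)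
  qed (simp add: word_evenp_add free_lift_add evenp_add)
  have one: "free_lift ?f 1 = 1"
    using free_lift_single[of ?f 0 1] by (simp add: f0 scaleq_one)
  show ?thesis
    unfolding superalg_hom_def cq_linear_iff free_eval_def
    by (auto simp: plus_free_gl.rep_eq scaleq_free_gl.rep_eq one_free_gl.rep_eq
        times_free_gl.rep_eq evenp_free_gl.rep_eq free_lift_add mult even word_scale_def
        scaleq_mult_left f0 one)
qed

text \<open>Formulated for any surjection with the right kernel, so that it applies both to the
  passage from the free algebra to GL and to that from GL to P.\<close>

lemma quotient_hom_exists:
  assumes \<pi>: "superalg_hom \<pi>" "surj \<pi>" "\<And>x. \<pi> x = 0 \<Longrightarrow> x \<in> ideal_gen R"
    and f: "superalg_hom f" "\<And>r. r \<in> R \<Longrightarrow> f r = 0"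
  obtains f' where "superalg_hom f'" "\<And>x. f' (\<pi> x) = f x"
proof -
  note p = superalg_homD[OF \<pi>(1)] and fD = superalg_homD[OF f(1)]
  define f' where "f' y = f (inv \<pi> y)" for y
  have proj: "f' (\<pi> x) = f x" for x
  proof -
    have "\<pi> (inv \<pi> (\<pi> x) - x) = 0" by (simp add: p surj_f_inv_f[OF \<pi>(2)])
    moreover have "ideal_gen R \<subseteq> {x. f x = 0}"
      by (rule ideal_gen_min[OF _ superalg_hom_kernel_ideal[OF f(1)]]) (auto simp: f(2))
    ultimately have "f (inv \<pi> (\<pi> x) - x) = 0" using \<pi>(3) by blast
    then show ?thesis by (simp add: f'_def fD)
  qed
  have cases: "\<exists>x. y = \<pi> x" for y using \<pi>(2) by (metis surjD)
  have "f' (x + y) = f' x + f' y" "f' (c *\<^sub>q x) = c *\<^sub>q f' x" "f' (x * y) = f' x * f' y"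
    "f' (evenp x) = evenp (f' x)" for x y c
    using cases[of x] cases[of y] by (auto simp: proj fD simp flip: p)
  moreover have "f' 1 = 1" using proj[of 1] by (simp add: p fD)
  ultimately have "superalg_hom f'" by (simp add: superalg_hom_def cq_linear_iff)
  then show ?thesis using proj by (rule that)
qed

lemma abs_O_GL_surj: "surj abs_O_GL"
  by (metis Quotient3_O_GL Quotient3_def surjI)

lemma abs_O_GL_kernel: "abs_O_GL x = 0 \<Longrightarrow> x \<in> ideal_gen rel_GL"
  by (simp add: zero_O_GL_def O_GL.abs_eq_iff)

lemma prP_surj: "surj prP"
  unfolding prP_def by (metis Quotient3_O_P Quotient3_def surjI)

lemma prP_kernel: "prP x = 0 \<Longrightarrow> x \<in> ideal_gen rel_P"
  by (simp add: prP_def zero_O_P_def O_P.abs_eq_iff)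

lemma hom_prSP: "superalg_hom prSP"
  by (simp add: prSP_def superalg_hom_def cq_linear_iff plus_O_SP.abs_eq scaleq_O_SP.abs_eq
      one_O_SP.abs_eq times_O_SP.abs_eq evenp_O_SP.abs_eq)

lemma prSP_surj: "surj prSP"
  unfolding prSP_def by (metis Quotient3_O_SP Quotient3_def surjI)

lemma prSP_kernel: "prSP x = 0 \<longleftrightarrow> x \<in> ideal_gen rel_SP"
  by (simp add: prSP_def zero_O_SP_def O_SP.abs_eq_iff)

section \<open>Presentation of P by generators and relations\<close>

definition free_to_P :: "free_gl \<Rightarrow> O_P" where
  "free_to_P x = prP (abs_O_GL x)"

lemma hom_free_to_P: "superalg_hom free_to_P"
  unfolding free_to_P_def by (rule superalg_hom_compose[OF hom_prP hom_O_GL])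

lemma free_to_P_gen: "free_to_P (gen_gl i j) = gP i j"
  by (simp add: free_to_P_def gP_def gGL_def)

lemma free_to_P_rel: "r \<in> rel_GL \<Longrightarrow> free_to_P r = 0"
  by (simp add: free_to_P_def rel_GL_zero superalg_homD[OF hom_prP])

lemma free_to_P_surj: "surj free_to_P"
  unfolding free_to_P_def using comp_surj[OF abs_O_GL_surj prP_surj] by (simp add: comp_def)

definition invD1 :: O_P where "invD1 = free_to_P (letter_gl D1inv)"
definition invD2 :: O_P where "invD2 = free_to_P (letter_gl D2inv)"

lemma O_P_induct:
  assumes B: "subalgebra B" and gens: "\<And>i j. gP i j \<in> B" "invD1 \<in> B" "invD2 \<in> B"
  shows "x \<in> B"
proof -
  obtain y where x: "x = free_to_P y" using free_to_P_surj by (metis surjD)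
  have "y \<in> free_to_P -` B"
  proof (rule free_gl_induct[OF subalgebra_vimage[OF hom_free_to_P B]])
    show "letter_gl l \<in> free_to_P -` B" for l
      using gens by (cases l) (simp_all add: invD1_def invD2_def flip: gen_gl_def free_to_P_gen)
  qed
  then show ?thesis by (simp add: x)
qed

lemma qdet4_free_to_P: "free_to_P (qdet4 gen_gl) = DP I1 I2 * D34P"
  by (simp add: superalg_hom_qdet4[OF hom_free_to_P] free_to_P_gen qdet4_gP)

lemma invD1_inverse: "DP I1 I2 * D34P * invD1 = 1" "invD1 * (DP I1 I2 * D34P) = 1"
  using free_to_P_rel[of "qdet4 gen_gl * letter_gl D1inv - 1"]
    free_to_P_rel[of "letter_gl D1inv * qdet4 gen_gl - 1"]
  by (simp_all add: rel_GL_def rel_inv_def superalg_homD[OF hom_free_to_P] qdet4_free_to_P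
      flip: invD1_def)

lemma invD2_inverse: "gP I5 I5 * invD2 = 1" "invD2 * gP I5 I5 = 1"
  using free_to_P_rel[of "gen_gl I5 I5 * letter_gl D2inv - 1"]
    free_to_P_rel[of "letter_gl D2inv * gen_gl I5 I5 - 1"]
  by (simp_all add: rel_GL_def rel_inv_def superalg_homD[OF hom_free_to_P] free_to_P_gen
      flip: invD2_def)

lemma rinv_d: "rinv (gP I5 I5) = invD2"
  by (rule rinv_eq[OF invD2_inverse])

lemma gP_row:
  assumes "j < l"
  shows "gP i j * gP i l
    = ((- 1) ^ (gpar i j * gpar i l) * qpow ((- 1) ^ (par i + 1))) *\<^sub>q (gP i l * gP i j)"
proof -
  let ?r = "gen_gl i j * gen_gl i l
    - ((- 1) ^ (gpar i j * gpar i l) * qpow ((- 1) ^ (par i + 1))) *\<^sub>q (gen_gl i l * gen_gl i j)"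
  have "?r \<in> rel_GL" using assms unfolding rel_GL_def rel_M_def by blast
  from free_to_P_rel[OF this] show ?thesis
    by (simp add: superalg_homD[OF hom_free_to_P] free_to_P_gen)
qed

lemma gP_col:
  assumes "i < k"
  shows "gP i j * gP k j
    = ((- 1) ^ (gpar i j * gpar k j) * qpow ((- 1) ^ (par j + 1))) *\<^sub>q (gP k j * gP i j)"
proof -
  let ?r = "gen_gl i j * gen_gl k j
    - ((- 1) ^ (gpar i j * gpar k j) * qpow ((- 1) ^ (par j + 1))) *\<^sub>q (gen_gl k j * gen_gl i j)"
  have "?r \<in> rel_GL" using assms unfolding rel_GL_def rel_M_def by blast
  from free_to_P_rel[OF this] show ?thesis
    by (simp add: superalg_homD[OF hom_free_to_P] free_to_P_gen)
qed

lemma gP_anti: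
  assumes "i < k \<and> j > l \<or> i > k \<and> j < l"
  shows "gP i j * gP k l = (- 1) ^ (gpar i j * gpar k l) *\<^sub>q (gP k l * gP i j)"
proof -
  let ?r = "gen_gl i j * gen_gl k l - (- 1) ^ (gpar i j * gpar k l) *\<^sub>q (gen_gl k l * gen_gl i j)"
  have "?r \<in> rel_GL" using assms unfolding rel_GL_def rel_M_def by blast
  from free_to_P_rel[OF this] show ?thesis
    by (simp add: superalg_homD[OF hom_free_to_P] free_to_P_gen)
qed

lemma gP_diag:
  assumes "i < k" "j < l"
  shows "gP i j * gP k l = (- 1) ^ (gpar i j * gpar k l) *\<^sub>q (gP k l * gP i j)
    + ((- 1) ^ (gpar i j * gpar k j) * (qpow (- 1) - qpow 1)) *\<^sub>q (gP k j * gP i l)"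
proof -
  let ?r = "gen_gl i j * gen_gl k l - (- 1) ^ (gpar i j * gpar k l) *\<^sub>q (gen_gl k l * gen_gl i j)
    - ((- 1) ^ (gpar i j * gpar k j) * (qpow (- 1) - qpow 1)) *\<^sub>q (gen_gl k j * gen_gl i l)"
  have "?r \<in> rel_GL" using assms unfolding rel_GL_def rel_M_def by blast
  from free_to_P_rel[OF this] show ?thesis
    by (simp add: superalg_homD[OF hom_free_to_P] free_to_P_gen algebra_simps)
qed

lemma gP_odd_square: "odd (gpar i j) \<Longrightarrow> gP i j * gP i j = 0"
  using free_to_P_rel[of "gen_gl i j * gen_gl i j"]
  by (auto simp: rel_GL_def rel_M_def superalg_homD[OF hom_free_to_P] free_to_P_gen)

section \<open>The projection onto the Levi factor\<close>

text \<open>Encodes the block partition {1,2}, {3,4,5} of the parabolic; the odd index 5 shares a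
  block with 3 and 4.\<close>

definition upper :: "idx \<Rightarrow> bool" where
  "upper i \<longleftrightarrow> i \<in> {I1, I2}"

lemma upper_simps [simp]: "upper I1" "upper I2" "\<not> upper I3" "\<not> upper I4" "\<not> upper I5"
  by (simp_all add: upper_def)

lemma upper_antimono: "i < k \<Longrightarrow> upper k \<Longrightarrow> upper i"
  by (cases i; cases k) (simp_all add: less_idx_def)

lemma gP_upper_zero: "upper i \<Longrightarrow> \<not> upper j \<Longrightarrow> gP i j = 0"
  by (rule gP_zero; cases i; cases j; simp)

text \<open>Only the lower left block is really deleted, since the upper right block is already zero
  in P.\<close>

definition levi_gen :: "idx \<Rightarrow> idx \<Rightarrow> O_P" where
  "levi_gen i j = (if upper i = upper j then gP i j else 0)"

text \<open>A permutation that contributes on either side preserves {1,2} and then only involves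
  entries of the diagonal blocks. Hence the inverse of D_1 may be sent to itself.\<close>

lemma qdet4_levi: "qdet4 levi_gen = qdet4 gP"
  unfolding qdet4_def
proof (rule sum.cong[OF refl])
  fix \<sigma> assume "\<sigma> \<in> {\<sigma>. \<sigma> permutes {I1, I2, I3, I4}}"
  then have \<sigma>: "\<sigma> permutes {I1, I2, I3, I4}" by simp
  let ?t = "\<lambda>g :: idx \<Rightarrow> idx \<Rightarrow> O_P. g I1 (\<sigma> I1) * g I2 (\<sigma> I2) * g I3 (\<sigma> I3) * g I4 (\<sigma> I4)"
  have "?t levi_gen = ?t gP"
  proof (cases "upper (\<sigma> I1) \<and> upper (\<sigma> I2)")
    case True
    then obtain a b where "\<sigma> = block_perm a b"
      using block_perm_char[OF \<sigma>] by (auto simp: upper_def)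
    then show ?thesis by (simp add: levi_gen_def)
  next
    case False
    then have "gP I1 (\<sigma> I1) = 0 \<or> gP I2 (\<sigma> I2) = 0" "levi_gen I1 (\<sigma> I1) = 0 \<or> levi_gen I2 (\<sigma> I2) = 0"
      by (auto simp: gP_upper_zero levi_gen_def)
    then show ?thesis by auto
  qed
  then show "(- qpow (- 1)) ^ perm_length \<sigma> *\<^sub>q ?t levi_gen = (- qpow (- 1)) ^ perm_length \<sigma> *\<^sub>q ?t gP"
    by simp
qed

lemma levi_hom:
  obtains \<phi> where "superalg_hom \<phi>" "\<And>i j. \<phi> (gP i j) = levi_gen i j"
proof -
  define e where "e l = (case l of G i j \<Rightarrow> levi_gen i j | D1inv \<Rightarrow> invD1 | D2inv \<Rightarrow> invD2)" for l
  have inv_par: "hpar 0 invD1" "hpar 0 invD2"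
    unfolding invD1_def invD2_def
    by (rule superalg_hom_hpar[OF hom_free_to_P]; simp add: hpar_def evenp_letter)+
  have "hpar (lpar l) (e l)" for l
    using inv_par by (cases l) (simp_all add: e_def levi_gen_def hpar_gP, simp add: hpar_def)
  then have f: "superalg_hom (free_eval e)" by (rule free_eval_hom)
  have gen: "free_eval e (gen_gl i j) = levi_gen i j" for i j
    by (simp add: gen_gl_def free_eval_letter e_def)
  have inv: "free_eval e r = 0" if "r \<in> rel_inv" for r
    using that unfolding rel_inv_def
    by (auto simp: superalg_homD[OF f] superalg_hom_qdet4[OF f] gen qdet4_levi qdet4_gP
        free_eval_letter e_def invD1_inverse)
       (simp_all add: levi_gen_def invD2_inverse)
  have M: "free_eval e r = 0" if "r \<in> rel_M" for r
    using that unfolding rel_M_def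
    apply (elim UnE CollectE exE conjE)
    subgoal for i j l
      using gP_row[of j l i] by (auto simp: superalg_homD[OF f] gen levi_gen_def)
    subgoal for i j k
      using gP_col[of i k j] by (auto simp: superalg_homD[OF f] gen levi_gen_def)
    subgoal for i j k l
      using gP_anti[of i k l j] by (auto simp: superalg_homD[OF f] gen levi_gen_def)
    \<comment> \<open>The one relation with a correction term g_kj g_il. If g_ij or g_kl lies off
      the diagonal blocks, so does a factor of the correction; if they lie in different diagonal
      blocks, the correction vanishes already in P because g_il = 0.\<close>
    subgoal for i j k l
      using gP_diag[of i k j l] upper_antimono[of i k] upper_antimono[of j l]
        gP_upper_zero[of i l]
      by (auto simp: superalg_homD[OF f] gen levi_gen_def)
    subgoal for i j
      using gP_odd_square[of i j] by (auto simp: superalg_homD[OF f] gen levi_gen_def)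
    done
  obtain f1 where f1: "superalg_hom f1" "\<And>x. f1 (abs_O_GL x) = free_eval e x"
    using quotient_hom_exists[OF hom_O_GL abs_O_GL_surj abs_O_GL_kernel f] inv M
    unfolding rel_GL_def by blast
  have "f1 r = 0" if "r \<in> rel_P" for r
    using that by (auto simp: rel_P_def gGL_def f1 gen levi_gen_def)
  then obtain \<phi> where \<phi>: "superalg_hom \<phi>" "\<And>x. \<phi> (prP x) = f1 x"
    using quotient_hom_exists[OF hom_prP prP_surj prP_kernel f1(1)] by blast
  show ?thesis
    by (rule that[OF \<phi>(1)]) (simp add: gP_def \<phi>(2) gGL_def f1(2) gen)
qed

section \<open>Quantum \<open>2 \<times> 2\<close> matrices\<close>

lemma qpow_mult: "qpow m * qpow n = qpow (m + n)"
  by (simp add: qpow_def mult_single)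

lemma qpow_0: "qpow 0 = 1"
  by (simp add: qpow_def)

lemmas scale_simps = scaleq_mult_left scaleq_mult_right scaleq_scaleq scaleq_one qpow_mult qpow_0
  cq.scale_right_distrib cq.scale_right_diff_distrib cq.scale_left_diff_distrib
  distrib_left distrib_right left_diff_distrib right_diff_distrib mult.assoc

lemma mult_assoc_rule: "a * b = c \<Longrightarrow> a * (b * z) = c * z" for a :: "'a::monoid_mult"
  by (simp flip: mult.assoc)

locale qmatrix2 =
  fixes a b c d :: "'a::cq_superalgebra"
  assumes ab: "a * b = qpow (- 1) *\<^sub>q (b * a)"
    and ac: "a * c = qpow (- 1) *\<^sub>q (c * a)"
    and bc: "b * c = c * b"
    and bd: "b * d = qpow (- 1) *\<^sub>q (d * b)"
    and cd: "c * d = qpow (- 1) *\<^sub>q (d * c)"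
    and ad: "a * d = d * a + (qpow (- 1) - qpow 1) *\<^sub>q (c * b)"
begin

lemmas rules = ab ac bc bd cd ad
lemmas rules' = rules rules[THEN mult_assoc_rule]

definition D where "D = a * d - qpow (- 1) *\<^sub>q (b * c)"

lemma D_central: "D * a = a * D" "D * b = b * D" "D * c = c * D" "D * d = d * D"
  by (simp_all add: D_def rules' scale_simps)

lemma inverse_central:
  assumes "D * E = 1" "E * D = 1" "D * z = z * D"
  shows "E * z = z * E"
proof -
  have "E * z = E * (z * D) * E" using assms(1) by (simp add: mult.assoc)
  also have "\<dots> = z * E" using assms(2) by (simp flip: assms(3) mult.assoc)
  finally show ?thesis .
qed

lemma inverse_left:
  assumes E: "D * E = 1" "E * D = 1"
  shows "(d * E) * a - (qpow 1 *\<^sub>q (b * E)) * c = 1" "(d * E) * b - (qpow 1 *\<^sub>q (b * E)) * d = 0"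
    "(a * E) * c - (qpow (- 1) *\<^sub>q (c * E)) * a = 0" "(a * E) * d - (qpow (- 1) *\<^sub>q (c * E)) * b = 1"
proof -
  note comm = D_central[THEN inverse_central[OF E]]
  have "d * a - qpow 1 *\<^sub>q (b * c) = D" "d * b - qpow 1 *\<^sub>q (b * d) = 0"
    "a * c - qpow (- 1) *\<^sub>q (c * a) = 0" "a * d - qpow (- 1) *\<^sub>q (c * b) = D"
    by (simp_all add: D_def rules' scale_simps)
  from this[THEN arg_cong[where f = "\<lambda>x. x * E"]]
  show "(d * E) * a - (qpow 1 *\<^sub>q (b * E)) * c = 1" "(d * E) * b - (qpow 1 *\<^sub>q (b * E)) * d = 0"
    "(a * E) * c - (qpow (- 1) *\<^sub>q (c * E)) * a = 0" "(a * E) * d - (qpow (- 1) *\<^sub>q (c * E)) * b = 1"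
    by (simp_all add: left_diff_distrib scaleq_mult_left mult.assoc comm E)
qed

lemma inverse_right:
  assumes E: "D * E = 1"
  shows "a * (d * E) - b * (qpow (- 1) *\<^sub>q (c * E)) = 1" "b * (a * E) - a * (qpow 1 *\<^sub>q (b * E)) = 0"
    "c * (d * E) - d * (qpow (- 1) *\<^sub>q (c * E)) = 0" "d * (a * E) - c * (qpow 1 *\<^sub>q (b * E)) = 1"
proof -
  have "a * d - qpow (- 1) *\<^sub>q (b * c) = D" "b * a - qpow 1 *\<^sub>q (a * b) = 0"
    "c * d - qpow (- 1) *\<^sub>q (d * c) = 0" "d * a - qpow 1 *\<^sub>q (c * b) = D"
    by (simp_all add: D_def rules' scale_simps)
  from this[THEN arg_cong[where f = "\<lambda>x. x * E"]]
  show "a * (d * E) - b * (qpow (- 1) *\<^sub>q (c * E)) = 1" "b * (a * E) - a * (qpow 1 *\<^sub>q (b * E)) = 0"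
    "c * (d * E) - d * (qpow (- 1) *\<^sub>q (c * E)) = 0" "d * (a * E) - c * (qpow 1 *\<^sub>q (b * E)) = 1"
    by (simp_all add: left_diff_distrib scaleq_mult_left scaleq_mult_right mult.assoc E)
qed

end

text \<open>The quantum adjugate times an inverse \<open>E\<close> of the quantum determinant. The
  factors q and q^{-1} off the diagonal make it a two-sided inverse.\<close>

definition qinv2 :: "idx \<Rightarrow> idx \<Rightarrow> (idx \<Rightarrow> idx \<Rightarrow> 'a::cq_superalgebra) \<Rightarrow> 'a \<Rightarrow> idx \<Rightarrow> idx \<Rightarrow> 'a" where
  "qinv2 p r m E i j =
     (if i = p then if j = p then m r r * E else - (qpow 1 *\<^sub>q (m p r * E))
      else if j = p then - (qpow (- 1) *\<^sub>q (m r p * E)) else m p p * E)"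

lemma qinv2_inverse:
  fixes m :: "idx \<Rightarrow> idx \<Rightarrow> 'a::cq_superalgebra"
  assumes q: "qmatrix2 (m p p) (m p r) (m r p) (m r r)" and "p \<noteq> r"
    and E: "(m p p * m r r - qpow (- 1) *\<^sub>q (m p r * m r p)) * E = 1"
      "E * (m p p * m r r - qpow (- 1) *\<^sub>q (m p r * m r p)) = 1"
    and "i \<in> {p, r}" "k \<in> {p, r}"
  shows "(\<Sum>j\<in>{p, r}. m i j * qinv2 p r m E j k) = (if i = k then 1 else 0)"
    "(\<Sum>j\<in>{p, r}. qinv2 p r m E i j * m j k) = (if i = k then 1 else 0)"
proof -
  interpret qmatrix2 "m p p" "m p r" "m r p" "m r r" by (rule q)
  note E' = E[folded D_def]
  show "(\<Sum>j\<in>{p, r}. m i j * qinv2 p r m E j k) = (if i = k then 1 else 0)"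
    using assms(2,5,6) inverse_right[OF E'(1)] by (auto simp: qinv2_def)
  show "(\<Sum>j\<in>{p, r}. qinv2 p r m E i j * m j k) = (if i = k then 1 else 0)"
    using assms(2,5,6) inverse_left[OF E'] by (auto simp: qinv2_def)
qed

lemma qmatrix2_block:
  "qmatrix2 (gP I1 I1) (gP I1 I2) (gP I2 I1) (gP I2 I2)"
  "qmatrix2 (gP I3 I3) (gP I3 I4) (gP I4 I3) (gP I4 I4)"
proof -
  have less: "I1 < I2" "I3 < I4" by (simp_all add: less_idx_def)
  show "qmatrix2 (gP I1 I1) (gP I1 I2) (gP I2 I1) (gP I2 I2)"
    "qmatrix2 (gP I3 I3) (gP I3 I4) (gP I4 I3) (gP I4 I4)"
    using less gP_row gP_col gP_anti[of I1 I2 I1 I2] gP_anti[of I3 I4 I3 I4]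
      gP_diag[of I1 I2 I1 I2] gP_diag[of I3 I4 I3 I4]
    by (unfold_locales; simp add: gpar_def par_def scaleq_one)+
qed

text \<open>The determinant D_1 factors in P into the commuting minors of x and y; each minor is
  inverted by the other one times \<open>invD1\<close>.\<close>

definition invD12 :: O_P where "invD12 = D34P * invD1"
definition invD34 :: O_P where "invD34 = DP I1 I2 * invD1"

lemma invD1_commute: "z * (DP I1 I2 * D34P) = (DP I1 I2 * D34P) * z \<Longrightarrow> invD1 * z = z * invD1"
  by (metis invD1_inverse mult.assoc mult_1_left mult_1_right)

lemma invD12_inverse: "DP I1 I2 * invD12 = 1" "invD12 * DP I1 I2 = 1"
  and invD34_inverse: "D34P * invD34 = 1" "invD34 * D34P = 1"
proof -
  have 1: "invD1 * D34P = D34P * invD1" "invD1 * DP I1 I2 = DP I1 I2 * invD1"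
    by (rule invD1_commute; metis D12_D34_commute mult.assoc)+
  have 2: "D34P * DP I1 I2 = DP I1 I2 * D34P" by (rule D12_D34_commute[symmetric])
  show "DP I1 I2 * invD12 = 1"
    unfolding invD12_def mult.assoc[symmetric] by (rule invD1_inverse(1))
  show "D34P * invD34 = 1"
    unfolding invD34_def mult.assoc[symmetric] 2 by (rule invD1_inverse(1))
  show "invD12 * DP I1 I2 = 1"
    unfolding invD12_def 1(1)[symmetric] mult.assoc 2 by (rule invD1_inverse(2))
  show "invD34 * D34P = 1"
    unfolding invD34_def 1(2)[symmetric] mult.assoc by (rule invD1_inverse(2))
qed

lemma rinv_D12: "rinv (DP I1 I2) = invD12"
  by (rule rinv_eq[OF invD12_inverse])

definition xinv :: "idx \<Rightarrow> idx \<Rightarrow> O_P" where "xinv = qinv2 I1 I2 gP invD12"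
definition yinv :: "idx \<Rightarrow> idx \<Rightarrow> O_P" where "yinv = qinv2 I3 I4 gP invD34"

lemma xinv_inverse:
  assumes "i \<in> {I1, I2}" "k \<in> {I1, I2}"
  shows "(\<Sum>j\<in>{I1, I2}. gP i j * xinv j k) = (if i = k then 1 else 0)"
    "(\<Sum>j\<in>{I1, I2}. xinv i j * gP j k) = (if i = k then 1 else 0)"
  unfolding xinv_def
  by (rule qinv2_inverse[OF qmatrix2_block(1)]; simp add: invD12_inverse assms[simplified] flip: DP_def)+

lemma yinv_inverse:
  assumes "i \<in> {I3, I4}" "k \<in> {I3, I4}"
  shows "(\<Sum>j\<in>{I3, I4}. gP i j * yinv j k) = (if i = k then 1 else 0)"
    "(\<Sum>j\<in>{I3, I4}. yinv i j * gP j k) = (if i = k then 1 else 0)"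
  unfolding yinv_def
  by (rule qinv2_inverse[OF qmatrix2_block(2)]; simp add: invD34_inverse assms[simplified] flip: D34P_def)+

section \<open>Commutation with the lower left block\<close>

lemma gP_upper_lower:
  assumes "\<not> upper i" "a \<in> {I1, I2}"
  shows "gP a I2 * gP i I1 = gP i I1 * gP a I2"
    "gP a I1 * gP i I1 = qpow (- 1) *\<^sub>q (gP i I1 * gP a I1)"
    "gP a I2 * gP i I2 = qpow (- 1) *\<^sub>q (gP i I2 * gP a I2)"
    "gP a I1 * gP i I2 = gP i I2 * gP a I1 + (qpow (- 1) - qpow 1) *\<^sub>q (gP i I1 * gP a I2)"
proof -
  have "a < i" "I1 < I2" using assms by (cases i; auto simp: less_idx_def)+
  then show "gP a I2 * gP i I1 = gP i I1 * gP a I2"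
    "gP a I1 * gP i I1 = qpow (- 1) *\<^sub>q (gP i I1 * gP a I1)"
    "gP a I2 * gP i I2 = qpow (- 1) *\<^sub>q (gP i I2 * gP a I2)"
    "gP a I1 * gP i I2 = gP i I2 * gP a I1 + (qpow (- 1) - qpow 1) *\<^sub>q (gP i I1 * gP a I2)"
    using gP_anti[of a i I1 I2] gP_col[of a i I1] gP_col[of a i I2] gP_diag[of a i I1 I2] assms(2)
    by (auto simp: gpar_def par_def scaleq_one)
qed

text \<open>In the minors defining t, move the entry of row i to the left: the correction from the
  diagonal relation changes one coefficient to exactly that of the adjugate. So t is the lower left
  block times x^{-1}, and i = I5 covers ttau.\<close>

lemma tP_eq:
  assumes "\<not> upper i" "j \<in> {I1, I2}"
  shows "tP i j = (\<Sum>k\<in>{I1, I2}. gP i k * xinv k j)"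
  using assms(2) unfolding tP_def rinv_D12
  by (auto simp: DP_def xinv_def qinv2_def gP_upper_lower[OF assms(1)]
      scale_simps)

lemma gP_eq_tP:
  assumes "\<not> upper i" "j \<in> {I1, I2}"
  shows "gP i j = (\<Sum>k\<in>{I1, I2}. tP i k * gP k j)"
proof -
  have "(\<Sum>k\<in>{I1, I2}. tP i k * gP k j)
      = (\<Sum>l\<in>{I1, I2}. gP i l * (\<Sum>k\<in>{I1, I2}. xinv l k * gP k j))"
    by (simp add: tP_eq assms distrib_left distrib_right mult.assoc add_ac)
  also have "\<dots> = (\<Sum>l\<in>{I1, I2}. gP i l * (if l = j then 1 else 0))"
    by (intro sum.cong refl) (use xinv_inverse(2)[OF _ assms(2)] in simp)
  also have "\<dots> = gP i j" using assms(2) by auto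
  finally show ?thesis by simp
qed

text \<open>Combined with \<open>D34_lower\<close>, this makes D_1 commute with the lower left block
  up to powers of q, and therefore also its inverse.\<close>

lemma D12_lower:
  assumes "\<not> upper i" "j \<in> {I1, I2}"
  shows "DP I1 I2 * gP i j = qpow (- 1) *\<^sub>q (gP i j * DP I1 I2)"
  using assms(2) gP_upper_lower[OF assms(1)] gP_upper_lower[OF assms(1), THEN mult_assoc_rule]
  by (auto simp: DP_def scale_simps)

lemma gP_lower_lower:
  assumes "j \<in> {I1, I2}" "l \<in> {I3, I4}"
  shows "k \<in> {I3, I4} \<Longrightarrow> gP k l * gP I5 j = gP I5 j * gP k l"
    "gP I3 l * gP I4 j = gP I4 j * gP I3 l"
    "k \<in> {I3, I4} \<Longrightarrow> gP k l * gP k j = qpow 1 *\<^sub>q (gP k j * gP k l)"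
    "gP I4 l * gP I3 j = gP I3 j * gP I4 l - (qpow (- 1) - qpow 1) *\<^sub>q (gP I4 j * gP I3 l)"
proof -
  have less: "I3 < I4" "I3 < I5" "I4 < I5" "j < l"
    using assms by (auto simp: less_idx_def)
  have par: "gpar k l = 0" "gpar k j = 0" if "k \<in> {I3, I4}" for k
    using assms that by (auto simp: gpar_def par_def)
  show "gP k l * gP I5 j = gP I5 j * gP k l" if "k \<in> {I3, I4}"
    using gP_anti[of k I5 j l] less that par[OF that] by (auto simp: scaleq_one)
  show "gP I3 l * gP I4 j = gP I4 j * gP I3 l"
    using gP_anti[of I3 I4 j l] less par[of I3] par[of I4] by (auto simp: scaleq_one)
  show "gP k l * gP k j = qpow 1 *\<^sub>q (gP k j * gP k l)" if "k \<in> {I3, I4}"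
    using gP_row[of j l k] less that par[OF that] by (auto simp: scale_simps par_def)
  show "gP I4 l * gP I3 j = gP I3 j * gP I4 l - (qpow (- 1) - qpow 1) *\<^sub>q (gP I4 j * gP I3 l)"
    using gP_diag[of I3 I4 j l] less par[of I3] par[of I4] by (auto simp: scale_simps)
qed

lemma D34_lower:
  assumes "\<not> upper i" "j \<in> {I1, I2}"
  shows "D34P * gP i j = (if i = I5 then 1 else qpow 1) *\<^sub>q (gP i j * D34P)"
proof -
  note rules = gP_lower_lower[OF assms(2)] qmatrix2.ab[OF qmatrix2_block(2)]
  have "i \<in> {I3, I4, I5}" using assms(1) by (cases i) simp_all
  then show ?thesis
    by (auto simp: D34P_def scale_simps rules rules[THEN mult_assoc_rule])
qed

section \<open>The decomposition into big cell and Levi factor\<close>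

lemma span_linear_image:
  assumes "cq_linear f" "\<And>x. x \<in> A \<Longrightarrow> f x \<in> cq.span B" "x \<in> cq.span A"
  shows "f x \<in> cq.span B"
  using assms(3)
proof (induction rule: cq.span_induct_alt)
  case base
  then show ?case by (simp add: cq_linear_zero[OF assms(1)] cq.span_zero)
next
  case (step c x y)
  then show ?case
    by (simp add: cq_linear_add[OF assms(1)] cq_linear_scale[OF assms(1)] cq.span_add
        cq.span_scale assms(2))
qed

section \<open>Spans of products\<close>

definition set_mult :: "'a::cq_superalgebra set \<Rightarrow> 'a set \<Rightarrow> 'a set" where
  "set_mult A B = cq.span {a * b | a b. a \<in> A \<and> b \<in> B}"

lemma set_mult_base: "a \<in> A \<Longrightarrow> b \<in> B \<Longrightarrow> a * b \<in> set_mult A B"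
  unfolding set_mult_def by (rule cq.span_base) blast

lemma set_mult_linear:
  assumes "cq_linear f" "\<And>a b. a \<in> A \<Longrightarrow> b \<in> B \<Longrightarrow> f (a * b) \<in> set_mult A' B'" "x \<in> set_mult A B"
  shows "f x \<in> set_mult A' B'"
  unfolding set_mult_def
proof (rule span_linear_image[OF assms(1) _ assms(3)[unfolded set_mult_def]])
  show "f y \<in> cq.span {a * b |a b. a \<in> A' \<and> b \<in> B'}" if "y \<in> {a * b |a b. a \<in> A \<and> b \<in> B}" for y
    using that assms(2) unfolding set_mult_def by blast
qed

lemma set_mult_closed:
  "0 \<in> set_mult A B" "x \<in> set_mult A B \<Longrightarrow> y \<in> set_mult A B \<Longrightarrow> x + y \<in> set_mult A B"
  "x \<in> set_mult A B \<Longrightarrow> c *\<^sub>q x \<in> set_mult A B" "x \<in> set_mult A B \<Longrightarrow> y \<in> set_mult A B \<Longrightarrow> x - y \<in> set_mult A B"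
  unfolding set_mult_def by (rule cq.span_zero cq.span_add cq.span_scale cq.span_diff; assumption)+

lemma set_mult_sum: "(\<And>i. i \<in> I \<Longrightarrow> f i \<in> set_mult A B) \<Longrightarrow> sum f I \<in> set_mult A B"
  unfolding set_mult_def by (rule cq.span_sum)

lemma set_mult_right:
  assumes "subalgebra B" "x \<in> set_mult A B" "b \<in> B"
  shows "x * b \<in> set_mult A B"
proof (rule set_mult_linear[OF cq_linear_mult(2) _ assms(2)])
  show "a * c * b \<in> set_mult A B" if "a \<in> A" "c \<in> B" for a c
    unfolding mult.assoc using that assms(1,3) by (intro set_mult_base) (simp_all add: subalgebra_def)
qed

lemma set_mult_left:
  assumes "subalgebra A" "x \<in> set_mult A B" "a \<in> A"
  shows "a * x \<in> set_mult A B"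
proof (rule set_mult_linear[OF cq_linear_mult(1) _ assms(2)])
  show "a * (c * b) \<in> set_mult A B" if "c \<in> A" "b \<in> B" for c b
    unfolding mult.assoc[symmetric]
    using that assms(1,3) by (intro set_mult_base) (simp_all add: subalgebra_def)
qed

definition levi_gens :: "O_P set" where
  "levi_gens = {gP i j | i j. upper i = upper j} \<union> {invD1, invD2}"

abbreviation levi :: "O_P set" where
  "levi \<equiv> subalgebra_gen levi_gens"

abbreviation big_cell :: "O_P set" where
  "big_cell \<equiv> subalgebra_gen big_cell_gens"

text \<open>Reordering is carried out with the entries g, for which the relations are given, instead
  of t; the two differ by the matrix x, which lies in the Levi factor.\<close>

definition lower_gens :: "O_P set" where
  "lower_gens = {gP i j | i j. \<not> upper i \<and> upper j}"

lemma subalgebra_gen_induct: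
  assumes "subalgebra B" "S \<subseteq> B" "x \<in> subalgebra_gen S" shows "x \<in> B"
  using assms unfolding subalgebra_gen_def by (meson hull_minimal subsetD)

lemma scaleq_cancel:
  "b * c = 1 \<Longrightarrow> c *\<^sub>q x = y \<Longrightarrow> x = b *\<^sub>q y"
  by (auto simp: scaleq_scaleq scaleq_one)

lemma levi_gP: "upper i = upper j \<Longrightarrow> gP i j \<in> levi"
  by (rule subalgebra_gen_inc) (auto simp: levi_gens_def)

lemma levi_inv: "invD1 \<in> levi" "invD2 \<in> levi"
  by (rule subalgebra_gen_inc; simp add: levi_gens_def)+

lemmas subalgebra_gen_intros = subalgebra_gen_closed subalgebra_gen_uminus subalgebra_gen_diff

lemma levi_xinv: "xinv i j \<in> levi"
proof -
  have "invD12 \<in> levi"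
    unfolding invD12_def D34P_def by (intro subalgebra_gen_intros levi_gP levi_inv; simp)
  then show ?thesis
    unfolding xinv_def qinv2_def by (auto intro!: subalgebra_gen_intros levi_gP)
qed

lemma upper_less: "upper i \<Longrightarrow> \<not> upper k \<Longrightarrow> i < k"
  by (cases i; cases k) (simp_all add: less_idx_def)

lemma sign_square: "(- 1) ^ n * (- 1) ^ n = (1 :: Cq)"
  by (simp flip: power_add mult_2)

lemma sign_qpow_inverse: "((- 1) ^ n * qpow (- m)) * ((- 1) ^ n * qpow m) = 1"
proof -
  have "((- 1) ^ n * qpow (- m)) * ((- 1) ^ n * qpow m)
      = ((- 1) ^ n * (- 1) ^ n) * (qpow (- m) * qpow m)"
    by (simp only: mult_ac)
  then show ?thesis by (simp only: sign_square qpow_mult) (simp add: qpow_0)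
qed

text \<open>The relations are homogeneous in the lower left block: every correction term again has
  exactly one factor from it, and the other factors are in the Levi subalgebra. For
  \<open>invD1\<close> and \<open>invD2\<close> the relation of the element they invert is
  multiplied by the inverse on both sides.\<close>

lemma levi_gen_lower:
  assumes h: "h \<in> levi_gens" and "\<not> upper k" "upper l"
  shows "h * gP k l \<in> set_mult lower_gens levi"
proof -
  have base: "gP i j * h \<in> set_mult lower_gens levi" if "\<not> upper i" "upper j" "h \<in> levi" for i j h
    using that by (intro set_mult_base) (auto simp: lower_gens_def)
  note intros = set_mult_closed base levi_gP levi_inv subalgebra_gen_intros
  have l: "l \<in> {I1, I2}" using assms(3) by (auto simp: upper_def)
  consider i j where "h = gP i j" "upper i" "upper j" | i j where "h = gP i j" "\<not> upper i" "\<not> upper j"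
    | "h = invD1" | "h = invD2"
    using h unfolding levi_gens_def by auto
  then show ?thesis
  proof cases
    case (1 i j)
    then have "i < k" using assms by (simp add: upper_less)
    consider "j = l" | "j < l" | "l < j" by fastforce
    then show ?thesis
    proof cases
      case 1
      then show ?thesis using gP_col[OF \<open>i < k\<close>, of j] \<open>h = gP i j\<close> \<open>upper i\<close> \<open>upper j\<close> assms
        by (auto intro!: intros)
    next
      case 2
      show ?thesis using gP_diag[OF \<open>i < k\<close> 2] \<open>h = gP i j\<close> \<open>upper i\<close> \<open>upper j\<close> assms
        by (auto intro!: intros)
    next
      case 3
      then show ?thesis using gP_anti[of i k l j] \<open>i < k\<close> \<open>h = gP i j\<close> \<open>upper i\<close> \<open>upper j\<close> assms
        by (auto intro!: intros)
    qed
  next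
    case (2 i j)
    then have "l < j" using assms by (simp add: upper_less)
    consider "i = k" | "i < k" | "k < i" by fastforce
    then show ?thesis
    proof cases
      assume "i = k"
      let ?s = "(- 1) ^ (gpar k l * gpar k j)" and ?n = "(- 1) ^ (par k + 1)"
      have "gP k j * gP k l = (?s * qpow (- ?n)) *\<^sub>q (gP k l * gP k j)"
      proof (rule scaleq_cancel)
        show "(?s * qpow (- ?n)) * (?s * qpow ?n) = 1" by (rule sign_qpow_inverse)
      qed (rule gP_row[OF \<open>l < j\<close>, symmetric])
      then show ?thesis using \<open>i = k\<close> 2 assms by (auto intro!: intros)
    next
      assume "i < k"
      then show ?thesis using gP_anti[of i k l j] \<open>l < j\<close> 2 assms by (auto intro!: intros)
    next
      assume "k < i"
      let ?s = "(- 1) ^ (gpar k l * gpar i j)"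
      have "gP i j * gP k l = ?s *\<^sub>q (gP k l * gP i j
          - ((- 1) ^ (gpar k l * gpar i l) * (qpow (- 1) - qpow 1)) *\<^sub>q (gP i l * gP k j))"
        by (rule scaleq_cancel[OF sign_square])
          (use gP_diag[OF \<open>k < i\<close> \<open>l < j\<close>] in simp)
      then show ?thesis using 2 assms by (auto intro!: intros)
    qed
  next
    case 3
    let ?D = "DP I1 I2 * D34P"
    \<comment> \<open>The minor of x contributes q^{-1} in every lower row, the minor of y
      contributes q in rows 3 and 4 and nothing in row 5.\<close>
    define n :: int where "n = (if k = I5 then - 1 else 0)"
    have D: "?D * gP k l = qpow n *\<^sub>q (gP k l * ?D)"
      by (simp add: mult.assoc D34_lower[OF assms(2) l] D12_lower[OF assms(2) l, THEN mult_assoc_rule]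
          n_def scale_simps)
    have "gP k l * invD1 = invD1 * ?D * (gP k l * invD1)"
      by (simp only: invD1_inverse mult_1_left)
    also have "\<dots> = invD1 * (?D * gP k l) * invD1" by (simp only: mult.assoc)
    also have "\<dots> = qpow n *\<^sub>q (invD1 * gP k l * (?D * invD1))"
      unfolding D by (simp only: scaleq_mult_left scaleq_mult_right mult.assoc)
    also have "\<dots> = qpow n *\<^sub>q (invD1 * gP k l)" by (simp only: invD1_inverse mult_1_right)
    finally have "qpow n *\<^sub>q (invD1 * gP k l) = gP k l * invD1" by simp
    then have "invD1 * gP k l = qpow (- n) *\<^sub>q (gP k l * invD1)"
      by (rule scaleq_cancel[rotated]) (simp add: qpow_mult qpow_0)
    then show ?thesis using 3 assms by (auto intro!: intros)
  next
    case 4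
    have par: "gpar i l = par i" "gpar I5 I5 = 2" for i using l by (auto simp: gpar_def par_def)
    have "l < I5" using l by (auto simp: less_idx_def)
    have "gP I5 l * gP I5 I5 = qpow 1 *\<^sub>q (gP I5 I5 * gP I5 l)"
      using gP_row[OF \<open>l < I5\<close>, of I5] by (simp add: par par_def)
    then have "invD2 * (gP I5 l * gP I5 I5) * invD2 = qpow 1 *\<^sub>q (invD2 * gP I5 I5 * (gP I5 l * invD2))"
      by (simp add: scaleq_mult_left scaleq_mult_right mult.assoc)
    then have 5: "invD2 * gP I5 l = qpow 1 *\<^sub>q (gP I5 l * invD2)"
      by (simp add: mult.assoc invD2_inverse)
    show ?thesis
    proof (cases "k = I5")
      case True
      then show ?thesis using 4 5 assms by (auto intro!: intros)
    next
      case False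
      then have "k < I5" by (cases k) (simp_all add: less_idx_def)
      with False have "par k = 0" by (simp add: par_def)
      \<comment> \<open>Here a correction g_5l g_k5 remains. After multiplication by
        \<open>invD2\<close> on both sides, fact \<open>5\<close> moves \<open>invD2\<close> past
        g_5l, and g_k5 is a Levi generator.\<close>
      let ?c = "qpow (- 1) - qpow 1"
      have "gP k l * gP I5 I5 = gP I5 I5 * gP k l + ?c *\<^sub>q (gP I5 l * gP k I5)"
        using gP_diag[OF \<open>k < I5\<close> \<open>l < I5\<close>] by (simp add: par \<open>par k = 0\<close> scaleq_one)
      then have "invD2 * (gP k l * gP I5 I5) * invD2
          = invD2 * gP I5 I5 * (gP k l * invD2) + ?c *\<^sub>q (invD2 * gP I5 l * (gP k I5 * invD2))"
        by (simp add: scaleq_mult_left scaleq_mult_right mult.assoc distrib_left distrib_right)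
      then have "invD2 * gP k l = gP k l * invD2 + ?c *\<^sub>q (qpow 1 *\<^sub>q (gP I5 l * (invD2 * (gP k I5 * invD2))))"
        by (simp add: mult.assoc invD2_inverse 5 scaleq_mult_left mult_assoc_rule[OF 5])
      then show ?thesis using 4 assms by (auto intro!: intros)
    qed
  qed
qed

lemma levi_lower:
  assumes "h \<in> levi" "g \<in> lower_gens" shows "h * g \<in> set_mult lower_gens levi"
proof -
  let ?K = "{h. \<forall>g\<in>lower_gens. h * g \<in> set_mult lower_gens levi}"
  have base: "g \<in> set_mult lower_gens levi" if "g \<in> lower_gens" for g
    using set_mult_base[OF that subalgebra_gen_intros(2)] by simp
  have mult: "h * h' * g \<in> set_mult lower_gens levi" if "h \<in> ?K" "h' \<in> ?K" "g \<in> lower_gens" for h h' g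
    unfolding mult.assoc
  proof (rule set_mult_linear[OF cq_linear_mult(1)])
    show "h' * g \<in> set_mult lower_gens levi" using that by blast
    show "h * (a * b) \<in> set_mult lower_gens levi" if "a \<in> lower_gens" "b \<in> levi" for a b
      using \<open>h \<in> ?K\<close> that set_mult_right[OF subalgebra_gen_subalgebra, of "h * a"]
      by (simp add: mult.assoc)
  qed
  have "subalgebra ?K"
    unfolding subalgebra_def
    using mult base by (auto simp: set_mult_closed distrib_right scaleq_mult_left)
  then have "h \<in> ?K"
  proof (rule subalgebra_gen_induct[OF _ _ assms(1)])
    show "levi_gens \<subseteq> ?K" using levi_gen_lower by (fastforce simp: lower_gens_def[THEN eqset_imp_iff])
  qed
  then show ?thesis using assms(2) by blast
qed

lemma tP_I5: "tP I5 j = ttauP j"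
  by (simp add: tP_def ttauP_def)

lemma big_cell_gens_eq: "big_cell_gens = {tP i j | i j. \<not> upper i \<and> upper j}"
proof (intro equalityI subsetI)
  fix x assume "x \<in> big_cell_gens"
  then consider i j where "x = tP i j" "i \<in> {I3, I4}" "j \<in> {I1, I2}"
    | j where "x = tP I5 j" "j \<in> {I1, I2}"
    unfolding big_cell_gens_def tP_I5 by blast
  then show "x \<in> {tP i j | i j. \<not> upper i \<and> upper j}"
  proof cases
    case (1 i j)
    then show ?thesis by (intro CollectI exI[of _ i] exI[of _ j]) auto
  next
    case (2 j)
    then show ?thesis by (intro CollectI exI[of _ I5] exI[of _ j]) auto
  qed
next
  fix x assume "x \<in> {tP i j | i j. \<not> upper i \<and> upper j}"
  then obtain i j where x: "x = tP i j" "\<not> upper i" "j \<in> {I1, I2}" by (auto simp: upper_def)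
  then have "i \<in> {I3, I4} \<or> i = I5" by (cases i) simp_all
  then show "x \<in> big_cell_gens"
    using x tP_I5 unfolding big_cell_gens_def by blast
qed

lemma big_cell_tP: "\<not> upper i \<Longrightarrow> upper j \<Longrightarrow> tP i j \<in> big_cell"
  by (rule subalgebra_gen_inc) (auto simp: big_cell_gens_eq)

lemma lower_in_product: "set_mult lower_gens levi \<subseteq> set_mult big_cell levi"
proof
  fix x assume "x \<in> set_mult lower_gens levi"
  then show "x \<in> set_mult big_cell levi"
  proof (rule set_mult_linear[OF cq_linear_id(2), rotated])
    fix g h assume "g \<in> lower_gens" "h \<in> levi"
    then obtain i j where g: "g = gP i j" "\<not> upper i" "upper j" by (auto simp: lower_gens_def)
    then have "g = (\<Sum>k\<in>{I1, I2}. tP i k * gP k j)" using gP_eq_tP[of i j] by (auto simp only: upper_def)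
    then have "g * h = (\<Sum>k\<in>{I1, I2}. tP i k * (gP k j * h))"
      by (simp add: distrib_right mult.assoc)
    also have "\<dots> \<in> set_mult big_cell levi"
    proof (rule set_mult_sum)
      fix k assume "k \<in> {I1, I2}"
      then have "upper k" by auto
      with g \<open>h \<in> levi\<close> show "tP i k * (gP k j * h) \<in> set_mult big_cell levi"
        by (intro set_mult_base big_cell_tP subalgebra_gen_intros levi_gP) auto
    qed
    finally show "g * h \<in> set_mult big_cell levi" .
  qed
qed

text \<open>For a generator t = g x^{-1}, the product h g is a combination of terms g' h' with g' in
  the lower left block, and g' = t' x leads back to entries of t on the left.\<close>

lemma levi_big_cell:
  assumes "h \<in> levi" "u \<in> big_cell" shows "h * u \<in> set_mult big_cell levi"
proof -
  note subalg = subalgebra_gen_subalgebra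
  let ?P = "{u. \<forall>h\<in>levi. h * u \<in> set_mult big_cell levi}"
  have base: "h \<in> set_mult big_cell levi" if "h \<in> levi" for h
    using set_mult_base[OF subalgebra_gen_intros(2) that] by simp
  have mult: "h * (u * u') \<in> set_mult big_cell levi" if "u \<in> ?P" "u' \<in> ?P" "h \<in> levi" for h u u'
    unfolding mult.assoc[symmetric]
  proof (rule set_mult_linear[OF cq_linear_mult(2)])
    show "h * u \<in> set_mult big_cell levi" using that by blast
    show "(a * b) * u' \<in> set_mult big_cell levi" if "a \<in> big_cell" "b \<in> levi" for a b
      using \<open>u' \<in> ?P\<close> that set_mult_left[OF subalg, of "b * u'"] by (simp add: mult.assoc)
  qed
  have "subalgebra ?P"
    unfolding subalgebra_def
    using mult base by (auto simp: set_mult_closed distrib_left scaleq_mult_right)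
  moreover have "big_cell_gens \<subseteq> ?P"
  proof (rule subsetI, rule CollectI, rule ballI)
    fix u h assume "u \<in> big_cell_gens" and h: "h \<in> levi"
    then obtain i j where u: "u = tP i j" "\<not> upper i" "upper j" by (auto simp: big_cell_gens_eq)
    then have "u = (\<Sum>k\<in>{I1, I2}. gP i k * xinv k j)" using tP_eq[of i j] by (auto simp only: upper_def)
    then have "h * u = (\<Sum>k\<in>{I1, I2}. h * gP i k * xinv k j)"
      by (simp add: distrib_left mult.assoc)
    also have "\<dots> \<in> set_mult lower_gens levi"
    proof (rule set_mult_sum)
      fix k assume "k \<in> {I1, I2}"
      then have "upper k" by auto
      then have "gP i k \<in> lower_gens" using u(2) unfolding lower_gens_def by blast
      then show "h * gP i k * xinv k j \<in> set_mult lower_gens levi"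
        by (intro set_mult_right subalg levi_xinv levi_lower h)
    qed
    finally show "h * u \<in> set_mult big_cell levi" using lower_in_product by blast
  qed
  ultimately have "u \<in> ?P" using assms(2) by (rule subalgebra_gen_induct)
  then show ?thesis using assms(1) by blast
qed

text \<open>The left multipliers of the span form a subalgebra that contains every generator of P,
  and 1 is in the span.\<close>

theorem big_cell_levi_decomposition: "x \<in> set_mult big_cell levi"
proof -
  note subalg = subalgebra_gen_subalgebra
  let ?W = "set_mult big_cell levi"
  let ?N = "{p. \<forall>w\<in>?W. p * w \<in> ?W}"
  have N: "subalgebra ?N"
    unfolding subalgebra_def
    by (auto simp: set_mult_closed distrib_right scaleq_mult_left mult.assoc)
  have levi: "h \<in> ?N" if "h \<in> levi" for h
  proof (rule CollectI, rule ballI, rule set_mult_linear[OF cq_linear_mult(1)])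
    show "h * (a * b) \<in> ?W" if "a \<in> big_cell" "b \<in> levi" for a b
      using set_mult_right[OF subalg levi_big_cell[OF \<open>h \<in> levi\<close> that(1)] that(2)]
      by (simp add: mult.assoc)
  qed
  have cell: "u \<in> ?N" if "u \<in> big_cell" for u
    using that set_mult_left[OF subalg] by blast
  have gen: "gP i j \<in> ?N" for i j
  proof (cases "upper i = upper j")
    case True
    then show ?thesis by (intro levi levi_gP)
  next
    case False
    show ?thesis
    proof (cases "upper i")
      case True
      with False show ?thesis by (simp add: gP_upper_zero set_mult_closed)
    next
      case lower: False
      then have "gP i j = (\<Sum>k\<in>{I1, I2}. tP i k * gP k j)"
        using False by (intro gP_eq_tP) (auto simp: upper_def)
      moreover have "tP i k * gP k j \<in> ?N" if "k \<in> {I1, I2}" for k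
        using N cell[OF big_cell_tP[OF lower, of k]] levi[OF levi_gP[of k j]] that False lower
        unfolding subalgebra_def by auto
      ultimately show ?thesis using N by (simp add: subalgebra_def)
    qed
  qed
  have "x \<in> ?N" by (rule O_P_induct[OF N gen levi levi]) (rule levi_inv)+
  moreover have "1 \<in> ?W" using set_mult_base[OF subalgebra_gen_intros(2) subalgebra_gen_intros(2)] by simp
  ultimately show ?thesis by force
qed

section \<open>Restricting the comultiplication\<close>

lemma cq_linear_sum: "cq_linear f \<Longrightarrow> f (sum h A) = (\<Sum>i\<in>A. f (h i))"
  by (rule module_hom.sum)

lemma subalgebra_range:
  assumes "superalg_hom f" shows "subalgebra (range f)"
  unfolding subalgebra_def by (auto simp flip: superalg_homD[OF assms])

lemma monoid_inverse_unique: "b * a = 1 \<Longrightarrow> a * c = 1 \<Longrightarrow> b = c" for a :: "'a::monoid_mult"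
  by (metis mult.assoc mult_1_left mult_1_right)

lemma subalgebra_sum:
  assumes "subalgebra B" "\<And>i. i \<in> A \<Longrightarrow> f i \<in> B" shows "sum f A \<in> B"
  using assms(2) by (induction A rule: infinite_finite_induct) (use assms(1) in \<open>auto simp: subalgebra_def\<close>)

lemma (in hopf_superalgebra) antipode_matrix:
  fixes g :: "'i::finite \<Rightarrow> 'i \<Rightarrow> 'h"
  assumes "\<Delta> (g i j) = (\<Sum>k\<in>UNIV. g i k \<otimes> g k j)"
  shows "(\<Sum>k\<in>UNIV. S (g i k) * g k j) = \<epsilon> (g i j) *\<^sub>q 1"
    "(\<Sum>k\<in>UNIV. g i k * S (g k j)) = \<epsilon> (g i j) *\<^sub>q 1"
  using antipode_left[of "g i j"] antipode_right[of "g i j"]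
  by (simp_all add: assms cq_linear_sum[OF tlift_linear] antipode_left_bilinear
      antipode_right_bilinear tlift_tens)

text \<open>Every law holds for \<Delta> and is pulled back along id \<otimes> \<iota>, which has
  the left inverse id \<otimes> r. As r is merely linear, multiplicativity of \<delta> is obtained
  in this way too.\<close>

lemma (in hopf_superalgebra) left_coaction_restrict:
  fixes \<iota> :: "'v::cq_superalgebra \<Rightarrow> 'h"
  assumes \<iota>: "superalg_hom \<iota>" and r: "cq_linear r" and retract: "\<And>u. r (\<iota> u) = u"
    and range: "\<And>u. \<Delta> (\<iota> u) \<in> range (map_tensor id \<iota>)"
  defines "\<delta> \<equiv> \<lambda>u. map_tensor id r (\<Delta> (\<iota> u))"
  shows "map_tensor id \<iota> (\<delta> u) = \<Delta> (\<iota> u)" "left_coaction \<Delta> \<epsilon> S \<delta>"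
proof -
  let ?J = "map_tensor id \<iota>"
  note \<iota>_lin = superalg_hom_linear[OF \<iota>]
  note lin = cq_linear_id r \<iota>_lin comult_linear map_tensor_linear
  have J_hom: "superalg_hom ?J" by (rule map_tensor_superalg_hom[OF superalg_hom_id \<iota>])
  have left_inv: "map_tensor id r (?J w) = w" for w :: "('h, 'v) tensor"
    by (simp add: map_tensor_compose lin retract map_tensor_id)
  have J_inj: "x = y" if "?J x = ?J y" for x y :: "('h, 'v) tensor"
    using left_inv that by metis
  show J\<delta>: "?J (\<delta> u) = \<Delta> (\<iota> u)" for u
    using range[of u] left_inv by (auto simp: \<delta>_def)
  have \<delta>_lin: "cq_linear \<delta>"
    unfolding \<delta>_def by (intro cq_linear_compose[OF map_tensor_linear] cq_linear_compose[OF comult_linear] lin)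
  note D = superalg_homD[OF \<iota>] superalg_homD[OF comult_hom] superalg_homD[OF J_hom]
  have \<delta>_hom: "superalg_hom \<delta>"
    unfolding superalg_hom_def
    by (intro conjI allI \<delta>_lin; rule J_inj; simp only: J\<delta> D)
  show "left_coaction \<Delta> \<epsilon> S \<delta>"
  proof (intro left_coaction.intro left_coaction_axioms.intro hopf_superalgebra_axioms \<delta>_hom)
    fix v
    have J2_inj: "x = y" if "map_tensor id ?J x = map_tensor id ?J y"
      for x y :: "('h, ('h, 'v) tensor) tensor"
    proof -
      have "map_tensor id (map_tensor id r) (map_tensor id ?J w) = w"
        for w :: "('h, ('h, 'v) tensor) tensor"
        by (simp add: map_tensor_compose lin retract map_tensor_id)
      then show ?thesis using that by metis
    qed
    show "tensor_assoc (map_tensor \<Delta> id (\<delta> v)) = map_tensor id \<delta> (\<delta> v)"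
    proof (rule J2_inj)
      have "map_tensor id ?J (tensor_assoc (map_tensor \<Delta> id (\<delta> v)))
          = tensor_assoc (map_tensor (map_tensor id id) \<iota> (map_tensor \<Delta> id (\<delta> v)))"
        by (simp add: tensor_assoc_map_tensor lin)
      also have "\<dots> = tensor_assoc (map_tensor \<Delta> id (?J (\<delta> v)))"
        by (simp add: map_tensor_compose lin map_tensor_id)
      also have "\<dots> = map_tensor id \<Delta> (?J (\<delta> v))" by (simp add: J\<delta> coassoc)
      also have "\<dots> = map_tensor id ?J (map_tensor id \<delta> (\<delta> v))"
        by (simp add: map_tensor_compose lin \<delta>_lin) (simp add: J\<delta>)
      finally show "map_tensor id ?J (tensor_assoc (map_tensor \<Delta> id (\<delta> v)))
          = map_tensor id ?J (map_tensor id \<delta> (\<delta> v))" .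
    qed
    have bil: "bilinear_q (\<lambda>a w. \<epsilon> a *\<^sub>q (w :: 'v))"
      by (simp add: bilinear_q_def cq_linear_iff counit_add counit_scaleq cq.scale_right_distrib
          cq.scale_left_distrib scaleq_scaleq mult.commute)
    have "\<iota> (tlift (\<lambda>a w. \<epsilon> a *\<^sub>q w) (\<delta> v)) = tlift (\<lambda>a w. \<epsilon> a *\<^sub>q w) (?J (\<delta> v))"
      by (simp add: linear_tlift bil lin tlift_map_tensor counit_scale_bilinear
          cq_linear_scale[OF \<iota>_lin])
    also have "\<dots> = \<iota> v" by (simp add: J\<delta> counit_left)
    finally show "tlift (\<lambda>a w. \<epsilon> a *\<^sub>q w) (\<delta> v) = v" using retract by metis
  qed
qed

section \<open>The Hopf structure of the parabolic supergroup\<close>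

lemma sum_idx: "(\<Sum>k\<in>UNIV. f k) = f I1 + f I2 + f I3 + f I4 + f I5"
  by (simp add: UNIV_idx add.assoc)

locale quantum_GL = hopf_superalgebra \<Delta> \<epsilon> S
  for \<Delta> :: "O_GL \<Rightarrow> (O_GL, O_GL) tensor" and \<epsilon> :: "O_GL \<Rightarrow> Cq" and S :: "O_GL \<Rightarrow> O_GL" +
  assumes comult_gen: "\<Delta> (gGL i j) = (\<Sum>k\<in>UNIV. gGL i k \<otimes> gGL k j)"
    and counit_gen: "\<epsilon> (gGL i j) = (if i = j then 1 else 0)"
begin

lemma map_prP_comult_gen: "map_tensor prP prP (\<Delta> (gGL i j)) = (\<Sum>k\<in>UNIV. gP i k \<otimes> gP k j)"
proof -
  note lin = superalg_hom_linear[OF hom_prP]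
  show ?thesis
    by (simp add: comult_gen cq_linear_sum[OF map_tensor_linear[OF lin lin]]
        map_tensor_tens[OF lin lin] gP_def)
qed

text \<open>In P the upper rows of g S(g) = 1 involve only x and the upper rows of S(g), so x^{-1}
  solves for the latter. This yields S(x) = x^{-1} together with the stability of the ideal under S
  that makes P a Hopf quotient.\<close>

lemma prP_antipode_upper:
  assumes "a \<in> {I1, I2}"
  shows "prP (S (gGL a j)) = (if upper j then xinv a j else 0)"
proof -
  let ?z = "\<lambda>k. prP (S (gGL k j))"
  note p = superalg_homD[OF hom_prP]
  have right: "(\<Sum>k\<in>{I1, I2}. gP i k * ?z k) = (if i = j then 1 else 0)" if "i \<in> {I1, I2}" for i
  proof -
    have "(\<Sum>k\<in>UNIV. gP i k * ?z k) = prP (\<Sum>k\<in>UNIV. gGL i k * S (gGL k j))"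
      by (simp add: p gP_def)
    also have "\<dots> = (if i = j then 1 else 0)"
      by (simp add: antipode_matrix(2) comult_gen counit_gen p scaleq_one)
    finally show ?thesis using that by (auto simp: sum_idx gP_upper_zero)
  qed
  have "?z a = (\<Sum>k\<in>{I1, I2}. (if a = k then 1 else 0) * ?z k)" using assms by auto
  also have "\<dots> = (\<Sum>k\<in>{I1, I2}. (\<Sum>i\<in>{I1, I2}. xinv a i * gP i k) * ?z k)"
    by (intro sum.cong refl) (simp only: xinv_inverse(2)[OF assms])
  also have "\<dots> = (\<Sum>i\<in>{I1, I2}. xinv a i * (\<Sum>k\<in>{I1, I2}. gP i k * ?z k))"
    by (simp add: distrib_left distrib_right mult.assoc add_ac)
  also have "\<dots> = (\<Sum>i\<in>{I1, I2}. xinv a i * (if i = j then 1 else 0))"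
    by (intro sum.cong refl) (simp only: right)
  also have "\<dots> = (if upper j then xinv a j else 0)" by (cases j) simp_all
  finally show ?thesis .
qed

sublocale P: hopf_quotient \<Delta> \<epsilon> S prP rel_P
proof (intro hopf_quotient.intro hopf_quotient_axioms.intro hopf_superalgebra_axioms)
  fix r assume "r \<in> rel_P"
  then obtain i j where r: "r = gGL i j" "upper i" "\<not> upper j" "i \<in> {I1, I2}" "i \<noteq> j"
    by (auto simp: rel_P_def)
  \<comment> \<open>The first factor vanishes for lower k, the second for upper k.\<close>
  have "gP i k \<otimes> gP k j = 0" for k
    using r by (cases "upper k") (simp_all add: gP_upper_zero)
  then show "map_tensor prP prP (\<Delta> r) = 0" by (simp add: r(1) map_prP_comult_gen)
  show "\<epsilon> r = 0" using r by (simp add: counit_gen)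
  show "prP (S r) = 0" using r by (simp add: prP_antipode_upper)
qed (rule hom_prP prP_surj prP_kernel; assumption?)+

sublocale PH: hopf_superalgebra P.\<Delta>' P.\<epsilon>' P.S'
  by (rule P.quot_hopf_superalgebra)

lemma comult_gP: "P.\<Delta>' (gP i j) = (\<Sum>k\<in>UNIV. gP i k \<otimes> gP k j)"
  unfolding gP_def P.quot_comult_proj map_prP_comult_gen[unfolded gP_def] ..

lemma counit_gP: "P.\<epsilon>' (gP i j) = (if i = j then 1 else 0)"
  unfolding gP_def P.quot_counit_proj counit_gen ..

lemma antipode_gP: "a \<in> {I1, I2} \<Longrightarrow> j \<in> {I1, I2} \<Longrightarrow> P.S' (gP a j) = xinv a j"
  unfolding gP_def P.quot_antipode_proj by (auto simp: prP_antipode_upper)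

lemma xiP_eq: "xiP j = invD2 * gP I5 j"
  by (simp add: xiP_def rinv_d)

lemma prSP_row: "j \<in> {I3, I4} \<Longrightarrow> prSP (gP I5 j) = 0"
proof -
  assume "j \<in> {I3, I4}"
  then have "prSP (xiP j) = 0" unfolding prSP_kernel by (intro ideal_gen_inc) (auto simp: rel_SP_def)
  moreover have "gP I5 j = gP I5 I5 * xiP j" by (simp add: xiP_eq invD2_inverse flip: mult.assoc)
  ultimately show ?thesis by (simp add: superalg_homD[OF hom_prSP])
qed

sublocale SP: hopf_quotient P.\<Delta>' P.\<epsilon>' P.S' prSP rel_SP
proof (intro hopf_quotient.intro hopf_quotient_axioms.intro PH.hopf_superalgebra_axioms)
  note p = superalg_homD[OF hom_prSP] and lin = superalg_hom_linear[OF hom_prSP]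
  fix r assume "r \<in> rel_SP"
  then obtain j where r: "r = invD2 * gP I5 j" and j: "j \<in> {I3, I4}"
    by (auto simp: rel_SP_def xiP_eq)
  have "map_tensor prSP prSP (gP I5 k \<otimes> gP k j) = 0" for k
    using j prSP_row by (cases k) (auto simp: map_tensor_tens lin gP_upper_zero p)
  then have "map_tensor prSP prSP (P.\<Delta>' (gP I5 j)) = 0"
    by (simp add: comult_gP cq_linear_sum[OF map_tensor_linear[OF lin lin]])
  then show "map_tensor prSP prSP (P.\<Delta>' r) = 0"
    by (simp add: r superalg_homD[OF PH.comult_hom]
        superalg_homD[OF map_tensor_superalg_hom[OF hom_prSP hom_prSP]])
  show "P.\<epsilon>' r = 0" using j by (auto simp: r PH.counit_mult counit_gP)
  \<comment> \<open>Modulo \<xi>, row 5 of S(g) g = 1 in columns 3 and 4 reduces to w y = 0, and y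
    is invertible.\<close>
  let ?w = "\<lambda>k. prSP (P.S' (gP I5 k))"
  have left: "(\<Sum>k\<in>{I3, I4}. ?w k * prSP (gP k l)) = 0" if "l \<in> {I3, I4}" for l
  proof -
    have "(\<Sum>k\<in>UNIV. ?w k * prSP (gP k l)) = prSP (\<Sum>k\<in>UNIV. P.S' (gP I5 k) * gP k l)"
      by (simp add: p)
    also have "\<dots> = 0"
      using that by (auto simp: PH.antipode_matrix(1) comult_gP counit_gP p)
    finally show ?thesis
      using that prSP_row[OF that] by (auto simp: sum_idx gP_upper_zero p)
  qed
  have "?w j = (\<Sum>k\<in>{I3, I4}. ?w k * prSP (if k = j then 1 else 0))" using j by (auto simp: p)
  also have "\<dots> = (\<Sum>k\<in>{I3, I4}. ?w k * prSP (\<Sum>l\<in>{I3, I4}. gP k l * yinv l j))"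
    by (intro sum.cong refl) (simp only: yinv_inverse(1)[OF _ j])
  also have "\<dots> = (\<Sum>l\<in>{I3, I4}. (\<Sum>k\<in>{I3, I4}. ?w k * prSP (gP k l)) * prSP (yinv l j))"
    by (simp add: p distrib_left distrib_right mult.assoc add_ac)
  also have "\<dots> = 0" using left by (intro sum.neutral ballI) (simp only: mult_zero_left)
  finally have w: "?w j = 0" .
  have "evenp (gP I5 j) = 0" using hpar_gP[of I5 j] j by (auto simp: hpar_def gpar_def par_def)
  then have "P.S' r = P.S' (gP I5 j) * (evenp (P.S' invD2) - oddp (P.S' invD2))"
    by (simp add: r PH.antipode_mult oddp_def cq_linear_zero[OF PH.antipode_linear])
  then show "prSP (P.S' r) = 0" by (simp add: p w)
qed (rule hom_prSP prSP_surj prSP_kernel[THEN iffD1]; assumption?)+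

section \<open>The coaction on the big cell\<close>

text \<open>Left in factored form because the formula for ttau has this shape;
  \<open>comult_tP\<close> multiplies it out for t.\<close>

lemma comult_tP_product:
  assumes i: "\<not> upper i" and j: "j \<in> {I1, I2}"
  shows "P.\<Delta>' (tP i j) = (\<Sum>b\<in>{I1, I2}.
    (gP i b \<otimes> 1 + (\<Sum>k\<in>{I3, I4, I5}. gP i k \<otimes> tP k b)) * (xinv b j \<otimes> 1))"
proof -
  let ?R = "\<lambda>b. gP i b \<otimes> 1 + (\<Sum>k\<in>{I3, I4, I5}. gP i k \<otimes> tP k b)"
  \<comment> \<open>\<open>?Y\<close> is (1 \<otimes> x) \<Delta>(x^{-1}). From \<Delta>(x) = (x
    \<otimes> 1)(1 \<otimes> x) it follows that (x \<otimes> 1) \<open>?Y\<close> = 1, so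
    \<open>?Y\<close> is x^{-1} \<otimes> 1 and \<Delta>(x^{-1}) is never computed by
    itself.\<close>
  let ?Y = "\<lambda>b. \<Sum>c\<in>{I1, I2}. (1 \<otimes> gP b c) * P.\<Delta>' (xinv c j)"
  note D = superalg_homD[OF PH.comult_hom]
  have upper: "P.\<Delta>' (gP a c) = (\<Sum>b\<in>{I1, I2}. (gP a b \<otimes> 1) * (1 \<otimes> gP b c))"
    if "a \<in> {I1, I2}" for a c
    using that by (auto simp: comult_gP sum_idx gP_upper_zero)
  have lower: "P.\<Delta>' (gP i c) = (\<Sum>b\<in>{I1, I2}. ?R b * (1 \<otimes> gP b c))" if "c \<in> {I1, I2}" for c
    by (simp add: comult_gP sum_idx distrib_right tens_add_right gP_eq_tP[OF _ that, of I3]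
        gP_eq_tP[OF _ that, of I4] gP_eq_tP[OF _ that, of I5] add_ac)
  have inv: "(\<Sum>b\<in>{I1, I2}. (gP a b \<otimes> 1) * ?Y b) = (if a = j then 1 else 0)"
    if "a \<in> {I1, I2}" for a
  proof -
    have "(\<Sum>b\<in>{I1, I2}. (gP a b \<otimes> 1) * ?Y b) = P.\<Delta>' (\<Sum>c\<in>{I1, I2}. gP a c * xinv c j)"
      by (simp add: D upper[OF that] distrib_left distrib_right add_ac flip: mult.assoc)
    then show ?thesis using xinv_inverse(1)[OF that j] by (simp add: D)
  qed
  have Y: "?Y b = xinv b j \<otimes> 1" if b: "b \<in> {I1, I2}" for b
  proof -
    have "?Y b = (\<Sum>d\<in>{I1, I2}. ((if b = d then 1 else 0) \<otimes> 1) * ?Y d)"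
      using b by (auto simp: one_tensor_def[symmetric])
    also have "\<dots> = (\<Sum>d\<in>{I1, I2}. ((\<Sum>a\<in>{I1, I2}. xinv b a * gP a d) \<otimes> 1) * ?Y d)"
      by (intro sum.cong refl) (simp only: xinv_inverse(2)[OF b])
    also have "\<dots> = (\<Sum>a\<in>{I1, I2}. (xinv b a \<otimes> 1) * (\<Sum>d\<in>{I1, I2}. (gP a d \<otimes> 1) * ?Y d))"
      by (simp add: tens_add_left distrib_left distrib_right add_ac flip: mult.assoc)
    also have "\<dots> = (\<Sum>a\<in>{I1, I2}. (xinv b a \<otimes> 1) * (if a = j then 1 else 0))"
      by (intro sum.cong refl) (simp only: inv)
    also have "\<dots> = xinv b j \<otimes> 1" using j by auto
    finally show ?thesis .
  qed
  have "P.\<Delta>' (tP i j) = (\<Sum>c\<in>{I1, I2}. (\<Sum>b\<in>{I1, I2}. ?R b * (1 \<otimes> gP b c)) * P.\<Delta>' (xinv c j))"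
    unfolding tP_eq[OF i j] D by (intro sum.cong refl) (simp only: lower)
  also have "\<dots> = (\<Sum>b\<in>{I1, I2}. ?R b * ?Y b)"
    by (simp add: distrib_left distrib_right add_ac flip: mult.assoc)
  also have "\<dots> = (\<Sum>b\<in>{I1, I2}. ?R b * (xinv b j \<otimes> 1))"
    by (intro sum.cong refl) (simp only: Y)
  finally show ?thesis .
qed

text \<open>x^{-1} is S(x), and S preserves parity. This keeps signs out of products with x^{-1}
  \<otimes> 1.\<close>

lemma xinv_even: "b \<in> {I1, I2} \<Longrightarrow> j \<in> {I1, I2} \<Longrightarrow> evenp (xinv b j) = xinv b j"
  using hpar_gP[of b j] PH.antipode_even[of "gP b j"]
  by (auto simp: antipode_gP hpar_def gpar_def par_def)

lemma comult_tP:
  assumes i: "\<not> upper i" and j: "j \<in> {I1, I2}"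
  shows "P.\<Delta>' (tP i j)
    = tP i j \<otimes> 1 + (\<Sum>k\<in>{I3, I4, I5}. \<Sum>b\<in>{I1, I2}. (gP i k * xinv b j) \<otimes> tP k b)"
proof -
  have "(x \<otimes> y) * (xinv b j \<otimes> 1) = (x * xinv b j) \<otimes> y" if "b \<in> {I1, I2}" for x y :: O_P and b
    using xinv_even[OF that j] by (simp add: tens_mult_tens_even)
  from this[of I1] this[of I2] show ?thesis
    unfolding comult_tP_product[OF assms]
    by (simp add: tP_eq[OF assms] distrib_right tens_add_left add_ac)
qed

text \<open>\<phi> kills t, which is the lower left block times x^{-1}, so only t \<otimes> 1
  survives in \<Delta> t. Both sides are homomorphisms in u, hence generators decide.\<close>

lemma big_cell_coinvariant:
  assumes \<phi>: "superalg_hom \<phi>" "\<And>i j. \<phi> (gP i j) = levi_gen i j" and u: "u \<in> big_cell"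
  shows "map_tensor id \<phi> (P.\<Delta>' u) = u \<otimes> 1"
proof -
  have hom: "superalg_hom (\<lambda>x. map_tensor id \<phi> (P.\<Delta>' x))"
    by (rule superalg_hom_compose[OF map_tensor_superalg_hom[OF superalg_hom_id \<phi>(1)] PH.comult_hom])
  have "evenp (x \<otimes> (1 :: O_P)) = evenp x \<otimes> 1" for x :: O_P
    by (simp add: tensor_evenp_tens evenp_one oddp_def)
  then have hom1: "superalg_hom (\<lambda>x :: O_P. x \<otimes> (1 :: O_P))"
    by (simp add: superalg_hom_def cq_linear_tens one_tensor_def)
  have \<phi>_tP: "\<phi> (tP i j) = 0" if "\<not> upper i" "j \<in> {I1, I2}" for i j
    using that(1) by (simp add: tP_eq[OF that] superalg_homD[OF \<phi>(1)] \<phi>(2) levi_gen_def)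
  have "map_tensor id \<phi> (P.\<Delta>' (tP i j)) = tP i j \<otimes> 1" if "\<not> upper i" "j \<in> {I1, I2}" for i j
  proof -
    note lin = cq_linear_id(1) superalg_hom_linear[OF \<phi>(1)]
    note L = map_tensor_linear[OF lin] and T = map_tensor_tens[OF lin]
    show ?thesis
      unfolding comult_tP[OF that] cq_linear_add[OF L] cq_linear_sum[OF L] T
      by (simp add: \<phi>_tP superalg_homD[OF \<phi>(1)])
  qed
  then have "big_cell_gens \<subseteq> {x. map_tensor id \<phi> (P.\<Delta>' x) = x \<otimes> 1}"
    by (auto simp: big_cell_gens_eq upper_def)
  with u show ?thesis
    using subalgebra_gen_induct[OF subalgebra_equalizer[OF hom hom1]] by blast
qed

text \<open>For i and j in the same block, a summation index from the other block contributes zero,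
  so the remaining right factors are fixed by \<phi>. Homomorphisms that agree on an element agree
  on its inverse, which settles \<open>invD1\<close> and \<open>invD2\<close>.\<close>

lemma levi_comult:
  assumes \<phi>: "superalg_hom \<phi>" "\<And>i j. \<phi> (gP i j) = levi_gen i j" and h: "h \<in> levi"
  shows "map_tensor id \<phi> (P.\<Delta>' h) = P.\<Delta>' h"
proof -
  let ?f = "\<lambda>x. map_tensor id \<phi> (P.\<Delta>' x)"
  have hom: "superalg_hom ?f"
    by (rule superalg_hom_compose[OF map_tensor_superalg_hom[OF superalg_hom_id \<phi>(1)] PH.comult_hom])
  note fD = superalg_homD[OF hom] and D = superalg_homD[OF PH.comult_hom]
  let ?E = "{x. ?f x = P.\<Delta>' x}"
  have gen: "?f (gP i j) = P.\<Delta>' (gP i j)" if "upper i = upper j" for i j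
  proof -
    note lin = cq_linear_id(1) superalg_hom_linear[OF \<phi>(1)]
    have "gP i k \<otimes> levi_gen k j = gP i k \<otimes> gP k j" for k
      using that by (cases "upper k"; cases "upper j") (simp_all add: levi_gen_def gP_upper_zero)
    then show ?thesis
      by (simp add: comult_gP cq_linear_sum[OF map_tensor_linear[OF lin]] map_tensor_tens[OF lin] \<phi>(2))
  qed
  have inverse: "?f y = P.\<Delta>' y" if "x * y = 1" "y * x = 1" "?f x = P.\<Delta>' x" for x y
  proof -
    have 1: "P.\<Delta>' x * P.\<Delta>' y = 1" by (simp only: D(4) that(1) flip: D(5))
    have "?f y * ?f x = 1" by (simp only: fD(4) that(2) flip: fD(5))
    then have "?f y * P.\<Delta>' x = 1" by (simp only: that(3))
    from monoid_inverse_unique[OF this 1] show ?thesis .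
  qed
  have "?f (DP I1 I2 * D34P) = P.\<Delta>' (DP I1 I2 * D34P)"
    by (simp add: DP_def D34P_def D gen
        superalg_homD[OF map_tensor_superalg_hom[OF superalg_hom_id \<phi>(1)]])
  then have "?f invD1 = P.\<Delta>' invD1" by (rule inverse[OF invD1_inverse])
  moreover have "?f invD2 = P.\<Delta>' invD2" by (rule inverse[OF invD2_inverse gen]) simp
  ultimately have "levi_gens \<subseteq> ?E" unfolding levi_gens_def using gen by blast
  then show ?thesis
    using subalgebra_gen_induct[OF subalgebra_equalizer[OF hom PH.comult_hom] _ h] by blast
qed

lemma big_cell_retraction:
  obtains \<rho> :: "O_P \<Rightarrow> O_P"
  where "cq_linear \<rho>" "\<And>x. \<rho> x \<in> big_cell" "\<And>u. u \<in> big_cell \<Longrightarrow> \<rho> u = u"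
proof -
  obtain \<phi> where \<phi>: "superalg_hom \<phi>" "\<And>i j. \<phi> (gP i j) = levi_gen i j"
    by (rule levi_hom) blast
  let ?m = "tlift (\<lambda>x y. x * P.S' y)"
  let ?f = "\<lambda>x. map_tensor id \<phi> (P.\<Delta>' x)"
  note m = PH.antipode_right_bilinear
  have hom: "superalg_hom ?f"
    by (rule superalg_hom_compose[OF map_tensor_superalg_hom[OF superalg_hom_id \<phi>(1)] PH.comult_hom])
  define \<rho> where "\<rho> x = ?m (?f x)" for x
  have lin: "cq_linear \<rho>"
    unfolding \<rho>_def by (rule cq_linear_compose[OF tlift_linear[OF m] superalg_hom_linear[OF hom]])
  have m_left: "?m ((u \<otimes> 1) * z) = u * ?m z" for u z
    by (induction z) (simp_all add: tlift_tens[OF m] tlift_add_arg[OF m] distrib_left mult.assoc)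
  have product: "\<rho> (u * h) = P.\<epsilon>' h *\<^sub>q u" if "u \<in> big_cell" "h \<in> levi" for u h
    using that by (simp add: \<rho>_def superalg_homD(5)[OF hom] big_cell_coinvariant[OF \<phi>]
        levi_comult[OF \<phi>] m_left PH.antipode_right scaleq_mult_right)
  show ?thesis
  proof
    show "cq_linear \<rho>" by (rule lin)
    show "\<rho> u = u" if "u \<in> big_cell" for u
      using product[OF that subalgebra_gen_intros(2)] by (simp add: PH.counit_one scaleq_one)
    \<comment> \<open>Each spanning product u h goes to a multiple of u, so all of P lands in the
      big cell.\<close>
    have "set_mult big_cell levi \<subseteq> {x. \<rho> x \<in> big_cell}"
      unfolding set_mult_def
    proof (rule cq.span_minimal)
      show "cq.subspace {x. \<rho> x \<in> big_cell}"
        by (rule cq.subspaceI)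
          (auto simp: cq_linear_zero[OF lin] cq_linear_add[OF lin] cq_linear_scale[OF lin] subalgebra_gen_intros)
    qed (auto simp: product subalgebra_gen_intros)
    then show "\<rho> x \<in> big_cell" for x using big_cell_levi_decomposition by blast
  qed
qed

end

section \<open>Assembling the coaction\<close>

lemma hom_Rep_O_U: "superalg_hom Rep_O_U"
  by (simp add: superalg_hom_def cq_linear_iff plus_O_U.rep_eq scaleq_O_U.rep_eq one_O_U.rep_eq
      times_O_U.rep_eq evenp_O_U.rep_eq)

theorem proposition7p5:
  fixes \<Delta> :: "O_GL \<Rightarrow> (O_GL, O_GL) tensor" and \<epsilon> :: "O_GL \<Rightarrow> Cq" and S :: "O_GL \<Rightarrow> O_GL"
  assumes hopf: "hopf_superalgebra \<Delta> \<epsilon> S"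
    and comult_gen: "\<And>i j. \<Delta> (gGL i j) = (\<Sum>k\<in>UNIV. gGL i k \<otimes> gGL k j)"
    and counit_gen: "\<And>i j. \<epsilon> (gGL i j) = (if i = j then 1 else 0)"
  defines "\<Delta>P \<equiv> quot_comult prP \<Delta>" and "\<epsilon>P \<equiv> quot_counit prP \<epsilon>" and "SP \<equiv> quot_antipode prP S"
  defines "\<Delta>SP \<equiv> quot_comult prSP \<Delta>P" and "\<epsilon>SP \<equiv> quot_counit prSP \<epsilon>P" and "SSP \<equiv> quot_antipode prSP SP"
  shows "\<exists>\<delta> :: O_U \<Rightarrow> (O_P, O_U) tensor.
     left_coaction \<Delta>P \<epsilon>P SP \<delta> \<and>
     (\<forall>u. map_tensor id Rep_O_U (\<delta> u) = \<Delta>P (Rep_O_U u)) \<and>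
     (\<forall>i\<in>{I3, I4}. \<forall>j\<in>{I1, I2}. \<delta> (tU i j) =
        tP i j \<otimes> 1
        + (\<Sum>a\<in>{I3, I4}. \<Sum>b\<in>{I1, I2}. (gP i a * SP (gP b j)) \<otimes> tU a b)
        + (\<Sum>a\<in>{I3, I4}. \<Sum>b\<in>{I1, I2}. (gP i a * etaP a * SP (gP b j)) \<otimes> ttauU b)) \<and>
     (\<forall>j\<in>{I1, I2}. \<delta> (ttauU j) =
        (\<Sum>a\<in>{I1, I2}. (gP I5 I5 \<otimes> 1)
           * (tauP a \<otimes> 1 + (\<Sum>b\<in>{I3, I4}. xiP b \<otimes> tU b a) + 1 \<otimes> ttauU a)
           * (SP (gP a j) \<otimes> 1))) \<and>
     left_coaction \<Delta>SP \<epsilon>SP SSP (\<lambda>u. map_tensor prSP id (\<delta> u))"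
proof -
  interpret quantum_GL \<Delta> \<epsilon> S
    by (intro quantum_GL.intro quantum_GL_axioms.intro hopf comult_gen counit_gen)
  obtain \<rho> :: "O_P \<Rightarrow> O_P" where \<rho>: "cq_linear \<rho>" "\<And>x. \<rho> x \<in> big_cell" "\<And>u. u \<in> big_cell \<Longrightarrow> \<rho> u = u"
    by (rule big_cell_retraction) blast
  define r where "r x = Abs_O_U (\<rho> x)" for x
  have Rep_r: "Rep_O_U (r x) = \<rho> x" for x
    unfolding r_def by (rule Abs_O_U_inverse[OF \<rho>(2)])
  note Rep = superalg_homD[OF hom_Rep_O_U]
  have r_lin: "cq_linear r"
    by (rule cq_linearI; rule Rep_O_U_inject[THEN iffD1])
      (simp_all only: Rep Rep_r cq_linear_add[OF \<rho>(1)] cq_linear_scale[OF \<rho>(1)])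
  have retract: "r (Rep_O_U u) = u" for u
    by (simp add: r_def \<rho>(3) Rep_O_U Rep_O_U_inverse)
  let ?J = "map_tensor id Rep_O_U :: (O_P, O_U) tensor \<Rightarrow> _"
  note lin = cq_linear_id(1) superalg_hom_linear[OF hom_Rep_O_U]
  note J = superalg_homD[OF map_tensor_superalg_hom[OF superalg_hom_id hom_Rep_O_U]]
    map_tensor_tens[OF lin] id_apply
  have J_tens: "x \<otimes> tP i j \<in> range ?J" if "\<not> upper i" "upper j" for x i j
  proof (rule range_eqI)
    show "x \<otimes> tP i j = ?J (x \<otimes> Abs_O_U (tP i j))"
      by (simp only: J Abs_O_U_inverse[OF big_cell_tP[OF that]])
  qed
  have range: "P.\<Delta>' (Rep_O_U u) \<in> range ?J" for u
  proof -
    note sub = subalgebra_range[OF map_tensor_superalg_hom[OF superalg_hom_id hom_Rep_O_U]]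
    \<comment> \<open>In \<open>comult_tP\<close> the right factors are 1 and entries of t and ttau
      (row I5), so the big cell is a left coideal.\<close>
    have "P.\<Delta>' (tP i j) \<in> range ?J" if ij: "\<not> upper i" "j \<in> {I1, I2}" for i j
    proof -
      have "tP i j \<otimes> 1 = ?J (tP i j \<otimes> 1)" by (simp only: J Rep)
      moreover have "(\<Sum>k\<in>{I3, I4, I5}. \<Sum>b\<in>{I1, I2}. (gP i k * xinv b j) \<otimes> tP k b) \<in> range ?J"
        by (intro subalgebra_sum sub J_tens) auto
      ultimately show ?thesis
        unfolding comult_tP[OF ij] using sub unfolding subalgebra_def by blast
    qed
    then have "big_cell_gens \<subseteq> P.\<Delta>' -` range ?J" by (auto simp: big_cell_gens_eq upper_def)
    from subalgebra_gen_induct[OF subalgebra_vimage[OF PH.comult_hom sub] this Rep_O_U]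
    show ?thesis by simp
  qed
  define \<delta> where "\<delta> u = map_tensor id r (P.\<Delta>' (Rep_O_U u))" for u
  note restrict = PH.left_coaction_restrict[OF hom_Rep_O_U r_lin retract range, folded \<delta>_def]
  have J_inj: "x = y" if "?J x = ?J y" for x y
  proof -
    have "map_tensor id r (?J w) = w" for w :: "(O_P, O_U) tensor"
      by (simp add: map_tensor_compose cq_linear_id r_lin lin(2) retract map_tensor_id)
    then show ?thesis using that by metis
  qed
  have T: "P.\<Delta>' (tP i j) = tP i j \<otimes> 1
      + (\<Sum>a\<in>{I3, I4}. \<Sum>b\<in>{I1, I2}. (gP i a * P.S' (gP b j)) \<otimes> tP a b)
      + (\<Sum>b\<in>{I1, I2}. (gP i I5 * P.S' (gP b j)) \<otimes> ttauP b)"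
    if "\<not> upper i" "j \<in> {I1, I2}" for i j
    using comult_tP[OF that] that(2) by (simp add: antipode_gP tP_I5 add_ac)
  \<comment> \<open>\<open>matrix_rinv\<close> is a choice, so a witness has to be exhibited before
    anything about \<eta> can be derived.\<close>
  have "\<exists>z. \<forall>i\<in>{I3, I4}. \<forall>k\<in>{I3, I4}.
      (\<Sum>j\<in>{I3, I4}. gP i j * z j k) = (if i = k then 1 else 0) \<and>
      (\<Sum>j\<in>{I3, I4}. z i j * gP j k) = (if i = k then 1 else 0)"
    by (intro exI[of _ yinv] ballI conjI yinv_inverse)
  from someI_ex[OF this, folded matrix_rinv_def]
  have y_inv: "(\<Sum>a\<in>{I3, I4}. gP i a * matrix_rinv {I3, I4} gP a k) = (if i = k then 1 else 0)"
    if "i \<in> {I3, I4}" "k \<in> {I3, I4}" for i k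
    using that by blast
  have eta: "(\<Sum>a\<in>{I3, I4}. gP i a * etaP a) = gP i I5" if i: "i \<in> {I3, I4}" for i
  proof -
    have "(\<Sum>a\<in>{I3, I4}. gP i a * etaP a)
        = (\<Sum>k\<in>{I3, I4}. (\<Sum>a\<in>{I3, I4}. gP i a * matrix_rinv {I3, I4} gP a k) * gP k I5)"
      by (simp add: etaP_def distrib_left distrib_right mult.assoc add_ac)
    also have "\<dots> = (\<Sum>k\<in>{I3, I4}. (if i = k then 1 else 0) * gP k I5)"
      by (intro sum.cong refl) (simp only: y_inv[OF i])
    also have "\<dots> = gP i I5" using i by auto
    finally show ?thesis .
  qed
  have t_formula: "\<delta> (tU i j) = tP i j \<otimes> 1
        + (\<Sum>a\<in>{I3, I4}. \<Sum>b\<in>{I1, I2}. (gP i a * P.S' (gP b j)) \<otimes> tU a b)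
        + (\<Sum>a\<in>{I3, I4}. \<Sum>b\<in>{I1, I2}. (gP i a * etaP a * P.S' (gP b j)) \<otimes> ttauU b)"
    if i: "i \<in> {I3, I4}" and j: "j \<in> {I1, I2}" for i j
  proof (rule J_inj)
    \<comment> \<open>Summing over a turns y_ia \<eta>_a into g_i5, the coefficient that \<Delta> t
      actually produces in front of ttau.\<close>
    have "(\<Sum>a\<in>{I3, I4}. \<Sum>b\<in>{I1, I2}. (gP i a * etaP a * P.S' (gP b j)) \<otimes> ttauP b)
        = (\<Sum>b\<in>{I1, I2}. ((\<Sum>a\<in>{I3, I4}. gP i a * etaP a) * P.S' (gP b j)) \<otimes> ttauP b)"
      by (simp add: distrib_right tens_add_left add_ac)
    also have "\<dots> = (\<Sum>b\<in>{I1, I2}. (gP i I5 * P.S' (gP b j)) \<otimes> ttauP b)"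
      by (simp only: eta[OF i])
    finally have e: "(\<Sum>a\<in>{I3, I4}. \<Sum>b\<in>{I1, I2}. (gP i a * etaP a * P.S' (gP b j)) \<otimes> ttauP b) = \<dots>" .
    have "\<not> upper i" using i by auto
    then have "?J (\<delta> (tU i j)) = tP i j \<otimes> 1
      + (\<Sum>a\<in>{I3, I4}. \<Sum>b\<in>{I1, I2}. (gP i a * P.S' (gP b j)) \<otimes> tP a b)
      + (\<Sum>a\<in>{I3, I4}. \<Sum>b\<in>{I1, I2}. (gP i a * etaP a * P.S' (gP b j)) \<otimes> ttauP b)"
      unfolding restrict(1) Rep_tU[OF i j] e by (rule T[OF _ j])
    also have "\<dots> = ?J (tP i j \<otimes> 1
        + (\<Sum>a\<in>{I3, I4}. \<Sum>b\<in>{I1, I2}. (gP i a * P.S' (gP b j)) \<otimes> tU a b)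
        + (\<Sum>a\<in>{I3, I4}. \<Sum>b\<in>{I1, I2}. (gP i a * etaP a * P.S' (gP b j)) \<otimes> ttauU b))"
      unfolding J by (simp add: Rep_tU Rep_ttauU Rep)
    finally show "?J (\<delta> (tU i j)) = \<dots>" .
  qed
  have tau_formula: "\<delta> (ttauU j) = (\<Sum>a\<in>{I1, I2}. (gP I5 I5 \<otimes> 1)
           * (tauP a \<otimes> 1 + (\<Sum>b\<in>{I3, I4}. xiP b \<otimes> tU b a) + 1 \<otimes> ttauU a)
           * (P.S' (gP a j) \<otimes> 1))" if j: "j \<in> {I1, I2}" for j
  proof (rule J_inj)
    \<comment> \<open>Multiplying by d turns \<tau> and \<xi> back into entries of row 5, so d
      \<otimes> 1 can be factored out on the left.\<close>
    have d: "gP I5 I5 * tauP a = gP I5 a" "gP I5 I5 * xiP b = gP I5 b" for a b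
      by (simp_all add: tauP_def xiP_def rinv_d invD2_inverse flip: mult.assoc)
    have "?J (\<delta> (ttauU j)) = (\<Sum>a\<in>{I1, I2}.
        (gP I5 a \<otimes> 1 + (\<Sum>k\<in>{I3, I4, I5}. gP I5 k \<otimes> tP k a)) * (xinv a j \<otimes> 1))"
      unfolding restrict(1) Rep_ttauU[OF j] tP_I5[symmetric]
      by (rule comult_tP_product[OF _ j]) simp
    also have "\<dots> = (\<Sum>a\<in>{I1, I2}. (gP I5 I5 \<otimes> 1)
           * (tauP a \<otimes> 1 + (\<Sum>b\<in>{I3, I4}. xiP b \<otimes> tP b a) + 1 \<otimes> ttauP a)
           * (P.S' (gP a j) \<otimes> 1))"
      using j by (simp add: distrib_left d antipode_gP tP_I5 add_ac)
    also have "\<dots> = ?J (\<Sum>a\<in>{I1, I2}. (gP I5 I5 \<otimes> 1)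
           * (tauP a \<otimes> 1 + (\<Sum>b\<in>{I3, I4}. xiP b \<otimes> tU b a) + 1 \<otimes> ttauU a)
           * (P.S' (gP a j) \<otimes> 1))"
      unfolding J by (simp add: Rep_tU Rep_ttauU Rep)
    finally show "?J (\<delta> (ttauU j)) = \<dots>" .
  qed
  show ?thesis
    unfolding \<Delta>SP_def \<epsilon>SP_def SSP_def \<Delta>P_def \<epsilon>P_def SP_def
    using restrict t_formula tau_formula SP.quot_left_coaction[OF restrict(2)] by blast
qed

end
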